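(* Let $\varphi\in L^{2}(\mathbb{R}^{2n})$ satisfy condition C and $\frac{1}{w_{\varphi}}\in L^{1}(\mathbb{T}^{n})$. If any one of the following equivalent conditions holds: (a) $\{T^{t}_{(k,l)}\varphi:(k,l)\in\mathbb{Z}^{2n}\}$ is Hilbertian; (b) $\|w_{\varphi}\|_{\infty}<\infty$; (c) $\{T^{t}_{(k,l)}\varphi:(k,l)\in\mathbb{Z}^{2n}\}$ is a Bessel sequence; then there exists $\tilde{\varphi}\in V^{t}(\varphi)$, a canonical dual to $\varphi$, such that $\{T^{t}_{(k,l)}\tilde{\varphi}:(k,l)\in\mathbb{Z}^{2n}\}$ is Besselian. Moreover, if $\{T^{t}_{(k,l)}\varphi:(k,l)\in\mathbb{Z}^{2n}\}$ is Besselian and if for each $\psi\in V^{t}(\varphi)$ there exists a sequence $\{c_{k,l}\}$ of complex numbers such that $\psi=\sum_{k,l\in\mathbb{Z}^{n}}c_{k,l}T^{t}_{(k,l)}\varphi$, then $\left\|\frac{1}{w_{\varphi}}\right\|_{\infty}<\infty$.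
   Context: $\mathbb{T}^{n}$ is identified with $[0,1)^{n}$ with Lebesgue measure; $\|\cdot\|_\infty$ is the $L^{\infty}(\mathbb{T}^{n})$ norm. Twisted translation: for $\varphi\in L^{2}(\mathbb{R}^{2n})$ and $(k,l)\in\mathbb{Z}^{2n}$ (with $k,l\in\mathbb{Z}^n$), $T^{t}_{(k,l)}\varphi(x,y)=e^{\pi i(x\cdot l-y\cdot k)}\varphi(x-k,y-l)$, $(x,y)\in\mathbb{R}^{n}\times\mathbb{R}^{n}$. $V^{t}(\varphi)$ is the closed linear span of $\{T^{t}_{(k,l)}\varphi:(k,l)\in\mathbb{Z}^{2n}\}$ in $L^{2}(\mathbb{R}^{2n})$. A canonical dual to $\varphi$ is a function $\tilde\varphi\in L^{2}(\mathbb{R}^{2n})$ with $\langle T^{t}_{(k,l)}\tilde{\varphi},\varphi\rangle=\delta_{(k,l),(0,0)}$ for all $k,l\in\mathbb{Z}^{n}$. Kernel of the Weyl transform: for $f\in L^{2}(\mathbb{R}^{2n})$, $K_{f}(\xi,\eta)=\int_{\mathbb{R}^{n}}f(x,\eta-\xi)e^{i\pi x\cdot(\xi+\eta)}dx$ (interpreted in the $L^{2}$ sense as a partial Fourier transform; $f\mapsto K_f$ is an isometry of $L^{2}(\mathbb{R}^{2n})$). $w_{\varphi}(\xi)=\sum_{m\in\mathbb{Z}^{n}}\int_{\mathbb{R}^{n}}|K_{\varphi}(\xi+m,\eta)|^{2}d\eta$ for $\xi\in\mathbb{R}^{n}$; this is $\mathbb{Z}^{n}$-periodic and is regarded also as a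 function on $\mathbb{T}^{n}$; $1/w_\varphi$ is $+\infty$ where $w_\varphi=0$. Condition C: $\varphi$ satisfies condition C if for every $l\in\mathbb{Z}^{n}\setminus\{0\}$, $\sum_{m\in\mathbb{Z}^{n}}\int_{\mathbb{R}^{n}}K_{\varphi}(\xi+m,\eta)\overline{K_{\varphi}(\xi+m+l,\eta)}\,d\eta=0$ for a.e. $\xi\in\mathbb{T}^{n}$. A family $\{f_{j}:j\in\mathbb{Z}^{d}\}$ in a Hilbert space $\mathcal{H}$ is Hilbertian if $\{c_{j}\}\in\ell^{2}(\mathbb{Z}^{d})$ implies that $\sum_{j\in\mathbb{Z}^{d}}c_{j}f_{j}$ converges; it is Besselian if convergence of $\sum_{j\in\mathbb{Z}^{d}}c_{j}f_{j}$ implies $\{c_{j}\}\in\ell^{2}(\mathbb{Z}^{d})$; it is a Bessel sequence if there is $B>0$ with $\sum_{j}|\langle f,f_{j}\rangle|^{2}\le B\|f\|^{2}$ for all $f\in\mathcal{H}$. Convergence of a series over $\mathbb{Z}^{d}$ means norm convergence in $\mathcal{H}$ of the partial sums over $\{j:\max_i|j_i|\le N\}$ as $N\to\infty$. *)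

theory Defs
  imports "HOL-Probability.Essential_Supremum"
begin

text \<open>Elements of \<open>L\<^sup>2\<close> are represented by Borel measurable functions; every
  Lebesgue measurable function agrees almost everywhere with a Borel one.\<close>

definition L2 :: "('a::euclidean_space \<Rightarrow> complex) set" where
  "L2 = {f. f \<in> borel_measurable lborel \<and> integrable lborel (\<lambda>z. (cmod (f z))\<^sup>2)}"

definition L2_inner :: "('a::euclidean_space \<Rightarrow> complex) \<Rightarrow> ('a \<Rightarrow> complex) \<Rightarrow> complex" where
  "L2_inner f g = (LINT z|lborel. f z * cnj (g z))"

definition L2_norm :: "('a::euclidean_space \<Rightarrow> complex) \<Rightarrow> real" where
  "L2_norm f = sqrt (LINT z|lborel. (cmod (f z))\<^sup>2)"

text \<open>Norm convergence. The extended nonnegative integral has the value \<open>\<infinity>\<close>, not a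
  default value, when the difference is not square integrable.\<close>

definition L2_tendsto :: "(nat \<Rightarrow> 'a::euclidean_space \<Rightarrow> complex) \<Rightarrow> ('a \<Rightarrow> complex) \<Rightarrow> bool" where
  "L2_tendsto F f \<longleftrightarrow>
     (\<lambda>N. \<integral>\<^sup>+ z. ennreal ((cmod (F N z - f z))\<^sup>2) \<partial>lborel) \<longlonglongrightarrow> 0"

text \<open>\<open>\<int>\<^bsup>2n\<^esup>\<close> is written as \<open>\<int>\<^sup>n \<times> \<int>\<^sup>n\<close>, so the cube of side \<open>2N\<close> bounds the
  entries of both components.\<close>

definition index_cube :: "nat \<Rightarrow> ((int^'n) \<times> (int^'n)) set" where
  "index_cube N = {(k, l). \<forall>i. \<bar>k $ i\<bar> \<le> int N \<and> \<bar>l $ i\<bar> \<le> int N}"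

definition L2_series ::
  "((int^'n) \<times> (int^'n) \<Rightarrow> complex) \<Rightarrow> ((int^'n) \<times> (int^'n) \<Rightarrow> 'a::euclidean_space \<Rightarrow> complex)
     \<Rightarrow> ('a \<Rightarrow> complex) \<Rightarrow> bool" where
  "L2_series c F f \<longleftrightarrow> L2_tendsto (\<lambda>N z. \<Sum>j\<in>index_cube N. c j * F j z) f"

definition L2_series_converges ::
  "((int^'n) \<times> (int^'n) \<Rightarrow> complex) \<Rightarrow> ((int^'n) \<times> (int^'n) \<Rightarrow> 'a::euclidean_space \<Rightarrow> complex)
     \<Rightarrow> bool" where
  "L2_series_converges c F \<longleftrightarrow> (\<exists>f\<in>L2. L2_series c F f)"

definition ell2 :: "('j \<Rightarrow> complex) set" where
  "ell2 = {c. (\<lambda>j. (cmod (c j))\<^sup>2) summable_on UNIV}"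

definition hilbertian ::
  "((int^'n) \<times> (int^'n) \<Rightarrow> 'a::euclidean_space \<Rightarrow> complex) \<Rightarrow> bool" where
  "hilbertian F \<longleftrightarrow> (\<forall>c. c \<in> ell2 \<longrightarrow> L2_series_converges c F)"

definition besselian ::
  "((int^'n) \<times> (int^'n) \<Rightarrow> 'a::euclidean_space \<Rightarrow> complex) \<Rightarrow> bool" where
  "besselian F \<longleftrightarrow> (\<forall>c. L2_series_converges c F \<longrightarrow> c \<in> ell2)"

definition bessel_sequence ::
  "((int^'n) \<times> (int^'n) \<Rightarrow> 'a::euclidean_space \<Rightarrow> complex) \<Rightarrow> bool" where
  "bessel_sequence F \<longleftrightarrow>
     (\<exists>B::real. B > 0 \<and> (\<forall>f\<in>L2.
        (\<Sum>\<^sub>\<infinity>j\<in>UNIV. ennreal ((cmod (L2_inner f (F j)))\<^sup>2)) \<le> ennreal (B * (L2_norm f)\<^sup>2)))"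

definition rvec :: "int^'n \<Rightarrow> real^'n" where
  "rvec k = (\<chi> i. real_of_int (k $ i))"

definition twisted_translate ::
  "(int^'n) \<times> (int^'n) \<Rightarrow> ((real^'n) \<times> (real^'n) \<Rightarrow> complex) \<Rightarrow> (real^'n) \<times> (real^'n) \<Rightarrow> complex" where
  "twisted_translate = (\<lambda>(k, l) \<phi> (x, y).
     exp (of_real pi * \<i> * of_real (x \<bullet> rvec l - y \<bullet> rvec k)) * \<phi> (x - rvec k, y - rvec l))"

abbreviation twisted_system ::
  "((real^'n) \<times> (real^'n) \<Rightarrow> complex) \<Rightarrow> (int^'n) \<times> (int^'n) \<Rightarrow> (real^'n) \<times> (real^'n) \<Rightarrow> complex" where
  "twisted_system \<phi> \<equiv> (\<lambda>j. twisted_translate j \<phi>)"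

definition twisted_span ::
  "((real^'n) \<times> (real^'n) \<Rightarrow> complex) \<Rightarrow> ((real^'n) \<times> (real^'n) \<Rightarrow> complex) set" where
  "twisted_span \<phi> =
     {g. \<exists>J c. finite J \<and> g = (\<lambda>z. \<Sum>j\<in>J. c j * twisted_translate j \<phi> z)}"

definition twisted_closed_span ::
  "((real^'n) \<times> (real^'n) \<Rightarrow> complex) \<Rightarrow> ((real^'n) \<times> (real^'n) \<Rightarrow> complex) set" where
  "twisted_closed_span \<phi> =
     {f \<in> L2. \<exists>G. (\<forall>N. G N \<in> twisted_span \<phi>) \<and> L2_tendsto G f}"

definition canonical_dual ::
  "((real^'n) \<times> (real^'n) \<Rightarrow> complex) \<Rightarrow> ((real^'n) \<times> (real^'n) \<Rightarrow> complex) \<Rightarrow> bool" where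
  "canonical_dual \<phi> \<psi> \<longleftrightarrow> \<psi> \<in> L2 \<and>
     (\<forall>k l. L2_inner (twisted_translate (k, l) \<psi>) \<phi> = (if (k, l) = (0, 0) then 1 else 0))"

text \<open>The integral over \<open>x\<close> converges absolutely once \<open>x\<close> is restricted to a ball (for
  almost every \<open>\<eta> - \<xi>\<close>); the kernel is the \<open>L\<^sup>2\<close> limit as the radius grows, a function that
  is determined up to a null set.\<close>

definition truncated_weyl_kernel ::
  "((real^'n) \<times> (real^'n) \<Rightarrow> complex) \<Rightarrow> nat \<Rightarrow> (real^'n) \<times> (real^'n) \<Rightarrow> complex" where
  "truncated_weyl_kernel f N = (\<lambda>(\<xi>, \<eta>).
     LINT x:cball 0 (real N)|lborel.
       f (x, \<eta> - \<xi>) * exp (\<i> * of_real pi * of_real (x \<bullet> (\<xi> + \<eta>))))"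

definition weyl_kernel ::
  "((real^'n) \<times> (real^'n) \<Rightarrow> complex) \<Rightarrow> (real^'n) \<times> (real^'n) \<Rightarrow> complex" where
  "weyl_kernel f = (SOME K. K \<in> L2 \<and> L2_tendsto (truncated_weyl_kernel f) K)"

definition unit_cube :: "(real^'n) set" where
  "unit_cube = {\<xi>. \<forall>i. 0 \<le> \<xi> $ i \<and> \<xi> $ i < 1}"

abbreviation torus_measure :: "(real^'n) measure" where
  "torus_measure \<equiv> restrict_space lborel unit_cube"

definition weight :: "((real^'n) \<times> (real^'n) \<Rightarrow> complex) \<Rightarrow> real^'n \<Rightarrow> ennreal" where
  "weight \<phi> \<xi> =
     (\<Sum>\<^sub>\<infinity>m\<in>UNIV. \<integral>\<^sup>+ \<eta>. ennreal ((cmod (weyl_kernel \<phi> (\<xi> + rvec m, \<eta>)))\<^sup>2) \<partial>lborel)"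

text \<open>The series converges absolutely for almost every \<open>\<xi>\<close>, by Cauchy--Schwarz and because
  the weight is finite almost everywhere; so \<open>has_sum\<close> agrees with summation over cubes.\<close>

definition condition_C :: "((real^'n) \<times> (real^'n) \<Rightarrow> complex) \<Rightarrow> bool" where
  "condition_C \<phi> \<longleftrightarrow> (\<forall>l. l \<noteq> 0 \<longrightarrow> (AE \<xi> in torus_measure.
     ((\<lambda>m. LINT \<eta>|lborel. weyl_kernel \<phi> (\<xi> + rvec m, \<eta>)
              * cnj (weyl_kernel \<phi> (\<xi> + rvec m + rvec l, \<eta>))) has_sum 0) UNIV))"

end

theory Submission
  imports Defs
begin

text \<open>
  The Weyl transform carries \<open>\<phi>\<close> isometrically to its kernel \<open>K\<close>, and it carries the twisted
  translation by \<open>(k, l)\<close> to a shift of the first variable by \<open>l\<close> followed by multiplication with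
  a phase and the character \<open>exp (2 \<pi> \<i> k \<bullet> \<xi>)\<close> (\<open>weyl_pair_twisted_translate\<close>). A finite combination
  of the translates with coefficients \<open>c\<close> therefore has the kernel \<open>\<Sum>l. P\<^sub>l \<xi> * K (\<xi> + l, \<eta>)\<close>,
  where \<open>P\<^sub>l\<close> is the trigonometric polynomial whose coefficients are, up to phases, those in the
  row \<open>l\<close> of \<open>c\<close>. Condition C says that for almost every \<open>\<xi>\<close> the vectors \<open>(K (\<xi> + m + l, \<cdot>))\<^sub>m\<close>
  with different \<open>l\<close> are orthogonal; each has the squared norm \<open>w \<xi>\<close>. Hence the squared norm of the
  combination is the sum over \<open>l\<close> of the integrals of \<open>|P\<^sub>l|\<^sup>2 w\<close> over the torus (\<open>norm_lin_comb\<close>).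
  Each row of the system is thus a copy of the characters in \<open>L\<^sup>2(w)\<close>, different rows are
  orthogonal, and the theorem compares \<open>L\<^sup>2(w)\<close> with the unweighted \<open>L\<^sup>2\<close> of the torus.

  If \<open>w \<le> b\<close> almost everywhere, combinations have squared norm at most \<open>b \<Sum>|c\<^sub>j|\<^sup>2\<close>. By duality this
  is the Bessel property, and the Bessel property returns the same bound, which makes series with
  square summable coefficients converge. If all these series converge, then every square integrable
  \<open>C\<close> on the torus lies in \<open>L\<^sup>2(w)\<close>, by Fatou's lemma for its partial Fourier sums; this forces
  \<open>w\<close> to be bounded (\<open>essentially_bounded_if_L1_multiplier\<close>). So the three conditions are equivalent.

  Because \<open>|1/w|\<^sup>2 w = 1/w\<close> is integrable, \<open>1/w\<close> belongs to \<open>L\<^sup>2(w)\<close>. The element \<open>\<psi>\<close> of the closed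
  span with symbol \<open>1/w\<close> in the row \<open>l = 0\<close> is a canonical dual: its inner products with the
  translates of \<open>\<phi>\<close> are the Fourier coefficients of \<open>1/w \<cdot> w = 1\<close>. The coefficients of a convergent
  series of translates of \<open>\<psi>\<close> are the inner products of its sum with the translates of \<open>\<phi>\<close>, and
  they are square summable when the translates of \<open>\<phi>\<close> form a Bessel sequence.

  For the last assertion, take \<open>C\<close> in \<open>L\<^sup>2(w)\<close> and expand the element of the closed span with
  symbol \<open>C\<close>. The Besselian property makes the coefficients square summable, the row \<open>l = 0\<close> of the
  expansion converges to \<open>C\<close> in \<open>L\<^sup>2(w)\<close>, and Fatou's lemma shows that \<open>C\<close> is square integrable. So
  \<open>L\<^sup>2(w)\<close> is contained in \<open>L\<^sup>2\<close>, and \<open>1/w\<close> is bounded.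

  Two analytic facts are established on the way. Plancherel's identity for functions of bounded
  support, which yields the Weyl kernel and its isometry, follows from Parseval's identity on the
  torus by evaluating the norm of the Zak transform in two orders of integration. Density of the
  trigonometric polynomials in \<open>L\<^sup>2\<close> of a finite measure on the torus comes from the
  Stone--Weierstrass theorem and a Dynkin argument (\<open>trig_polys_dense\<close>).
\<close>

section \<open>Square integrable functions on a measure space\<close>

definition l2sq :: "'a measure \<Rightarrow> ('a \<Rightarrow> complex) \<Rightarrow> ennreal" where
  "l2sq M f = (\<integral>\<^sup>+ z. ennreal ((cmod (f z))\<^sup>2) \<partial>M)"

lemma l2sq_cong_AE: "AE z in M. f z = g z \<Longrightarrow> l2sq M f = l2sq M g"
  unfolding l2sq_def by (rule nn_integral_cong_AE) auto

lemma l2sq_mono_AE: "AE z in M. cmod (f z) \<le> cmod (g z) \<Longrightarrow> l2sq M f \<le> l2sq M g"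
  unfolding l2sq_def by (rule nn_integral_mono_AE) (auto intro!: ennreal_leI power_mono)

lemma l2sq_zero [simp]: "l2sq M (\<lambda>z. 0) = 0"
  by (simp add: l2sq_def)

lemma l2sq_minus_commute: "l2sq M (\<lambda>z. f z - g z) = l2sq M (\<lambda>z. g z - f z)"
  by (simp add: l2sq_def norm_minus_commute)

lemma l2sq_cmult:
  assumes [measurable]: "f \<in> borel_measurable M"
  shows "l2sq M (\<lambda>z. c * f z) = ennreal ((cmod c)\<^sup>2) * l2sq M f"
  unfolding l2sq_def
  by (simp add: norm_mult power_mult_distrib ennreal_mult nn_integral_cmult)

lemma l2sq_unimodular:
  "(\<And>z. cmod (u z) = 1) \<Longrightarrow> l2sq M (\<lambda>z. u z * f z) = l2sq M f"
  unfolding l2sq_def by (simp add: norm_mult)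

lemma cmod_add_power2_le:
  fixes a :: real
  assumes "a > 0"
  shows "(cmod (x + y))\<^sup>2 \<le> (1 + a) * (cmod x)\<^sup>2 + (1 + 1 / a) * (cmod y)\<^sup>2"
proof -
  have "(cmod (x + y))\<^sup>2 \<le> (cmod x + cmod y)\<^sup>2"
    by (intro power_mono norm_triangle_ineq) auto
  also have "\<dots> = (cmod x)\<^sup>2 + (cmod y)\<^sup>2 + 2 * (cmod x * cmod y)"
    by (simp add: power2_sum)
  also have "2 * (cmod x * cmod y) \<le> a * (cmod x)\<^sup>2 + (1 / a) * (cmod y)\<^sup>2"
  proof -
    have "0 \<le> (sqrt a * cmod x - cmod y / sqrt a)\<^sup>2" by simp
    also have "\<dots> = a * (cmod x)\<^sup>2 + (cmod y)\<^sup>2 / a - 2 * (cmod x * cmod y)"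
      using assms by (simp add: power2_diff power_mult_distrib power_divide)
    finally show ?thesis by simp
  qed
  finally show ?thesis by (simp add: algebra_simps)
qed

text \<open>This weighted form of the triangle inequality for squares replaces Minkowski's
  inequality: letting \<open>a\<close> tend to \<open>0\<close> it still yields continuity of the norm.\<close>

lemma l2sq_add_weighted:
  fixes a :: real
  assumes [measurable]: "f \<in> borel_measurable M" "g \<in> borel_measurable M" and a: "a > 0"
  shows "l2sq M (\<lambda>z. f z + g z)
    \<le> ennreal (1 + a) * l2sq M f + ennreal (1 + 1 / a) * l2sq M g"
proof -
  have "l2sq M (\<lambda>z. f z + g z)
      \<le> (\<integral>\<^sup>+ z. ennreal (1 + a) * ennreal ((cmod (f z))\<^sup>2)
            + ennreal (1 + 1 / a) * ennreal ((cmod (g z))\<^sup>2) \<partial>M)"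
    unfolding l2sq_def
    using cmod_add_power2_le[OF a] a
    by (intro nn_integral_mono) (simp flip: ennreal_mult ennreal_plus add: ennreal_leI)
  also have "\<dots> = ennreal (1 + a) * l2sq M f + ennreal (1 + 1 / a) * l2sq M g"
    unfolding l2sq_def by (subst nn_integral_add) (simp_all add: nn_integral_cmult)
  finally show ?thesis .
qed

lemma l2sq_add_le:
  assumes "f \<in> borel_measurable M" "g \<in> borel_measurable M"
  shows "l2sq M (\<lambda>z. f z + g z) \<le> 2 * l2sq M f + 2 * l2sq M g"
  using l2sq_add_weighted[OF assms, of 1] by simp

lemma l2sq_triangle:
  assumes "f \<in> borel_measurable M" "g \<in> borel_measurable M" "h \<in> borel_measurable M"
  shows "l2sq M (\<lambda>z. f z - h z) \<le> 2 * l2sq M (\<lambda>z. f z - g z) + 2 * l2sq M (\<lambda>z. g z - h z)"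
  using l2sq_add_le[of "\<lambda>z. f z - g z" M "\<lambda>z. g z - h z"] assms by simp

lemma tendsto_0_ennreal_le:
  fixes f g :: "'i \<Rightarrow> ennreal"
  assumes "(g \<longlongrightarrow> 0) F" "eventually (\<lambda>n. f n \<le> g n) F"
  shows "(f \<longlongrightarrow> 0) F"
  by (rule tendsto_sandwich[OF _ assms(2) tendsto_const assms(1)]) simp

lemma tendsto_0_ennreal_2_plus_2:
  fixes f g :: "'i \<Rightarrow> ennreal"
  assumes "(f \<longlongrightarrow> 0) F" "(g \<longlongrightarrow> 0) F"
  shows "((\<lambda>n. 2 * f n + 2 * g n) \<longlongrightarrow> 0) F"
proof -
  have "((\<lambda>n. 2 * f n + 2 * g n) \<longlongrightarrow> 2 * 0 + 2 * 0) F"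
    by (intro tendsto_add ennreal_tendsto_cmult assms) auto
  then show ?thesis by simp
qed

lemma l2_tendsto_triangle:
  assumes "\<And>n. F n \<in> borel_measurable M" "\<And>n. G n \<in> borel_measurable M"
    "h \<in> borel_measurable M"
    and "(\<lambda>n. l2sq M (\<lambda>z. F n z - G n z)) \<longlonglongrightarrow> 0"
    and "(\<lambda>n. l2sq M (\<lambda>z. G n z - h z)) \<longlonglongrightarrow> 0"
  shows "(\<lambda>n. l2sq M (\<lambda>z. F n z - h z)) \<longlonglongrightarrow> 0"
  by (rule tendsto_0_ennreal_le[OF tendsto_0_ennreal_2_plus_2[OF assms(4,5)]])
     (intro always_eventually allI l2sq_triangle assms)

lemma l2_tendsto_add:
  assumes "\<And>n. F n \<in> borel_measurable M" "\<And>n. G n \<in> borel_measurable M"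
    and "(\<lambda>n. l2sq M (F n)) \<longlonglongrightarrow> 0" and "(\<lambda>n. l2sq M (G n)) \<longlonglongrightarrow> 0"
  shows "(\<lambda>n. l2sq M (\<lambda>z. F n z + G n z)) \<longlonglongrightarrow> 0"
  by (rule tendsto_0_ennreal_le[OF tendsto_0_ennreal_2_plus_2[OF assms(3,4)]])
     (intro always_eventually allI l2sq_add_le assms)

lemma l2_tendsto_cmult:
  assumes "\<And>n. F n \<in> borel_measurable M" and "(\<lambda>n. l2sq M (F n)) \<longlonglongrightarrow> 0"
  shows "(\<lambda>n. l2sq M (\<lambda>z. c * F n z)) \<longlonglongrightarrow> 0"
proof -
  have "(\<lambda>n. ennreal ((cmod c)\<^sup>2) * l2sq M (F n)) \<longlonglongrightarrow> ennreal ((cmod c)\<^sup>2) * 0"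
    by (intro ennreal_tendsto_cmult assms) auto
  then show ?thesis using assms(1) by (simp add: l2sq_cmult)
qed

lemma l2_tendsto_sum:
  assumes "finite J" "\<And>j n. j \<in> J \<Longrightarrow> F n j \<in> borel_measurable M"
    and "\<And>j. j \<in> J \<Longrightarrow> (\<lambda>n. l2sq M (F n j)) \<longlonglongrightarrow> 0"
  shows "(\<lambda>n. l2sq M (\<lambda>z. \<Sum>j\<in>J. c j * F n j z)) \<longlonglongrightarrow> 0"
  using assms
proof (induction J rule: finite_induct)
  case (insert j J)
  have "(\<lambda>n. l2sq M (\<lambda>z. c j * F n j z + (\<Sum>j\<in>J. c j * F n j z))) \<longlonglongrightarrow> 0"
    using insert by (intro l2_tendsto_add l2_tendsto_cmult) auto
  then show ?case using insert by simp
qed simp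

lemma l2_tendsto_subseq_AE:
  assumes [measurable]: "\<And>n. F n \<in> borel_measurable M" "f \<in> borel_measurable M"
    and lim: "(\<lambda>n. l2sq M (\<lambda>z. F n z - f z)) \<longlonglongrightarrow> 0"
  obtains r :: "nat \<Rightarrow> nat" where "strict_mono r" "AE z in M. (\<lambda>n. F (r n) z) \<longlonglongrightarrow> f z"
proof -
  have "eventually (\<lambda>n. l2sq M (\<lambda>z. F n z - f z) < 1) sequentially"
    using order_tendstoD(2)[OF lim, of 1] by simp
  then obtain N where N: "\<And>n. n \<ge> N \<Longrightarrow> l2sq M (\<lambda>z. F n z - f z) < 1"
    by (auto simp: eventually_sequentially)
  define u where "u n z = (cmod (F (n + N) z - f z))\<^sup>2" for n z
  have [measurable]: "u n \<in> borel_measurable M" for n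
    unfolding u_def by measurable
  have nn: "(\<integral>\<^sup>+ z. ennreal (u n z) \<partial>M) = l2sq M (\<lambda>z. F (n + N) z - f z)" for n
    by (simp add: u_def l2sq_def)
  have int: "integrable M (u n)" for n
    using N[of "n + N"] nn[of n]
    by (intro integrableI_nonneg) (auto simp: u_def intro: order_less_trans)
  have ie: "ennreal (LINT z|M. norm (u n z)) = l2sq M (\<lambda>z. F (n + N) z - f z)" for n
  proof -
    have "(\<integral>\<^sup>+ z. ennreal (u n z) \<partial>M) = ennreal (LINT z|M. u n z)"
      by (rule nn_integral_eq_integral[OF int]) (simp add: u_def)
    then show ?thesis using nn[of n] by (simp add: u_def)
  qed
  have "(\<lambda>n. ennreal (LINT z|M. norm (u n z))) \<longlonglongrightarrow> ennreal 0"
    unfolding ie using LIMSEQ_ignore_initial_segment[OF lim, of N] by simp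
  then have "(\<lambda>n. LINT z|M. norm (u n z)) \<longlonglongrightarrow> 0"
    by (subst (asm) tendsto_ennreal_iff) auto
  from tendsto_L1_AE_subseq[OF int this] obtain r where r: "strict_mono (r :: nat \<Rightarrow> nat)"
    and ae: "AE z in M. (\<lambda>n. u (r n) z) \<longlonglongrightarrow> 0" by auto
  show ?thesis
  proof
    show "strict_mono (\<lambda>n. r n + N)"
      using r by (simp add: strict_mono_def)
    show "AE z in M. (\<lambda>n. F (r n + N) z) \<longlonglongrightarrow> f z"
      using ae
    proof eventually_elim
      case (elim z)
      have "(\<lambda>n. cmod (F (r n + N) z - f z)) \<longlonglongrightarrow> 0"
        using tendsto_real_sqrt[OF elim] by (simp add: u_def)
      then show ?case by (simp add: LIM_zero_cancel tendsto_norm_zero_iff)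
    qed
  qed
qed

text \<open>Only almost everywhere convergence enters. So a sequence that converges in the norm of one
  weight, along a subsequence also almost everywhere, passes its bounds in the norm of another
  weight on to its limit; this is how weighted and unweighted norms are compared later.\<close>

lemma l2_Fatou:
  assumes [measurable]: "\<And>n. F n \<in> borel_measurable M" "f \<in> borel_measurable M"
    and ae: "AE z in M. (\<lambda>n. F n z) \<longlonglongrightarrow> f z"
    and bd: "\<And>n. l2sq M (F n) \<le> C"
  shows "l2sq M f \<le> C"
proof -
  have "l2sq M f = (\<integral>\<^sup>+ z. liminf (\<lambda>n. ennreal ((cmod (F n z))\<^sup>2)) \<partial>M)"
    unfolding l2sq_def
  proof (rule nn_integral_cong_AE, use ae in eventually_elim)
    case (elim z)
    have "(\<lambda>n. ennreal ((cmod (F n z))\<^sup>2)) \<longlonglongrightarrow> ennreal ((cmod (f z))\<^sup>2)"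
      by (intro tendsto_ennrealI tendsto_intros elim)
    then show ?case by (rule lim_imp_Liminf[OF trivial_limit_sequentially, symmetric])
  qed
  also have "\<dots> \<le> liminf (\<lambda>n. l2sq M (F n))"
    unfolding l2sq_def by (rule nn_integral_liminf) simp
  also have "\<dots> \<le> C"
    using bd by (intro Liminf_le) (auto intro!: always_eventually)
  finally show ?thesis .
qed

text \<open>Riesz--Fischer. Along a subsequence the squared norms of the increments are at most \<open>8\<^sup>-\<^sup>k\<close>, so that
  \<open>\<Sum>k. 4\<^sup>k |increment|\<^sup>2\<close> has finite integral; hence the increments are summable almost
  everywhere.\<close>

lemma l2_complete:
  assumes [measurable]: "\<And>n. F n \<in> borel_measurable M"
    and cauchy: "\<And>e::real. e > 0 \<Longrightarrow>
      \<exists>N. \<forall>m\<ge>N. \<forall>n\<ge>N. l2sq M (\<lambda>z. F m z - F n z) \<le> ennreal e"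
  obtains f where "f \<in> borel_measurable M" "(\<lambda>n. l2sq M (\<lambda>z. F n z - f z)) \<longlonglongrightarrow> 0"
proof -
  have "\<exists>N. \<forall>m\<ge>N. \<forall>n\<ge>N. l2sq M (\<lambda>z. F m z - F n z) \<le> ennreal ((1/8)^k)" for k :: nat
    by (rule cauchy) simp
  then obtain N where N: "\<And>k m n. m \<ge> N k \<Longrightarrow> n \<ge> N k \<Longrightarrow>
      l2sq M (\<lambda>z. F m z - F n z) \<le> ennreal ((1/8)^k)"
    by metis
  define r where "r k = k + (\<Sum>i\<le>k. N i)" for k
  have r1: "r k \<ge> N k" for k
    unfolding r_def by (intro trans_le_add2 member_le_sum) auto
  have r2: "r (Suc k) \<ge> r k" for k
    unfolding r_def by simp
  define D where "D k z = cmod (F (r (Suc k)) z - F (r k) z)" for k z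
  have [measurable]: "D k \<in> borel_measurable M" for k
    unfolding D_def by measurable
  have "(\<integral>\<^sup>+ z. (\<Sum>k. ennreal (4^k * (D k z)\<^sup>2)) \<partial>M)
      = (\<Sum>k. \<integral>\<^sup>+ z. ennreal (4^k * (D k z)\<^sup>2) \<partial>M)"
    by (rule nn_integral_suminf) simp
  also have "\<dots> \<le> (\<Sum>k. ennreal ((1/2)^k))"
  proof (rule suminf_le)
    fix k
    have "(\<integral>\<^sup>+ z. ennreal (4^k * (D k z)\<^sup>2) \<partial>M)
        = ennreal (4^k) * l2sq M (\<lambda>z. F (r (Suc k)) z - F (r k) z)"
      by (simp add: l2sq_def D_def ennreal_mult nn_integral_cmult)
    also have "\<dots> \<le> ennreal (4^k) * ennreal ((1/8)^k)"
      by (intro mult_left_mono N) (use r1[of k] r2[of k] in auto)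
    also have "\<dots> = ennreal ((1/2)^k)"
      by (simp flip: ennreal_mult power_mult_distrib)
    finally show "(\<integral>\<^sup>+ z. ennreal (4^k * (D k z)\<^sup>2) \<partial>M) \<le> ennreal ((1/2)^k)" .
  qed auto
  also have "\<dots> < top"
    by (subst suminf_ennreal2) (auto intro!: summable_geometric)
  finally have "AE z in M. (\<Sum>k. ennreal (4^k * (D k z)\<^sup>2)) \<noteq> \<infinity>"
    by (intro nn_integral_PInf_AE) auto
  then have conv: "AE z in M. convergent (\<lambda>k. F (r k) z)"
  proof eventually_elim
    case (elim z)
    have sm: "summable (\<lambda>k. 4^k * (D k z)\<^sup>2)"
      using elim by (intro summable_suminf_not_top) auto
    then have "(\<lambda>k. 4^k * (D k z)\<^sup>2) \<longlonglongrightarrow> 0" by (rule summable_LIMSEQ_zero)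
    then have "Bseq (\<lambda>k. 4^k * (D k z)\<^sup>2)" by (intro convergent_imp_Bseq) (auto simp: convergent_def)
    then obtain C where C: "C > 0" "\<And>k. norm (4^k * (D k z)\<^sup>2) \<le> C"
      by (auto simp: Bseq_def)
    have four: "(4::real)^k = (2^k)\<^sup>2" for k :: nat
      by (simp add: power2_eq_square flip: power_mult_distrib)
    have "norm (F (r (Suc k)) z - F (r k) z) \<le> sqrt C * (1/2)^k" for k
    proof -
      have "(2^k * D k z)\<^sup>2 \<le> C"
        using C(2)[of k] by (simp add: power_mult_distrib abs_mult four)
      then have "2^k * D k z \<le> sqrt C" by (rule real_le_rsqrt)
      then show ?thesis by (simp add: D_def field_simps)
    qed
    then have "summable (\<lambda>k. F (r (Suc k)) z - F (r k) z)"
      by (intro summable_comparison_test'[OF summable_mult[OF summable_geometric], of _ 0]) auto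
    then have "convergent (\<lambda>n. \<Sum>k<n. F (r (Suc k)) z - F (r k) z)"
      by (simp add: summable_iff_convergent)
    then have "convergent (\<lambda>n. F (r n) z - F (r 0) z)"
      using sum_lessThan_telescope[of "\<lambda>k. F (r k) z"] by simp
    then have "convergent (\<lambda>n. (F (r n) z - F (r 0) z) + F (r 0) z)"
      by (intro convergent_add convergent_const)
    then show ?case by simp
  qed
  define f where "f z = lim (\<lambda>k. F (r k) z)" for z
  have fm [measurable]: "f \<in> borel_measurable M"
    unfolding f_def by measurable
  have lim: "AE z in M. (\<lambda>k. F (r k) z) \<longlonglongrightarrow> f z"
    using conv by eventually_elim (simp add: f_def convergent_LIMSEQ_iff)
  have "\<forall>\<^sub>F n in sequentially. l2sq M (\<lambda>z. F n z - f z) < e" if e: "e > 0" for e :: ennreal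
  proof -
    obtain d where d: "d > 0" "ennreal d < e"
    proof -
      obtain y where y: "0 < y" "y < e" using dense[OF e] by auto
      then obtain d where "y = ennreal d" "d \<ge> 0" by (cases y) auto
      then show ?thesis using y that[of d] by simp
    qed
    obtain N' where N': "\<And>m n. m \<ge> N' \<Longrightarrow> n \<ge> N' \<Longrightarrow> l2sq M (\<lambda>z. F m z - F n z) \<le> ennreal d"
      using cauchy[OF d(1)] by metis
    have "l2sq M (\<lambda>z. F n z - f z) \<le> ennreal d" if n: "n \<ge> N'" for n
    proof (rule l2_Fatou[where F = "\<lambda>k z. F n z - F (r (k + N')) z"])
      show "AE z in M. (\<lambda>k. F n z - F (r (k + N')) z) \<longlonglongrightarrow> F n z - f z"
        using lim
      proof eventually_elim
        case (elim z)
        show ?case by (intro tendsto_intros LIMSEQ_ignore_initial_segment[OF elim])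
      qed
      show "l2sq M (\<lambda>z. F n z - F (r (k + N')) z) \<le> ennreal d" for k
        using n by (intro N') (auto simp: r_def)
    qed auto
    then show ?thesis using d(2) by (auto simp: eventually_sequentially intro: le_less_trans)
  qed
  then have "(\<lambda>n. l2sq M (\<lambda>z. F n z - f z)) \<longlonglongrightarrow> 0"
    by (intro order_tendstoI) auto
  with fm show ?thesis by (rule that)
qed

lemma l2sq_le_of_tendsto:
  assumes [measurable]: "\<And>n. F n \<in> borel_measurable M" "f \<in> borel_measurable M"
    and lim: "(\<lambda>n. l2sq M (\<lambda>z. F n z - f z)) \<longlonglongrightarrow> 0"
    and bd: "\<And>n. l2sq M (F n) \<le> C"
  shows "l2sq M f \<le> C"
proof -
  obtain r :: "nat \<Rightarrow> nat" where r: "strict_mono r" "AE z in M. (\<lambda>n. F (r n) z) \<longlonglongrightarrow> f z"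
    by (rule l2_tendsto_subseq_AE[OF assms(1,2) lim])
  show ?thesis by (rule l2_Fatou[OF _ _ r(2) bd]) auto
qed

text \<open>Values above the limit are excluded by the weighted triangle inequality with small \<open>a\<close>, values
  below it by Fatou's lemma along a subsequence.\<close>

lemma l2sq_tendsto:
  assumes [measurable]: "\<And>n. F n \<in> borel_measurable M" "f \<in> borel_measurable M"
    and lim: "(\<lambda>n. l2sq M (\<lambda>z. F n z - f z)) \<longlonglongrightarrow> 0"
    and fin: "l2sq M f < top"
  shows "(\<lambda>n. l2sq M (F n)) \<longlonglongrightarrow> l2sq M f"
proof -
  obtain A where A: "l2sq M f = ennreal A" "A \<ge> 0"
    using fin by (cases "l2sq M f") auto
  have up: "\<forall>\<^sub>F n in sequentially. l2sq M (F n) < x" if x: "l2sq M f < x" for x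
  proof -
    obtain B where B: "A < B" "ennreal B < x"
    proof -
      obtain y where y: "l2sq M f < y" "y < x" using dense[OF x] by auto
      then obtain B where "y = ennreal B" "B \<ge> 0" by (cases y) auto
      then show ?thesis using y A that[of B] by (simp add: ennreal_less_iff)
    qed
    obtain a where a: "a > 0" "(1 + a) * A < B"
    proof (rule that[of "(B - A) / (2 * (A + 1))"])
      show "(B - A) / (2 * (A + 1)) > 0" using A B by simp
      have "(B - A) / (2 * (A + 1)) * A = (B - A) * (A / (2 * (A + 1)))" by simp
      also have "\<dots> < (B - A) * 1" using A B by (intro mult_strict_left_mono) (auto simp: field_simps)
      finally show "(1 + (B - A) / (2 * (A + 1))) * A < B" by (simp add: algebra_simps)
    qed
    have "(\<lambda>n. ennreal (1 + a) * l2sq M f + ennreal (1 + 1 / a) * l2sq M (\<lambda>z. F n z - f z))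
        \<longlonglongrightarrow> ennreal (1 + a) * l2sq M f + ennreal (1 + 1 / a) * 0"
      by (intro tendsto_add tendsto_const ennreal_tendsto_cmult lim) auto
    moreover have "ennreal (1 + a) * l2sq M f + ennreal (1 + 1 / a) * 0 < x"
    proof -
      have "ennreal (1 + a) * l2sq M f = ennreal ((1 + a) * A)"
        unfolding A(1) using a A by (intro ennreal_mult[symmetric]) auto
      also have "\<dots> < x"
        using a(2) B(2) by (meson ennreal_leI less_imp_le order_le_less_trans)
      finally show ?thesis by simp
    qed
    ultimately have "\<forall>\<^sub>F n in sequentially.
        ennreal (1 + a) * l2sq M f + ennreal (1 + 1 / a) * l2sq M (\<lambda>z. F n z - f z) < x"
      by (rule order_tendstoD(2))
    then show ?thesis
    proof eventually_elim
      case (elim n)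
      have "l2sq M (F n) = l2sq M (\<lambda>z. f z + (F n z - f z))" by simp
      also have "\<dots> \<le> ennreal (1 + a) * l2sq M f + ennreal (1 + 1 / a) * l2sq M (\<lambda>z. F n z - f z)"
        by (rule l2sq_add_weighted) (use a in auto)
      finally show ?case using elim by simp
    qed
  qed
  have "\<forall>\<^sub>F n in sequentially. x < l2sq M (F n)" if x: "x < l2sq M f" for x
  proof (rule ccontr)
    assume "\<not> ?thesis"
    then have inf: "\<forall>N. \<exists>n\<ge>N. l2sq M (F n) \<le> x"
      by (auto simp: eventually_sequentially not_less)
    then have "\<forall>N. \<exists>n>N. l2sq M (F n) \<le> x"
      by (meson Suc_le_lessD)
    then obtain s :: "nat \<Rightarrow> nat" where s: "strict_mono s" "\<And>n. l2sq M (F (s n)) \<le> x"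
      using infinite_enumerate[of "{n. l2sq M (F n) \<le> x}"]
      by (auto simp: infinite_nat_iff_unbounded)
    have "(\<lambda>n. l2sq M (\<lambda>z. F (s n) z - f z)) \<longlonglongrightarrow> 0"
      using LIMSEQ_subseq_LIMSEQ[OF lim s(1)] by (simp add: o_def)
    then have "l2sq M f \<le> x"
      by (rule l2sq_le_of_tendsto[rotated 2]) (use s(2) in auto)
    with x show False by simp
  qed
  with up show ?thesis by (intro order_tendstoI) auto
qed

lemma borel_measurable_cnj [measurable]:
  "f \<in> borel_measurable M \<Longrightarrow> (\<lambda>x. cnj (f x)) \<in> borel_measurable M"
  by (rule borel_measurable_continuous_on[of cnj]) (auto intro: continuous_intros)

lemma l2_Cauchy_Schwarz:
  assumes [measurable]: "f \<in> borel_measurable M" "g \<in> borel_measurable M"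
    and fin: "l2sq M f < top" "l2sq M g < top"
  shows "integrable M (\<lambda>z. f z * cnj (g z))"
    and "ennreal ((cmod (LINT z|M. f z * cnj (g z)))\<^sup>2) \<le> l2sq M f * l2sq M g"
proof -
  have CS: "(\<integral>\<^sup>+ z. ennreal (norm (f z * cnj (g z))) \<partial>M)\<^sup>2 \<le> l2sq M f * l2sq M g"
    using Cauchy_Schwarz_nn_integral[of "\<lambda>z. ennreal (cmod (f z))" M "\<lambda>z. ennreal (cmod (g z))"]
    by (simp add: l2sq_def norm_mult ennreal_mult ennreal_power)
  have "(\<integral>\<^sup>+ z. ennreal (norm (f z * cnj (g z))) \<partial>M)\<^sup>2 < top"
    using CS fin by (auto simp: ennreal_mult_less_top intro: order_le_less_trans)
  then have "(\<integral>\<^sup>+ z. ennreal (norm (f z * cnj (g z))) \<partial>M) < top"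
    by (simp add: power_less_top_ennreal)
  then show int: "integrable M (\<lambda>z. f z * cnj (g z))"
    by (simp add: integrable_iff_bounded)
  have "ennreal ((cmod (LINT z|M. f z * cnj (g z)))\<^sup>2)
      = (ennreal (cmod (LINT z|M. f z * cnj (g z))))\<^sup>2"
    by (simp add: ennreal_power)
  also have "\<dots> \<le> (\<integral>\<^sup>+ z. ennreal (norm (f z * cnj (g z))) \<partial>M)\<^sup>2"
    by (intro power_mono integral_norm_bound_ennreal int) auto
  finally show "ennreal ((cmod (LINT z|M. f z * cnj (g z)))\<^sup>2) \<le> l2sq M f * l2sq M g"
    using CS by (rule order_trans)
qed

lemma l2sq_add_finite:
  assumes "f \<in> borel_measurable M" "g \<in> borel_measurable M" "l2sq M f < top" "l2sq M g < top"
  shows "l2sq M (\<lambda>z. f z + g z) < top"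
  by (rule order_le_less_trans[OF l2sq_add_le]) (use assms in \<open>auto simp: ennreal_mult_less_top\<close>)

lemma l2sq_sum_finite:
  assumes "finite J" "\<And>j. j \<in> J \<Longrightarrow> f j \<in> borel_measurable M" "\<And>j. j \<in> J \<Longrightarrow> l2sq M (f j) < top"
  shows "l2sq M (\<lambda>z. \<Sum>j\<in>J. c j * f j z) < top"
  using assms
proof (induction J rule: finite_induct)
  case (insert j J)
  have "l2sq M (\<lambda>z. c j * f j z + (\<Sum>j\<in>J. c j * f j z)) < top"
    using insert by (intro l2sq_add_finite) (auto simp: l2sq_cmult ennreal_mult_less_top)
  then show ?case using insert by simp
qed simp

lemma l2_dominated_convergence:
  fixes w :: "'a \<Rightarrow> real"
  assumes [measurable]: "\<And>n. F n \<in> borel_measurable M" "f \<in> borel_measurable M"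
    "w \<in> borel_measurable M"
    and bd: "\<And>n. AE z in M. cmod (F n z) \<le> w z"
    and fin: "(\<integral>\<^sup>+ z. ennreal ((w z)\<^sup>2) \<partial>M) < top"
    and lim: "AE z in M. (\<lambda>n. F n z) \<longlonglongrightarrow> f z"
  shows "(\<lambda>n. l2sq M (\<lambda>z. F n z - f z)) \<longlonglongrightarrow> 0"
proof -
  have bd': "AE z in M. \<forall>n. cmod (F n z) \<le> w z"
    using bd by (simp add: AE_all_countable)
  have "(\<lambda>n. \<integral>\<^sup>+ z. ennreal ((cmod (F n z - f z))\<^sup>2) \<partial>M) \<longlonglongrightarrow> (\<integral>\<^sup>+ z. 0 \<partial>M)"
  proof (rule nn_integral_dominated_convergence[where w = "\<lambda>z. 4 * ennreal ((w z)\<^sup>2)"])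
    show "AE z in M. ennreal ((cmod (F n z - f z))\<^sup>2) \<le> 4 * ennreal ((w z)\<^sup>2)" for n
      using bd' lim
    proof eventually_elim
      case (elim z)
      have "cmod (f z) \<le> w z"
        by (rule LIMSEQ_le_const2[OF tendsto_norm[OF elim(2)]]) (use elim(1) in auto)
      then have "cmod (F n z - f z) \<le> 2 * w z"
        using elim(1)[rule_format, of n] norm_triangle_ineq4[of "F n z" "f z"] by simp
      then have "(cmod (F n z - f z))\<^sup>2 \<le> (2 * w z)\<^sup>2" by (intro power_mono) auto
      then have "ennreal ((cmod (F n z - f z))\<^sup>2) \<le> ennreal (4 * (w z)\<^sup>2)"
        by (intro ennreal_leI) (simp add: power_mult_distrib)
      then show ?case by (simp add: ennreal_mult')
    qed
    show "(\<integral>\<^sup>+ z. 4 * ennreal ((w z)\<^sup>2) \<partial>M) < \<infinity>"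
      using fin by (simp add: nn_integral_cmult ennreal_mult_less_top)
    show "AE z in M. (\<lambda>n. ennreal ((cmod (F n z - f z))\<^sup>2)) \<longlonglongrightarrow> 0"
      using lim
    proof eventually_elim
      case (elim z)
      have "(\<lambda>n. ennreal ((cmod (F n z - f z))\<^sup>2)) \<longlonglongrightarrow> ennreal ((cmod (f z - f z))\<^sup>2)"
        by (intro tendsto_ennrealI tendsto_intros elim)
      then show ?case by simp
    qed
  qed auto
  then show ?thesis by (simp add: l2sq_def)
qed

lemma l2sq_diff_finite:
  assumes "f \<in> borel_measurable M" "g \<in> borel_measurable M" "l2sq M f < top" "l2sq M g < top"
  shows "l2sq M (\<lambda>z. f z - g z) < top"
  using l2sq_add_finite[of f M "\<lambda>z. - g z"] assms by (simp add: l2sq_def)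

lemma enn2real_eq_addD:
  assumes "x < top" "y < top" "z < top" "enn2real x = enn2real y + enn2real z"
  shows "x = y + z"
proof -
  obtain a b c where "x = ennreal a" "a \<ge> 0" "y = ennreal b" "b \<ge> 0" "z = ennreal c" "c \<ge> 0"
    using assms(1-3) by (metis ennreal_cases less_irrefl)
  then show ?thesis using assms(4) by simp
qed

lemma l2_tendsto_imp_Cauchy:
  fixes e :: real
  assumes [measurable]: "\<And>n. F n \<in> borel_measurable M" "f \<in> borel_measurable M"
    and lim: "(\<lambda>n. l2sq M (\<lambda>z. F n z - f z)) \<longlonglongrightarrow> 0" and e: "e > 0"
  shows "\<exists>N. \<forall>m\<ge>N. \<forall>n\<ge>N. l2sq M (\<lambda>z. F m z - F n z) \<le> ennreal e"
proof -
  obtain N where N: "\<And>n. n \<ge> N \<Longrightarrow> l2sq M (\<lambda>z. F n z - f z) < ennreal (e / 4)"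
    using order_tendstoD(2)[OF lim, of "ennreal (e / 4)"] e by (auto simp: eventually_sequentially)
  have "l2sq M (\<lambda>z. F m z - F n z) \<le> ennreal e" if "m \<ge> N" "n \<ge> N" for m n
  proof -
    have "l2sq M (\<lambda>z. F m z - F n z) \<le> 2 * l2sq M (\<lambda>z. F m z - f z) + 2 * l2sq M (\<lambda>z. f z - F n z)"
      by (rule l2sq_triangle) auto
    also have "\<dots> \<le> 2 * ennreal (e / 4) + 2 * ennreal (e / 4)"
      using N[OF that(1)] N[OF that(2)] l2sq_minus_commute[of M f "F n"]
      by (intro add_mono mult_left_mono) auto
    also have "\<dots> = ennreal e"
      using e by (simp add: ennreal_mult'[symmetric] ennreal_plus[symmetric] flip: ennreal_numeral del: ennreal_plus)
    finally show ?thesis .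
  qed
  then show ?thesis by blast
qed

lemma cis_measurable [measurable (raw)]:
  "f \<in> borel_measurable M \<Longrightarrow> (\<lambda>x. cis (f x)) \<in> borel_measurable M"
  by (rule borel_measurable_continuous_on[of cis]) (auto intro: continuous_intros)

lemma fst_borel_measurable [measurable (raw)]:
  "f \<in> borel_measurable M \<Longrightarrow> (\<lambda>x. fst (f x)) \<in> borel_measurable M"
  by (rule borel_measurable_continuous_on[of fst]) (auto intro: continuous_intros)

lemma snd_borel_measurable [measurable (raw)]:
  "f \<in> borel_measurable M \<Longrightarrow> (\<lambda>x. snd (f x)) \<in> borel_measurable M"
  by (rule borel_measurable_continuous_on[of snd]) (auto intro: continuous_intros)

lemma l2_inner_tendsto:
  assumes [measurable]: "\<And>n. F n \<in> borel_measurable M" "f \<in> borel_measurable M" "g \<in> borel_measurable M"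
    and fin: "\<And>n. l2sq M (F n) < top" "l2sq M f < top" "l2sq M g < top"
    and lim: "(\<lambda>n. l2sq M (\<lambda>z. F n z - f z)) \<longlonglongrightarrow> 0"
  shows "(\<lambda>n. LINT z|M. F n z * cnj (g z)) \<longlonglongrightarrow> (LINT z|M. f z * cnj (g z))"
proof -
  have eq: "(LINT z|M. F n z * cnj (g z)) - (LINT z|M. f z * cnj (g z))
      = (LINT z|M. (F n z - f z) * cnj (g z))" for n
    unfolding left_diff_distrib
    by (intro Bochner_Integration.integral_diff[symmetric] l2_Cauchy_Schwarz(1)) (auto simp: fin)
  have "(\<lambda>n. l2sq M g * l2sq M (\<lambda>z. F n z - f z)) \<longlonglongrightarrow> l2sq M g * 0"
    by (intro ennreal_tendsto_cmult fin lim)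
  then have "(\<lambda>n. l2sq M (\<lambda>z. F n z - f z) * l2sq M g) \<longlonglongrightarrow> 0" by (simp add: mult.commute)
  then have "(\<lambda>n. ennreal ((cmod (LINT z|M. (F n z - f z) * cnj (g z)))\<^sup>2)) \<longlonglongrightarrow> 0"
    by (rule tendsto_0_ennreal_le, intro always_eventually allI l2_Cauchy_Schwarz(2) l2sq_diff_finite)
       (auto simp: fin)
  then have "(\<lambda>n. ennreal ((cmod (LINT z|M. (F n z - f z) * cnj (g z)))\<^sup>2)) \<longlonglongrightarrow> ennreal 0" by simp
  then have "(\<lambda>n. (cmod (LINT z|M. (F n z - f z) * cnj (g z)))\<^sup>2) \<longlonglongrightarrow> 0"
    by (subst (asm) tendsto_ennreal_iff) auto
  then have "(\<lambda>n. sqrt ((cmod (LINT z|M. (F n z - f z) * cnj (g z)))\<^sup>2)) \<longlonglongrightarrow> sqrt 0"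
    by (rule tendsto_real_sqrt)
  then have "(\<lambda>n. (LINT z|M. F n z * cnj (g z)) - (LINT z|M. f z * cnj (g z))) \<longlonglongrightarrow> 0"
    unfolding eq by (simp add: tendsto_norm_zero_iff)
  then show ?thesis by (rule LIM_zero_cancel)
qed

lemma l2sq_eq_integral:
  assumes "f \<in> borel_measurable M" "l2sq M f < top"
  shows "complex_of_real (enn2real (l2sq M f)) = (LINT z|M. f z * cnj (f z))"
proof -
  have "l2sq M f = ennreal (LINT z|M. (cmod (f z))\<^sup>2)"
    using assms unfolding l2sq_def
    by (intro nn_integral_eq_integral) (auto simp: integrable_iff_bounded)
  then have "enn2real (l2sq M f) = (LINT z|M. (cmod (f z))\<^sup>2)"
    by simp
  then show ?thesis
    by (simp only: integral_complex_of_real[symmetric] complex_norm_square)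
qed

lemma polarization:
  assumes [measurable]: "f \<in> borel_measurable M" "g \<in> borel_measurable M"
    and fin: "l2sq M f < top" "l2sq M g < top"
  shows "4 * (LINT z|M. f z * cnj (g z))
    = (\<Sum>s\<in>{1, - 1, \<i>, - \<i>}. s * of_real (enn2real (l2sq M (\<lambda>z. f z + s * g z))))"
proof -
  define I where "I f g = (LINT z|M. f z * cnj (g z))" for f g :: "'a \<Rightarrow> complex"
  have E: "complex_of_real (enn2real (l2sq M (\<lambda>z. f z + s * g z)))
      = I f f + cnj s * I f g + s * I g f + s * cnj s * I g g" for s
  proof -
    have "l2sq M (\<lambda>z. f z + s * g z) < top"
      by (intro l2sq_add_finite) (use fin in \<open>auto simp: l2sq_cmult ennreal_mult_less_top\<close>)
    then have "complex_of_real (enn2real (l2sq M (\<lambda>z. f z + s * g z)))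
        = (LINT z|M. (f z + s * g z) * cnj (f z + s * g z))"
      by (intro l2sq_eq_integral) auto
    also have "\<dots> = (LINT z|M. ((f z * cnj (f z) + cnj s * (f z * cnj (g z))) + s * (g z * cnj (f z)))
        + s * cnj s * (g z * cnj (g z)))"
      by (intro Bochner_Integration.integral_cong refl) (simp add: algebra_simps)
    also have "\<dots> = I f f + cnj s * I f g + s * I g f + s * cnj s * I g g"
      unfolding I_def
      by (simp only: Bochner_Integration.integral_add Bochner_Integration.integrable_add
          integrable_mult_right integral_mult_right_zero
          l2_Cauchy_Schwarz(1)[OF assms(1,1) fin(1,1)] l2_Cauchy_Schwarz(1)[OF assms(1,2) fin(1,2)]
          l2_Cauchy_Schwarz(1)[OF assms(2,1) fin(2,1)] l2_Cauchy_Schwarz(1)[OF assms(2,2) fin(2,2)])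
    finally show ?thesis .
  qed
  have ne: "\<i> \<noteq> 1" "\<i> \<noteq> - 1" "- \<i> \<noteq> 1" "- \<i> \<noteq> - 1" "\<i> \<noteq> - \<i>" "(1::complex) \<noteq> - 1"
    by (auto simp: complex_eq_iff)
  have "(\<Sum>s\<in>{1, - 1, \<i>, - \<i>}. s * of_real (enn2real (l2sq M (\<lambda>z. f z + s * g z)))) = 4 * I f g"
    unfolding E using ne ne[symmetric] by (simp add: algebra_simps)
  then show ?thesis by (simp add: I_def)
qed

text \<open>If \<open>h\<close> were unbounded, each \<open>E\<^sub>n = {h > 4\<^sup>n}\<close> would have positive measure, and the sum of the
  indicators of the \<open>E\<^sub>n\<close>, normalized to integral \<open>2\<^sup>-\<^sup>n\<close>, would be integrable, while its product
  with \<open>h\<close> has integral at least \<open>2\<^sup>n\<close> for every \<open>n\<close>.\<close>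

lemma essentially_bounded_if_L1_multiplier:
  fixes h :: "'a \<Rightarrow> ennreal"
  assumes M: "finite_measure M" and [measurable]: "h \<in> borel_measurable M"
    and mult: "\<And>D :: 'a \<Rightarrow> real. D \<in> borel_measurable M \<Longrightarrow> (\<And>x. 0 \<le> D x) \<Longrightarrow>
      (\<integral>\<^sup>+ x. ennreal (D x) \<partial>M) < top \<Longrightarrow> (\<integral>\<^sup>+ x. ennreal (D x) * h x \<partial>M) < top"
  shows "\<exists>b::real. 0 < b \<and> (AE x in M. h x \<le> ennreal b)"
proof (rule ccontr)
  assume "\<not> ?thesis"
  then have unb: "\<not> (AE x in M. h x \<le> ennreal (4 ^ n))" for n :: nat
    by (metis zero_less_numeral zero_less_power)
  define E where "E n = {x \<in> space M. h x > ennreal (4 ^ n)}" for n :: nat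
  have E [measurable]: "E n \<in> sets M" for n unfolding E_def by measurable
  define m where "m n = measure M (E n)" for n
  have em: "emeasure M (E n) = ennreal (m n)" for n
    unfolding m_def by (rule finite_measure.emeasure_eq_measure[OF M])
  have m: "m n > 0" for n
  proof -
    have "emeasure M (E n) \<noteq> 0"
    proof
      assume "emeasure M (E n) = 0"
      then have "AE x in M. x \<notin> E n" by (intro AE_not_in) (auto simp: null_sets_def)
      then have "AE x in M. h x \<le> ennreal (4 ^ n)"
        using AE_space by eventually_elim (auto simp: E_def not_less)
      then show False using unb by blast
    qed
    then show ?thesis unfolding em by (simp add: m_def zero_less_measure_iff)
  qed
  \<comment> \<open>normalizes the integral over \<open>E n\<close> to \<open>2\<^sup>-\<^sup>n\<close>\<close>
  define d where "d n = (1/2)^n / m n" for n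
  have d: "d n > 0" for n using m by (simp add: d_def)
  define De where "De x = (\<Sum>n. ennreal (d n) * indicator (E n) x)" for x
  have De_m [measurable]: "De \<in> borel_measurable M" unfolding De_def by measurable
  have "(\<integral>\<^sup>+ x. De x \<partial>M) = (\<Sum>n. \<integral>\<^sup>+ x. ennreal (d n) * indicator (E n) x \<partial>M)"
    unfolding De_def by (rule nn_integral_suminf) simp
  also have "\<dots> = (\<Sum>n. ennreal ((1/2)^n))"
  proof (rule suminf_cong)
    fix n
    have "(\<integral>\<^sup>+ x. ennreal (d n) * indicator (E n) x \<partial>M) = ennreal (d n) * ennreal (m n)"
      by (simp add: nn_integral_cmult em)
    also have "\<dots> = ennreal ((1/2)^n)"
      using m[of n] d[of n] by (simp add: d_def flip: ennreal_mult)
    finally show "(\<integral>\<^sup>+ x. ennreal (d n) * indicator (E n) x \<partial>M) = ennreal ((1/2)^n)" .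
  qed
  also have "\<dots> < top"
    by (subst suminf_ennreal2) (auto intro!: summable_geometric)
  finally have De_fin: "(\<integral>\<^sup>+ x. De x \<partial>M) < top" .
  define D where "D x = enn2real (De x)" for x
  have [measurable]: "D \<in> borel_measurable M" unfolding D_def by measurable
  have "AE x in M. De x \<noteq> \<infinity>"
    using De_fin by (intro nn_integral_PInf_AE) auto
  then have DDe: "AE x in M. ennreal (D x) = De x"
    by eventually_elim (simp add: D_def less_top)
  have "(\<integral>\<^sup>+ x. ennreal (D x) \<partial>M) < top"
    using De_fin nn_integral_cong_AE[OF DDe] by simp
  then have "(\<integral>\<^sup>+ x. ennreal (D x) * h x \<partial>M) < top"
    by (rule mult[rotated 2]) (auto simp: D_def)
  moreover have "(\<integral>\<^sup>+ x. ennreal (D x) * h x \<partial>M) = (\<integral>\<^sup>+ x. De x * h x \<partial>M)"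
    using DDe by (intro nn_integral_cong_AE) (auto elim: eventually_mono)
  ultimately have fin: "(\<integral>\<^sup>+ x. De x * h x \<partial>M) < top" by simp
  have ge: "ennreal (2 ^ n) \<le> (\<integral>\<^sup>+ x. De x * h x \<partial>M)" for n
  proof -
    have "ennreal (2 ^ n) = ennreal (d n * 4 ^ n) * ennreal (m n)"
    proof -
      have "d n * 4 ^ n * m n = 2 ^ n"
        using m[of n] by (simp add: d_def flip: power_mult_distrib)
      then show ?thesis using m[of n] d[of n] by (simp flip: ennreal_mult)
    qed
    also have "\<dots> = (\<integral>\<^sup>+ x. ennreal (d n * 4 ^ n) * indicator (E n) x \<partial>M)"
      by (simp add: nn_integral_cmult em)
    also have "\<dots> \<le> (\<integral>\<^sup>+ x. De x * h x \<partial>M)"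
    proof (rule nn_integral_mono)
      fix x
      show "ennreal (d n * 4 ^ n) * indicator (E n) x \<le> De x * h x"
      proof (cases "x \<in> E n")
        case True
        have "(\<Sum>i\<in>{n}. ennreal (d i) * indicator (E i) x) \<le> De x"
          unfolding De_def by (rule sum_le_suminf) auto
        then have "ennreal (d n) * indicator (E n) x \<le> De x"
          by (simp only: sum.insert finite.emptyI empty_iff not_False_eq_True sum.empty add_0_right simp_thms)
        then have "ennreal (d n) * ennreal (4 ^ n) \<le> De x * h x"
          using True by (intro mult_mono) (auto simp: E_def less_imp_le)
        then show ?thesis using True d[of n] by (simp add: ennreal_mult)
      qed simp
    qed
    finally show ?thesis .
  qed
  obtain r where r: "(\<integral>\<^sup>+ x. De x * h x \<partial>M) = ennreal r" "r \<ge> 0"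
    using fin by (cases "\<integral>\<^sup>+ x. De x * h x \<partial>M") auto
  obtain n where "r < 2 ^ n" using real_arch_pow[of 2 r] by auto
  then show False using ge[of n] r by (simp add: not_le[symmetric])
qed

lemma L2_iff: "f \<in> L2 \<longleftrightarrow> f \<in> borel_measurable lborel \<and> l2sq lborel f < top"
  unfolding L2_def l2sq_def integrable_iff_bounded by auto

lemma L2_tendsto_iff: "L2_tendsto F f \<longleftrightarrow> (\<lambda>N. l2sq lborel (\<lambda>z. F N z - f z)) \<longlonglongrightarrow> 0"
  unfolding L2_tendsto_def l2sq_def ..

lemma L2_norm_l2sq: "f \<in> L2 \<Longrightarrow> ennreal ((L2_norm f)\<^sup>2) = l2sq lborel f"
  unfolding L2_def L2_norm_def l2sq_def by (simp add: nn_integral_eq_integral)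

lemma L2_sum:
  assumes "finite J" "\<And>j. j \<in> J \<Longrightarrow> f j \<in> L2"
  shows "(\<lambda>z. \<Sum>j\<in>J. c j * f j z) \<in> L2"
  using assms by (auto simp: L2_iff intro!: l2sq_sum_finite borel_measurable_sum borel_measurable_times)

lemma L2_measurable: "f \<in> L2 \<Longrightarrow> f \<in> borel_measurable borel"
  by (simp add: L2_def)

lemma L2_limit:
  assumes [measurable]: "f \<in> borel_measurable lborel"
    and lim: "(\<lambda>n. l2sq lborel (\<lambda>z. F n z - f z)) \<longlonglongrightarrow> 0" and F: "\<And>n. F n \<in> L2"
  shows "f \<in> L2"
proof -
  obtain N where "l2sq lborel (\<lambda>z. F N z - f z) < 1"
    using order_tendstoD(2)[OF lim, of 1] by (auto simp: eventually_sequentially)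
  then have 1: "l2sq lborel (\<lambda>z. F N z - f z) < top" by (rule order_less_trans) simp
  have [measurable]: "F N \<in> borel_measurable borel" using F by (rule L2_measurable)
  have m: "F N \<in> borel_measurable lborel" "(\<lambda>z. F N z - f z) \<in> borel_measurable lborel"
    by simp_all
  have "l2sq lborel (\<lambda>z. F N z - (F N z - f z)) < top"
    using l2sq_diff_finite[OF m _ 1] F[of N] by (simp add: L2_iff)
  then show ?thesis by (simp add: L2_iff)
qed

lemma L2_inner_sum_right:
  assumes J: "finite J" and f: "f \<in> L2" and g: "\<And>j. j \<in> J \<Longrightarrow> g j \<in> L2"
  shows "L2_inner f (\<lambda>z. \<Sum>j\<in>J. c j * g j z) = (\<Sum>j\<in>J. cnj (c j) * L2_inner f (g j))"
proof -
  have int: "integrable lborel (\<lambda>z. f z * cnj (g j z))" if "j \<in> J" for j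
    using f g[OF that] by (intro l2_Cauchy_Schwarz(1)) (auto simp: L2_iff)
  have "L2_inner f (\<lambda>z. \<Sum>j\<in>J. c j * g j z) = (LINT z|lborel. (\<Sum>j\<in>J. cnj (c j) * (f z * cnj (g j z))))"
    unfolding L2_inner_def by (simp add: sum_distrib_left mult_ac)
  also have "\<dots> = (\<Sum>j\<in>J. cnj (c j) * L2_inner f (g j))"
    using int by (subst Bochner_Integration.integral_sum) (auto simp: L2_inner_def)
  finally show ?thesis .
qed

lemma L2_inner_sum_left:
  assumes J: "finite J" and g: "g \<in> L2" and f: "\<And>j. j \<in> J \<Longrightarrow> f j \<in> L2"
  shows "L2_inner (\<lambda>z. \<Sum>j\<in>J. c j * f j z) g = (\<Sum>j\<in>J. c j * L2_inner (f j) g)"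
proof -
  have int: "integrable lborel (\<lambda>z. f j z * cnj (g z))" if "j \<in> J" for j
    using g f[OF that] by (intro l2_Cauchy_Schwarz(1)) (auto simp: L2_iff)
  have "L2_inner (\<lambda>z. \<Sum>j\<in>J. c j * f j z) g = (LINT z|lborel. (\<Sum>j\<in>J. c j * (f j z * cnj (g z))))"
    unfolding L2_inner_def sum_distrib_right by (simp only: mult.assoc)
  also have "\<dots> = (\<Sum>j\<in>J. c j * L2_inner (f j) g)"
    using int by (subst Bochner_Integration.integral_sum) (auto simp: L2_inner_def)
  finally show ?thesis .
qed

section \<open>Sums over countable index sets\<close>

text \<open>Sums of extended nonnegative reals over a countable index type are integrals over the
  counting measure, which makes Tonelli's theorem available for them.\<close>

lemma infsum_ennreal_eq_nn_integral:
  fixes f :: "'i::countable \<Rightarrow> ennreal"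
  shows "(\<Sum>\<^sub>\<infinity>j\<in>UNIV. f j) = (\<integral>\<^sup>+ j. f j \<partial>count_space UNIV)"
proof -
  have eq: "(\<Sum>\<^sub>\<infinity>j\<in>UNIV. f j) = (SUP F\<in>{F. finite F}. sum f F)"
    using nonneg_infsum_complete[of UNIV f] by simp
  have le: "sum f F \<le> (\<integral>\<^sup>+ j. f j \<partial>count_space UNIV)" if "finite F" for F
  proof -
    have "sum f F = (\<integral>\<^sup>+ j. f j * indicator F j \<partial>count_space UNIV)"
      using that by (subst nn_integral_count_space'[of F]) auto
    also have "\<dots> \<le> (\<integral>\<^sup>+ j. f j \<partial>count_space UNIV)"
      by (intro nn_integral_mono) (auto simp: indicator_def)
    finally show ?thesis .
  qed
  define A where "A n = {j::'i. to_nat j < n}" for n :: nat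
  have fin: "finite (A n)" for n
    unfolding A_def by (rule finite_imageD[of to_nat]) (auto intro: finite_subset[of _ "{..<n}"] inj_on_subset[OF inj_to_nat])
  have "(\<integral>\<^sup>+ j. f j \<partial>count_space UNIV) = (\<integral>\<^sup>+ j. (SUP n. f j * indicator (A n) j) \<partial>count_space UNIV)"
  proof (rule nn_integral_cong)
    fix j :: 'i
    show "f j = (SUP n. f j * indicator (A n) j)"
      by (intro antisym SUP_upper2[of "Suc (to_nat j)"] SUP_least) (auto simp: A_def indicator_def)
  qed
  also have "\<dots> = (SUP n. \<integral>\<^sup>+ j. f j * indicator (A n) j \<partial>count_space UNIV)"
    by (rule nn_integral_monotone_convergence_SUP)
       (auto simp: incseq_def le_fun_def A_def indicator_def)
  also have "\<dots> = (SUP n. sum f (A n))"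
  proof (intro SUP_cong refl)
    fix n show "(\<integral>\<^sup>+ j. f j * indicator (A n) j \<partial>count_space UNIV) = sum f (A n)"
      by (subst nn_integral_count_space'[OF fin[of n]]) auto
  qed
  also have "\<dots> \<le> (SUP F\<in>{F. finite F}. sum f F)"
    using fin by (intro SUP_least SUP_upper) auto
  finally show ?thesis
    unfolding eq using le by (intro antisym SUP_least) auto
qed

lemma nn_integral_count_space_limit:
  fixes f :: "'i \<Rightarrow> ennreal"
  assumes "incseq A" "\<And>n. finite (A n)" "(\<Union>n. A n) = UNIV"
  shows "(\<lambda>n. \<Sum>j\<in>A n. f j) \<longlonglongrightarrow> (\<integral>\<^sup>+ j. f j \<partial>count_space UNIV)"
proof -
  have *: "(\<integral>\<^sup>+ j. f j * indicator (A n) j \<partial>count_space UNIV) = (\<Sum>j\<in>A n. f j)" for n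
    by (subst nn_integral_count_space'[OF assms(2)[of n]]) auto
  have "(\<integral>\<^sup>+ j. f j \<partial>count_space UNIV) = (\<integral>\<^sup>+ j. (SUP n. f j * indicator (A n) j) \<partial>count_space UNIV)"
  proof (rule nn_integral_cong)
    fix j
    obtain n where "j \<in> A n" using assms(3) by auto
    then show "f j = (SUP n. f j * indicator (A n) j)"
      by (intro antisym SUP_upper2[of n] SUP_least) (auto simp: indicator_def)
  qed
  also have "\<dots> = (SUP n. \<Sum>j\<in>A n. f j)"
    unfolding *[symmetric]
    by (rule nn_integral_monotone_convergence_SUP)
       (use assms(1) in \<open>auto simp: incseq_def le_fun_def indicator_def\<close>)
  finally have eq: "(\<integral>\<^sup>+ j. f j \<partial>count_space UNIV) = (SUP n. \<Sum>j\<in>A n. f j)" .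
  have "incseq (\<lambda>n. \<Sum>j\<in>A n. f j)"
    using assms(1,2) by (auto simp: incseq_def intro!: sum_mono2)
  then show ?thesis unfolding eq by (rule LIMSEQ_SUP)
qed

lemma has_sum_nn_integral_count_space:
  fixes f :: "'i::countable \<Rightarrow> ennreal"
  shows "(f has_sum (\<integral>\<^sup>+ i. f i \<partial>count_space UNIV)) UNIV"
proof -
  have "(f has_sum (SUP F\<in>{F. finite F \<and> F \<subseteq> UNIV}. sum f F)) UNIV"
    by (rule nonneg_has_sum_complete) simp
  then show ?thesis
    using infsum_ennreal_eq_nn_integral[of f] infsumI by fastforce
qed

lemma has_sum_enn2real:
  fixes f :: "'i::countable \<Rightarrow> ennreal"
  assumes fin: "(\<integral>\<^sup>+ i. f i \<partial>count_space UNIV) < top"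
  shows "((\<lambda>i. enn2real (f i)) has_sum enn2real (\<integral>\<^sup>+ i. f i \<partial>count_space UNIV)) UNIV"
proof -
  have f: "f i < top" for i
    using nn_integral_ge_point[of i UNIV f] fin by (auto intro: order_le_less_trans)
  have "(sum f \<longlongrightarrow> ennreal (enn2real (\<integral>\<^sup>+ i. f i \<partial>count_space UNIV))) (finite_subsets_at_top UNIV)"
    using has_sum_nn_integral_count_space[of f] fin by (simp add: has_sum_def)
  then have "((\<lambda>F. enn2real (sum f F)) \<longlongrightarrow> enn2real (\<integral>\<^sup>+ i. f i \<partial>count_space UNIV)) (finite_subsets_at_top UNIV)"
    by (rule tendsto_enn2real) simp
  then show ?thesis
    unfolding has_sum_def using f by (simp add: enn2real_sum)
qed

lemma nn_integral_count_space_ennreal_has_sum: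
  fixes q :: "'i::countable \<Rightarrow> real"
  assumes "(q has_sum s) UNIV" "\<And>i. q i \<ge> 0"
  shows "(\<integral>\<^sup>+ i. ennreal (q i) \<partial>count_space UNIV) = ennreal s"
proof -
  have "((\<lambda>F. ennreal (sum q F)) \<longlongrightarrow> ennreal s) (finite_subsets_at_top UNIV)"
    using assms(1) unfolding has_sum_def by (rule tendsto_ennrealI)
  moreover have "(\<lambda>F. ennreal (sum q F)) = sum (\<lambda>i. ennreal (q i))"
    using assms(2) by (simp add: fun_eq_iff)
  ultimately have "((\<lambda>i. ennreal (q i)) has_sum ennreal s) UNIV"
    unfolding has_sum_def by simp
  then show ?thesis
    using has_sum_nn_integral_count_space[of "\<lambda>i. ennreal (q i)"] has_sum_unique by blast
qed

lemma has_sum_sum_finite: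
  fixes f :: "'j \<Rightarrow> 'i \<Rightarrow> 'a::topological_comm_monoid_add"
  assumes "\<And>j. j \<in> J \<Longrightarrow> (f j has_sum s j) A"
  shows "((\<lambda>i. \<Sum>j\<in>J. f j i) has_sum (\<Sum>j\<in>J. s j)) A"
  using assms by (induction J rule: infinite_finite_induct) (auto intro: has_sum_add)

section \<open>The integer lattice and the torus\<close>

lemma rvec_component [simp]: "rvec k $ i = real_of_int (k $ i)"
  by (simp add: rvec_def)

lemma rvec_0 [simp]: "rvec 0 = 0"
  by (simp add: vec_eq_iff)

lemma rvec_add: "rvec (k + l) = rvec k + rvec l"
  by (simp add: vec_eq_iff)

lemma rvec_uminus: "rvec (- k) = - rvec k"
  by (simp add: vec_eq_iff)

lemma rvec_eq_iff: "rvec k = rvec l \<longleftrightarrow> k = l"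
  by (simp add: vec_eq_iff)

lemma unit_cube_component_sets: "unit_cube = (\<Inter>i. {\<xi>::real^'n. 0 \<le> \<xi> $ i} \<inter> {\<xi>. \<xi> $ i < 1})"
  by (auto simp: unit_cube_def)

lemma unit_cube_borel [measurable]: "(unit_cube :: (real^'n) set) \<in> sets borel"
proof -
  have "{\<xi>::real^'n. 0 \<le> \<xi> $ i} \<in> sets borel" "{\<xi>::real^'n. \<xi> $ i < 1} \<in> sets borel" for i
    by (auto intro!: borel_closed borel_open closed_Collect_le open_Collect_less continuous_intros)
  then show ?thesis
    unfolding unit_cube_component_sets by (intro sets.finite_INT) auto
qed

lemma space_torus [simp]: "space torus_measure = unit_cube"
  by (simp add: space_restrict_space)

lemma measurable_torus [measurable (raw)]:
  "f \<in> borel_measurable borel \<Longrightarrow> f \<in> borel_measurable torus_measure"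
  by (intro measurable_restrict_space1) simp

lemma nn_integral_torus:
  "(\<integral>\<^sup>+ \<xi>. f \<xi> \<partial>torus_measure) = (\<integral>\<^sup>+ \<xi>. f \<xi> * indicator unit_cube \<xi> \<partial>lborel)"
  by (subst nn_integral_restrict_space) auto

lemma emeasure_unit_cube: "emeasure lborel (unit_cube :: (real^'n) set) = 1"
proof (rule antisym)
  have one: "b \<in> Basis \<Longrightarrow> 0 \<bullet> b \<le> (1::real^'n) \<bullet> b \<and> ((1::real^'n) - 0) \<bullet> b = 1" for b
    by (auto simp: Basis_vec_def inner_axis)
  have "emeasure lborel (unit_cube :: (real^'n) set) \<le> emeasure lborel (cbox 0 (1::real^'n))"
    by (intro emeasure_mono) (auto simp: unit_cube_def mem_box_cart less_imp_le)
  then show "emeasure lborel (unit_cube :: (real^'n) set) \<le> 1"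
    using one by (subst (asm) emeasure_lborel_cbox) auto
  have "emeasure lborel (box 0 (1::real^'n)) \<le> emeasure lborel (unit_cube :: (real^'n) set)"
    by (intro emeasure_mono) (auto simp: unit_cube_def mem_box_cart less_imp_le)
  then show "1 \<le> emeasure lborel (unit_cube :: (real^'n) set)"
    using one by (subst (asm) emeasure_lborel_box) auto
qed

lemma emeasure_torus: "emeasure torus_measure (unit_cube :: (real^'n) set) = 1"
  by (subst emeasure_restrict_space) (auto simp: emeasure_unit_cube)

lemma finite_measure_torus: "finite_measure (torus_measure :: (real^'n) measure)"
  by (rule finite_measureI) (simp add: emeasure_torus)

lemma measure_torus: "measure torus_measure (unit_cube :: (real^'n) set) = 1"
  by (simp add: measure_def emeasure_torus)

lemma nn_integral_lborel_translate:
  fixes a :: "'a::euclidean_space"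
  assumes [measurable]: "f \<in> borel_measurable borel"
  shows "(\<integral>\<^sup>+ x. f (x + a) \<partial>lborel) = (\<integral>\<^sup>+ x. f x \<partial>lborel)"
proof -
  have "(\<integral>\<^sup>+ x. f x \<partial>lborel) = (\<integral>\<^sup>+ x. f x \<partial>distr lborel borel ((+) a))"
    by (simp add: lborel_distr_plus)
  also have "\<dots> = (\<integral>\<^sup>+ x. f (a + x) \<partial>lborel)"
    by (subst nn_integral_distr) auto
  finally show ?thesis by (simp add: add.commute)
qed

definition floor_vec :: "real^'n \<Rightarrow> int^'n" where
  "floor_vec x = (\<chi> i. \<lfloor>x $ i\<rfloor>)"

lemma diff_rvec_in_unit_cube_iff: "x - rvec m \<in> unit_cube \<longleftrightarrow> m = floor_vec x"
proof -
  have "0 \<le> t - real_of_int j \<and> t - real_of_int j < 1 \<longleftrightarrow> j = \<lfloor>t\<rfloor>" for t j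
    by linarith
  then show ?thesis by (simp add: unit_cube_def floor_vec_def vec_eq_iff)
qed

lemma nn_integral_count_unique:
  assumes "\<And>m. m \<noteq> m0 \<Longrightarrow> f m = 0"
  shows "(\<integral>\<^sup>+ m. f m \<partial>count_space UNIV) = f m0"
  by (subst nn_integral_count_space'[of "{m0}"]) (use assms in auto)

lemma nn_integral_lborel_tiling:
  fixes f :: "real^'n \<Rightarrow> ennreal"
  assumes [measurable]: "f \<in> borel_measurable borel"
  shows "(\<integral>\<^sup>+ x. f x \<partial>lborel)
    = (\<integral>\<^sup>+ \<xi>. (\<integral>\<^sup>+ m. f (\<xi> + rvec m) \<partial>count_space UNIV) \<partial>torus_measure)"
proof -
  have "(\<integral>\<^sup>+ \<xi>. (\<integral>\<^sup>+ m. f (\<xi> + rvec m) \<partial>count_space UNIV) \<partial>torus_measure)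
    = (\<integral>\<^sup>+ \<xi>. (\<integral>\<^sup>+ m. f (\<xi> + rvec m) * indicator unit_cube \<xi> \<partial>count_space UNIV) \<partial>lborel)"
    by (subst nn_integral_torus) (simp add: nn_integral_multc)
  also have "\<dots> = (\<integral>\<^sup>+ m. (\<integral>\<^sup>+ \<xi>. f (\<xi> + rvec m) * indicator unit_cube \<xi> \<partial>lborel) \<partial>count_space UNIV)"
    by (rule nn_integral_count_space_nn_integral) auto
  also have "\<dots> = (\<integral>\<^sup>+ m. (\<integral>\<^sup>+ \<xi>. f \<xi> * indicator unit_cube (\<xi> - rvec m) \<partial>lborel) \<partial>count_space UNIV)"
  proof (rule nn_integral_cong)
    fix m :: "int^'n"
    show "(\<integral>\<^sup>+ \<xi>. f (\<xi> + rvec m) * indicator unit_cube \<xi> \<partial>lborel)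
        = (\<integral>\<^sup>+ \<xi>. f \<xi> * indicator unit_cube (\<xi> - rvec m) \<partial>lborel)"
      using nn_integral_lborel_translate[of "\<lambda>\<xi>. f \<xi> * indicator unit_cube (\<xi> - rvec m)" "rvec m"]
      by simp
  qed
  also have "\<dots> = (\<integral>\<^sup>+ \<xi>. (\<integral>\<^sup>+ m. f \<xi> * indicator unit_cube (\<xi> - rvec m) \<partial>count_space UNIV) \<partial>lborel)"
    by (rule nn_integral_count_space_nn_integral[symmetric]) auto
  also have "\<dots> = (\<integral>\<^sup>+ \<xi>. f \<xi> \<partial>lborel)"
  proof (rule nn_integral_cong)
    fix \<xi> :: "real^'n"
    show "(\<integral>\<^sup>+ m. f \<xi> * indicator unit_cube (\<xi> - rvec m) \<partial>count_space UNIV) = f \<xi>"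
      by (subst nn_integral_count_unique[of "floor_vec \<xi>"])
         (auto simp: indicator_def diff_rvec_in_unit_cube_iff)
  qed
  finally show ?thesis ..
qed

text \<open>Tiling the indicator of the shifted cube: each point of the torus is hit by exactly one
  lattice translate.\<close>

lemma nn_integral_torus_translate:
  fixes f :: "real^'n \<Rightarrow> ennreal"
  assumes [measurable]: "f \<in> borel_measurable borel" and per: "\<And>x m. f (x + rvec m) = f x"
  shows "(\<integral>\<^sup>+ \<xi>. f (\<xi> + a) \<partial>torus_measure) = (\<integral>\<^sup>+ \<xi>. f \<xi> \<partial>torus_measure)"
proof -
  have "(\<integral>\<^sup>+ \<xi>. f (\<xi> + a) \<partial>torus_measure) = (\<integral>\<^sup>+ \<xi>. f \<xi> * indicator unit_cube (\<xi> - a) \<partial>lborel)"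
    using nn_integral_lborel_translate[of "\<lambda>\<xi>. f \<xi> * indicator unit_cube (\<xi> - a)" a]
    by (simp add: nn_integral_torus)
  also have "\<dots> = (\<integral>\<^sup>+ \<xi>. (\<integral>\<^sup>+ m. f (\<xi> + rvec m) * indicator unit_cube (\<xi> + rvec m - a)
      \<partial>count_space UNIV) \<partial>torus_measure)"
    by (rule nn_integral_lborel_tiling) simp
  also have "\<dots> = (\<integral>\<^sup>+ \<xi>. f \<xi> \<partial>torus_measure)"
  proof (rule nn_integral_cong)
    fix \<xi> :: "real^'n"
    have *: "\<xi> + rvec m - a \<in> unit_cube \<longleftrightarrow> m = - floor_vec (\<xi> - a)" for m
      using diff_rvec_in_unit_cube_iff[of "\<xi> - a" "- m"]
      by (simp add: rvec_uminus algebra_simps minus_equation_iff[of m] eq_commute[of m])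
    show "(\<integral>\<^sup>+ m. f (\<xi> + rvec m) * indicator unit_cube (\<xi> + rvec m - a) \<partial>count_space UNIV) = f \<xi>"
      by (subst nn_integral_count_unique[of "- floor_vec (\<xi> - a)"]) (auto simp: indicator_def * per)
  qed
  finally show ?thesis .
qed

section \<open>Fourier series on the torus\<close>

definition character :: "int^'n \<Rightarrow> real^'n \<Rightarrow> complex" where
  "character k \<xi> = cis (2 * pi * (\<xi> \<bullet> rvec k))"

lemma character_0 [simp]: "character 0 \<xi> = 1"
  by (simp add: character_def)

lemma norm_character [simp]: "cmod (character k \<xi>) = 1"
  by (simp add: character_def)

lemma character_add: "character (k + l) \<xi> = character k \<xi> * character l \<xi>"
  by (simp add: character_def rvec_add inner_add_right cis_mult algebra_simps)

lemma cnj_character: "cnj (character k \<xi>) = character (- k) \<xi>"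
  by (simp add: character_def rvec_uminus cis_cnj)

lemma character_mult_cnj: "character k \<xi> * cnj (character l \<xi>) = character (k - l) \<xi>"
  by (simp add: cnj_character flip: character_add)

lemma character_periodic: "character k (\<xi> + rvec m) = character k \<xi>"
proof -
  have "rvec m \<bullet> rvec k = real_of_int (\<Sum>i\<in>UNIV. m $ i * k $ i)"
    by (simp add: inner_vec_def)
  then have "cis (2 * pi * (rvec m \<bullet> rvec k)) = 1"
    by (metis Ints_of_int cis_multiple_2pi mult.assoc)
  then show ?thesis
    by (simp add: character_def inner_add_left distrib_left flip: cis_mult)
qed

lemma continuous_on_character: "continuous_on S (character k)"
  unfolding character_def by (intro continuous_intros)

lemma character_measurable [measurable]: "character k \<in> borel_measurable borel"
  by (intro borel_measurable_continuous_onI continuous_on_character)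

lemma integrable_bounded_torus:
  fixes f :: "real^'n \<Rightarrow> 'b::{banach, second_countable_topology}"
  assumes "f \<in> borel_measurable torus_measure" "\<And>x. norm (f x) \<le> B"
  shows "integrable torus_measure f"
  by (rule finite_measure.integrable_const_bound[OF finite_measure_torus, of _ B]) (use assms in auto)

text \<open>For \<open>k \<noteq> 0\<close> the translation by \<open>k / (2 |k|\<^sup>2)\<close> changes the sign of the character, while
  it preserves integrals of periodic functions; adding \<open>1\<close> makes the functions nonnegative.\<close>

lemma integral_character:
  "(LINT \<xi>|torus_measure. character k \<xi>) = (if k = 0 then 1 else 0)"
proof (cases "k = 0")
  case True
  then show ?thesis by (simp add: measure_torus)
next
  case False
  define a where "a = (1 / (2 * (rvec k \<bullet> rvec k))) *\<^sub>R rvec k"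
  have "rvec k \<noteq> 0" using False rvec_eq_iff[of k 0] by simp
  then have a: "a \<bullet> rvec k = 1/2" by (simp add: a_def)
  have shift: "character k (\<xi> + a) = - character k \<xi>" for \<xi>
    by (simp add: character_def inner_add_left a distrib_left flip: cis_mult)
  have zero: "(LINT \<xi>|torus_measure. g (character k \<xi>)) = 0"
    if g: "g \<in> borel_measurable borel" "\<And>z. g (- z) = - g z" "\<And>z. \<bar>g z\<bar> \<le> cmod z"
    for g :: "complex \<Rightarrow> real"
  proof -
    have [measurable]: "g \<in> borel_measurable borel" by fact
    have bd: "\<bar>g (character k \<xi>)\<bar> \<le> 1" for \<xi> using g(3)[of "character k \<xi>"] by simp
    have bd2: "0 \<le> 1 + g (character k \<xi>)" "0 \<le> 1 - g (character k \<xi>)" for \<xi>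
      using bd[of \<xi>] by (auto simp: abs_le_iff)
    have int: "integrable torus_measure (\<lambda>\<xi>. g (character k \<xi>))"
      using bd by (intro integrable_bounded_torus[where B = 1]) auto
    have one: "integrable torus_measure (\<lambda>\<xi>::real^'a. 1::real)"
      by (intro integrable_bounded_torus[where B = 1]) auto
    have "(\<integral>\<^sup>+ \<xi>. ennreal (1 + g (character k (\<xi> + a))) \<partial>torus_measure)
        = (\<integral>\<^sup>+ \<xi>. ennreal (1 + g (character k \<xi>)) \<partial>torus_measure)"
      by (rule nn_integral_torus_translate) (auto simp: character_periodic)
    moreover have "(\<integral>\<^sup>+ \<xi>. ennreal (1 + g (character k \<xi>)) \<partial>torus_measure)
        = ennreal (LINT \<xi>|torus_measure. 1 + g (character k \<xi>))"
      using bd2 by (intro nn_integral_eq_integral Bochner_Integration.integrable_add int one AE_I2)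
    moreover have "(\<integral>\<^sup>+ \<xi>. ennreal (1 + g (character k (\<xi> + a))) \<partial>torus_measure)
        = ennreal (LINT \<xi>|torus_measure. 1 - g (character k \<xi>))"
      using bd2 unfolding shift g(2) add_uminus_conv_diff
      by (intro nn_integral_eq_integral Bochner_Integration.integrable_diff int one AE_I2)
    ultimately have eq: "ennreal (LINT \<xi>|torus_measure. 1 - g (character k \<xi>))
        = ennreal (LINT \<xi>|torus_measure. 1 + g (character k \<xi>))" by simp
    have nn: "0 \<le> (LINT \<xi>|torus_measure. 1 - g (character k \<xi>))"
      "0 \<le> (LINT \<xi>|torus_measure. 1 + g (character k \<xi>))"
      using bd2 by (intro integral_nonneg_AE AE_I2; simp)+
    have "(LINT \<xi>|torus_measure. 1 - g (character k \<xi>)) = (LINT \<xi>|torus_measure. 1 + g (character k \<xi>))"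
      using eq nn by simp
    then show ?thesis using int one by simp
  qed
  have int: "integrable torus_measure (character k)"
    by (intro integrable_bounded_torus[where B = 1]) auto
  have "Re (LINT \<xi>|torus_measure. character k \<xi>) = 0"
    using zero[of Re] int by (simp add: abs_Re_le_cmod)
  moreover have "Im (LINT \<xi>|torus_measure. character k \<xi>) = 0"
    using zero[of Im] int by (simp add: abs_Im_le_cmod)
  ultimately show ?thesis using False by (simp add: complex_eq_iff)
qed

definition trig_poly :: "(int^'n) set \<Rightarrow> (int^'n \<Rightarrow> complex) \<Rightarrow> real^'n \<Rightarrow> complex" where
  "trig_poly A a \<xi> = (\<Sum>k\<in>A. a k * character k \<xi>)"

lemma trig_poly_measurable [measurable]: "trig_poly A a \<in> borel_measurable borel"
  unfolding trig_poly_def by measurable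

lemma cmod_trig_poly_le: "cmod (trig_poly A a \<xi>) \<le> (\<Sum>k\<in>A. cmod (a k))"
  unfolding trig_poly_def by (rule order_trans[OF norm_sum]) (simp add: norm_mult)

lemma l2sq_bounded_finite:
  assumes "finite_measure M" "\<And>x. cmod (f x) \<le> B"
  shows "l2sq M f < top"
proof -
  have "l2sq M f \<le> (\<integral>\<^sup>+ x. ennreal (B\<^sup>2) \<partial>M)"
    unfolding l2sq_def using assms(2) by (intro nn_integral_mono ennreal_leI power_mono) auto
  also have "\<dots> < top"
    using finite_measure.finite_emeasure_space[OF assms(1)]
    by (simp add: ennreal_mult_less_top top.not_eq_extremum)
  finally show ?thesis .
qed

definition fourier_coeff :: "(real^'n \<Rightarrow> complex) \<Rightarrow> int^'n \<Rightarrow> complex" where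
  "fourier_coeff C k = (LINT \<xi>|torus_measure. C \<xi> * cnj (character k \<xi>))"

lemma integral_mult_cnj_trig_poly:
  assumes [measurable]: "C \<in> borel_measurable torus_measure" and fin: "l2sq torus_measure C < top"
  shows "(LINT \<xi>|torus_measure. C \<xi> * cnj (trig_poly A a \<xi>)) = (\<Sum>k\<in>A. fourier_coeff C k * cnj (a k))"
proof -
  have int: "integrable torus_measure (\<lambda>\<xi>. C \<xi> * cnj (character k \<xi>))" for k
    by (intro l2_Cauchy_Schwarz(1) fin l2sq_bounded_finite[OF finite_measure_torus, of _ 1]) auto
  have "(LINT \<xi>|torus_measure. C \<xi> * cnj (trig_poly A a \<xi>))
      = (LINT \<xi>|torus_measure. (\<Sum>k\<in>A. cnj (a k) * (C \<xi> * cnj (character k \<xi>))))"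
    by (simp add: trig_poly_def sum_distrib_left algebra_simps)
  also have "\<dots> = (\<Sum>k\<in>A. cnj (a k) * fourier_coeff C k)"
    using int by (subst Bochner_Integration.integral_sum) (auto simp: fourier_coeff_def)
  finally show ?thesis by (simp add: mult.commute)
qed

lemma fourier_coeff_trig_poly:
  assumes "finite A"
  shows "fourier_coeff (trig_poly A a) k = (if k \<in> A then a k else 0)"
proof -
  have int: "integrable torus_measure (\<lambda>\<xi>. a j * character (j - k) \<xi>)" for j
    by (intro integrable_bounded_torus[where B = "cmod (a j)"]) (auto simp: norm_mult)
  have "fourier_coeff (trig_poly A a) k
      = (LINT \<xi>|torus_measure. (\<Sum>j\<in>A. a j * character (j - k) \<xi>))"
    by (simp add: fourier_coeff_def trig_poly_def sum_distrib_right mult.assoc character_mult_cnj)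
  also have "\<dots> = (\<Sum>j\<in>A. if j = k then a j else 0)"
    using int by (subst Bochner_Integration.integral_sum) (auto simp: integral_character intro!: sum.cong)
  finally show ?thesis using assms by simp
qed

lemma trig_poly_l2sq:
  assumes "finite A"
  shows "l2sq torus_measure (trig_poly A a) = ennreal (\<Sum>k\<in>A. (cmod (a k))\<^sup>2)"
proof -
  have fin: "l2sq torus_measure (trig_poly A a) < top"
    by (rule l2sq_bounded_finite[OF finite_measure_torus cmod_trig_poly_le])
  have "complex_of_real (enn2real (l2sq torus_measure (trig_poly A a))) = (\<Sum>k\<in>A. a k * cnj (a k))"
    using fin assms by (subst l2sq_eq_integral, simp_all, subst integral_mult_cnj_trig_poly)
      (auto simp: fourier_coeff_trig_poly)
  also have "\<dots> = complex_of_real (\<Sum>k\<in>A. (cmod (a k))\<^sup>2)"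
    by (simp only: of_real_sum complex_norm_square)
  finally have "enn2real (l2sq torus_measure (trig_poly A a)) = (\<Sum>k\<in>A. (cmod (a k))\<^sup>2)"
    by (simp only: of_real_eq_iff)
  then show ?thesis using fin by (metis ennreal_enn2real)
qed

definition trig_polys :: "(real^'n \<Rightarrow> complex) set" where
  "trig_polys = {P. \<exists>A a. finite A \<and> P = trig_poly A a}"

lemma trig_poly_in: "finite A \<Longrightarrow> trig_poly A a \<in> trig_polys"
  by (auto simp: trig_polys_def)

lemma trig_poly_superset:
  assumes "finite B" "A \<subseteq> B"
  shows "trig_poly A a = trig_poly B (\<lambda>k. if k \<in> A then a k else 0)"
  unfolding trig_poly_def fun_eq_iff
  using assms by (auto intro!: sum.mono_neutral_cong_left)

lemma trig_polys_add:
  assumes "P \<in> trig_polys" "Q \<in> trig_polys"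
  shows "(\<lambda>\<xi>. P \<xi> + Q \<xi>) \<in> trig_polys"
proof -
  obtain A a B b where *: "finite A" "P = trig_poly A a" "finite B" "Q = trig_poly B b"
    using assms by (auto simp: trig_polys_def)
  define a' where "a' k = (if k \<in> A then a k else 0) + (if k \<in> B then b k else 0)" for k
  have "(\<lambda>\<xi>. P \<xi> + Q \<xi>) = trig_poly (A \<union> B) a'"
    using * trig_poly_superset[of "A \<union> B" A a] trig_poly_superset[of "A \<union> B" B b]
    by (simp add: trig_poly_def a'_def distrib_right sum.distrib fun_eq_iff)
  then show ?thesis using * by (simp add: trig_poly_in)
qed

lemma trig_polys_cmult_character:
  assumes "P \<in> trig_polys"
  shows "(\<lambda>\<xi>. c * character l \<xi> * P \<xi>) \<in> trig_polys"
proof -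
  obtain A a where *: "finite A" "P = trig_poly A a"
    using assms by (auto simp: trig_polys_def)
  have "(\<lambda>\<xi>. c * character l \<xi> * P \<xi>) = trig_poly ((+) l ` A) (\<lambda>k. c * a (k - l))"
    unfolding * trig_poly_def fun_eq_iff
    by (simp add: sum.reindex character_add sum_distrib_left algebra_simps)
  then show ?thesis using * by (simp add: trig_poly_in)
qed

lemma trig_polys_cmult: "P \<in> trig_polys \<Longrightarrow> (\<lambda>\<xi>. c * P \<xi>) \<in> trig_polys"
  using trig_polys_cmult_character[of P c 0] by simp

lemma trig_polys_character: "(\<lambda>\<xi>. c * character k \<xi>) \<in> trig_polys"
proof -
  have "(\<lambda>\<xi>. c * character k \<xi>) = trig_poly {k} (\<lambda>_. c)"
    by (simp add: trig_poly_def fun_eq_iff)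
  then show ?thesis by (simp add: trig_poly_in)
qed

lemma trig_polys_const: "(\<lambda>\<xi>. c) \<in> trig_polys"
  using trig_polys_character[of c 0] by simp

lemma trig_polys_sum:
  "(\<And>i. i \<in> I \<Longrightarrow> P i \<in> trig_polys) \<Longrightarrow> (\<lambda>\<xi>. \<Sum>i\<in>I. P i \<xi>) \<in> trig_polys"
  by (induction I rule: infinite_finite_induct) (auto intro: trig_polys_const trig_polys_add)

lemma trig_polys_mult:
  assumes "P \<in> trig_polys" "Q \<in> trig_polys"
  shows "(\<lambda>\<xi>. P \<xi> * Q \<xi>) \<in> trig_polys"
proof -
  obtain A a where *: "finite A" "P = trig_poly A a"
    using assms by (auto simp: trig_polys_def)
  have "(\<lambda>\<xi>. P \<xi> * Q \<xi>) = (\<lambda>\<xi>. \<Sum>k\<in>A. a k * character k \<xi> * Q \<xi>)"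
    unfolding * trig_poly_def by (simp add: sum_distrib_right)
  then show ?thesis
    using assms(2) by (auto intro: trig_polys_sum trig_polys_cmult_character)
qed

lemma trig_polys_measurable: "P \<in> trig_polys \<Longrightarrow> P \<in> borel_measurable borel"
  by (auto simp: trig_polys_def)

text \<open>The map \<open>\<xi> \<mapsto> (exp (2 \<pi> \<i> \<xi>\<^sub>j))\<^sub>j\<close> identifies the torus with a compact subset of
  complex space; real polynomials there pull back to trigonometric polynomials.\<close>

definition torus_map :: "real^'n \<Rightarrow> complex^'n" where
  "torus_map \<xi> = (\<chi> i. cis (2 * pi * \<xi> $ i))"

lemma continuous_torus_map: "continuous_on S torus_map"
  unfolding torus_map_def by (intro continuous_intros)

lemma real_polynomial_torus_map:
  fixes g :: "complex^'n \<Rightarrow> real"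
  assumes "real_polynomial_function g"
  shows "(\<lambda>\<xi>. complex_of_real (g (torus_map \<xi>))) \<in> trig_polys"
  using assms
proof induction
  case (linear f)
  interpret bounded_linear f by fact
  let ?e = "\<lambda>i. axis i (1::int)"
  have in1: "\<xi> \<bullet> rvec (?e i) = \<xi> $ i" for \<xi> :: "real^'n" and i
  proof -
    have "rvec (?e i) = axis i (1::real)" by (auto simp: vec_eq_iff axis_def)
    then show ?thesis by (simp add: inner_axis)
  qed
  have "torus_map \<xi> = (\<Sum>i\<in>UNIV. cos (2 * pi * \<xi> $ i) *\<^sub>R axis i 1 + sin (2 * pi * \<xi> $ i) *\<^sub>R axis i \<i>)"
    for \<xi> :: "real^'n"
  proof (subst vec_eq_iff, rule allI)
    fix j
    have "(\<Sum>i\<in>UNIV. cos (2 * pi * \<xi> $ i) *\<^sub>R axis i 1 + sin (2 * pi * \<xi> $ i) *\<^sub>R axis i \<i>) $ j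
      = (\<Sum>i\<in>UNIV. if i = j then cis (2 * pi * \<xi> $ i) else 0)"
      unfolding sum_component
      by (intro sum.cong refl) (auto simp: axis_def cis.ctr complex_eq_iff)
    then show "torus_map \<xi> $ j = (\<Sum>i\<in>UNIV. cos (2 * pi * \<xi> $ i) *\<^sub>R axis i 1
        + sin (2 * pi * \<xi> $ i) *\<^sub>R axis i \<i>) $ j"
      by (simp add: torus_map_def)
  qed
  then have F: "f (torus_map \<xi>) = (\<Sum>i\<in>UNIV. f (axis i 1) * cos (2 * pi * \<xi> $ i)
      + f (axis i \<i>) * sin (2 * pi * \<xi> $ i))" for \<xi>
    by (simp add: sum add scaleR mult.commute)
  have CS: "complex_of_real (cos (2 * pi * \<xi> $ i))
      = (1/2) * character (?e i) \<xi> + (1/2) * character (- ?e i) \<xi>"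
    and SC: "complex_of_real (sin (2 * pi * \<xi> $ i))
      = (- \<i>/2) * character (?e i) \<xi> + (\<i>/2) * character (- ?e i) \<xi>" for \<xi> :: "real^'n" and i
    by (simp_all add: character_def rvec_uminus in1 complex_eq_iff)
  have "(\<lambda>\<xi>. complex_of_real (f (torus_map \<xi>))) = (\<lambda>\<xi>. \<Sum>i\<in>UNIV.
      of_real (f (axis i 1)) * ((1/2) * character (?e i) \<xi> + (1/2) * character (- ?e i) \<xi>)
      + of_real (f (axis i \<i>)) * ((- \<i>/2) * character (?e i) \<xi> + (\<i>/2) * character (- ?e i) \<xi>))"
    by (simp only: F of_real_sum of_real_add of_real_mult CS SC)
  also have "\<dots> \<in> trig_polys"
    by (intro trig_polys_sum trig_polys_add trig_polys_cmult trig_polys_character)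
  finally show ?case .
next
  case (const c)
  then show ?case by (rule trig_polys_const)
next
  case (add f g)
  then show ?case by (simp add: trig_polys_add)
next
  case (mult f g)
  then show ?case by (simp add: trig_polys_mult)
qed

definition trig_approx :: "(real^'n) measure \<Rightarrow> (real^'n \<Rightarrow> complex) \<Rightarrow> bool" where
  "trig_approx M C \<longleftrightarrow> (\<forall>e::real. e > 0 \<longrightarrow> (\<exists>P\<in>trig_polys. l2sq M (\<lambda>\<xi>. C \<xi> - P \<xi>) < ennreal e))"

locale torus_finite_measure = finite_measure M for M :: "(real^'n) measure" +
  assumes sets_M: "sets M = sets torus_measure"
begin

lemma space_M: "space M = unit_cube"
  using sets_eq_imp_space_eq[OF sets_M] by simp

lemma emeasure_space_less_top: "emeasure M (space M) < top"
  by (metis finite_emeasure_space infinity_ennreal_def less_top)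

lemma measurable_M [measurable (raw)]:
  "f \<in> borel_measurable borel \<Longrightarrow> f \<in> borel_measurable M"
  unfolding measurable_cong_sets[OF sets_M refl] by (rule measurable_torus)

lemma trig_approxI_sequence:
  assumes [measurable]: "C \<in> borel_measurable M" "\<And>n. D n \<in> borel_measurable M"
    and D: "\<And>n. trig_approx M (D n)"
    and lim: "(\<lambda>n. l2sq M (\<lambda>\<xi>. C \<xi> - D n \<xi>)) \<longlonglongrightarrow> 0"
  shows "trig_approx M C"
  unfolding trig_approx_def
proof (intro allI impI)
  fix e :: real assume e: "e > 0"
  obtain n where n: "l2sq M (\<lambda>\<xi>. C \<xi> - D n \<xi>) < ennreal (e / 4)"
    using order_tendstoD(2)[OF lim, of "ennreal (e / 4)"] e by (auto simp: eventually_sequentially)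
  obtain P where P: "P \<in> trig_polys" "l2sq M (\<lambda>\<xi>. D n \<xi> - P \<xi>) < ennreal (e / 4)"
    using D[of n] e unfolding trig_approx_def by (meson divide_pos_pos zero_less_numeral)
  have [measurable]: "P \<in> borel_measurable borel" by (rule trig_polys_measurable) fact
  have "l2sq M (\<lambda>\<xi>. C \<xi> - P \<xi>) \<le> 2 * l2sq M (\<lambda>\<xi>. C \<xi> - D n \<xi>) + 2 * l2sq M (\<lambda>\<xi>. D n \<xi> - P \<xi>)"
    by (rule l2sq_triangle) auto
  also have "\<dots> < 2 * ennreal (e / 4) + 2 * ennreal (e / 4)"
    using n P by (intro add_strict_mono ennreal_mult_strict_left_mono) auto
  also have "\<dots> = ennreal e"
    using e by (simp add: ennreal_mult'[symmetric] ennreal_plus[symmetric] flip: ennreal_numeral del: ennreal_plus)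
  finally show "\<exists>P\<in>trig_polys. l2sq M (\<lambda>\<xi>. C \<xi> - P \<xi>) < ennreal e"
    using P by blast
qed

lemma trig_approx_sequence:
  assumes "trig_approx M C"
  obtains P where "\<And>n. P n \<in> trig_polys" "(\<lambda>n. l2sq M (\<lambda>\<xi>. C \<xi> - P n \<xi>)) \<longlonglongrightarrow> 0"
proof -
  have "\<exists>P\<in>trig_polys. l2sq M (\<lambda>\<xi>. C \<xi> - P \<xi>) < ennreal (inverse (real (Suc n)))" for n
    using assms unfolding trig_approx_def by simp
  then obtain P where P: "\<And>n. P n \<in> trig_polys"
    "\<And>n. l2sq M (\<lambda>\<xi>. C \<xi> - P n \<xi>) < ennreal (inverse (real (Suc n)))"
    by metis
  have lim: "(\<lambda>n. ennreal (inverse (real (Suc n)))) \<longlonglongrightarrow> 0"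
    using tendsto_ennrealI[OF LIMSEQ_inverse_real_of_nat] by (simp only: ennreal_0)
  have "(\<lambda>n. l2sq M (\<lambda>\<xi>. C \<xi> - P n \<xi>)) \<longlonglongrightarrow> 0"
    by (rule tendsto_0_ennreal_le[OF lim always_eventually[OF allI[OF less_imp_le[OF P(2)]]]])
  with P(1) show ?thesis by (rule that)
qed

lemma trig_approx_poly: "P \<in> trig_polys \<Longrightarrow> trig_approx M P"
  unfolding trig_approx_def by (intro allI impI bexI[of _ P]) auto

lemma trig_approx_sum:
  assumes "finite I" and [measurable]: "\<And>i. i \<in> I \<Longrightarrow> C i \<in> borel_measurable M"
    and "\<And>i. i \<in> I \<Longrightarrow> trig_approx M (C i)"
  shows "trig_approx M (\<lambda>\<xi>. \<Sum>i\<in>I. c i * C i \<xi>)"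
proof -
  have "\<exists>P. (\<forall>n. P n \<in> trig_polys) \<and> (\<lambda>n. l2sq M (\<lambda>\<xi>. C i \<xi> - P n \<xi>)) \<longlonglongrightarrow> 0" if "i \<in> I" for i
    by (rule trig_approx_sequence[OF assms(3)[OF that]]) auto
  then obtain P where P: "\<And>i n. i \<in> I \<Longrightarrow> P i n \<in> trig_polys"
    "\<And>i. i \<in> I \<Longrightarrow> (\<lambda>n. l2sq M (\<lambda>\<xi>. C i \<xi> - P i n \<xi>)) \<longlonglongrightarrow> 0"
    by metis
  have [measurable]: "P i n \<in> borel_measurable borel" if "i \<in> I" for i n
    by (rule trig_polys_measurable) (use P that in auto)
  show ?thesis
  proof (rule trig_approxI_sequence[where D = "\<lambda>n \<xi>. \<Sum>i\<in>I. c i * P i n \<xi>"])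
    show "trig_approx M (\<lambda>\<xi>. \<Sum>i\<in>I. c i * P i n \<xi>)" for n
      using P(1) by (intro trig_approx_poly trig_polys_sum trig_polys_cmult) auto
    have "(\<lambda>n. l2sq M (\<lambda>\<xi>. \<Sum>i\<in>I. c i * (C i \<xi> - P i n \<xi>))) \<longlonglongrightarrow> 0"
      using P(2) assms(1) by (intro l2_tendsto_sum) auto
    then show "(\<lambda>n. l2sq M (\<lambda>\<xi>. (\<Sum>i\<in>I. c i * C i \<xi>) - (\<Sum>i\<in>I. c i * P i n \<xi>))) \<longlonglongrightarrow> 0"
      by (simp add: right_diff_distrib sum_subtractf)
  qed measurable
qed

text \<open>The indicator of a closed subset of the embedded torus is the limit of continuous functions
  of the distance to it, and Stone--Weierstrass approximates these by polynomials. The sets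
  \<open>{..a}\<close> are suitable because, starting at the corner \<open>0\<close> of the cube, they remain preimages
  of closed sets although the faces at \<open>0\<close> and \<open>1\<close> are glued together.\<close>

lemma trig_approx_indicator_atMost:
  "trig_approx M (indicator (unit_cube \<inter> {..a}))"
proof (cases "unit_cube \<inter> {..a} = {}")
  case True
  then show ?thesis using trig_approx_poly[OF trig_polys_const[of 0]] by (simp add: indicator_def[abs_def])
next
  case False
  \<comment> \<open>cutting at \<open>1\<close> keeps the box inside one full turn in every coordinate\<close>
  define b where "b = (\<chi> i. min (a $ i) 1)"
  define F where "F = torus_map ` cbox 0 b"
  have b0: "0 \<le> b $ i" for i
  proof -
    obtain x where "x \<in> unit_cube" "x \<le> a" using False by auto
    then have "0 \<le> x $ i" "x $ i \<le> a $ i" by (auto simp: unit_cube_def less_eq_vec_def)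
    then show ?thesis by (simp add: b_def)
  qed
  have cF: "compact F"
    unfolding F_def by (intro compact_continuous_image continuous_torus_map compact_cbox)
  have neF: "F \<noteq> {}"
    using b0 by (auto simp: F_def box_ne_empty(1) Basis_vec_def inner_axis)
  define S where "S = torus_map ` (cbox 0 1 :: (real^'n) set)"
  have cS: "compact S"
    unfolding S_def by (intro compact_continuous_image continuous_torus_map compact_cbox)
  have mem: "torus_map \<xi> \<in> F \<longleftrightarrow> \<xi> \<le> a" if \<xi>: "\<xi> \<in> unit_cube" for \<xi>
  proof
    assume "torus_map \<xi> \<in> F"
    then obtain t where t: "t \<in> cbox 0 b" "torus_map \<xi> = torus_map t" by (auto simp: F_def)
    show "\<xi> \<le> a"
      unfolding less_eq_vec_def
    proof
      fix i
      have t1: "0 \<le> t $ i" "t $ i \<le> a $ i" "t $ i \<le> 1"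
        using t(1) by (auto simp: mem_box_cart b_def)
      have x1: "0 \<le> \<xi> $ i" "\<xi> $ i < 1" using \<xi> by (auto simp: unit_cube_def)
      have "cis (2 * pi * \<xi> $ i) = cis (2 * pi * t $ i)"
        using t(2) by (auto simp: torus_map_def vec_eq_iff)
      then have "cis (2 * pi * (\<xi> $ i - t $ i)) = 1"
        by (simp add: right_diff_distrib flip: cis_divide)
      then obtain n :: int where "2 * pi * (\<xi> $ i - t $ i) = 2 * pi * n"
        by (metis Re_complex_of_real cis.sel(1) cos_one_2pi_int mult.assoc mult.commute of_real_1)
      then have n: "\<xi> $ i - t $ i = n" by simp
      then have "real_of_int n < 1" using t1 x1 by linarith
      then have "n \<le> 0" by simp
      then show "\<xi> $ i \<le> a $ i" using n t1 by linarith
    qed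
  next
    assume "\<xi> \<le> a"
    then have "\<xi> \<in> cbox 0 b"
      using \<xi> by (auto simp: mem_box_cart b_def less_eq_vec_def unit_cube_def less_imp_le)
    then show "torus_map \<xi> \<in> F" by (auto simp: F_def)
  qed
  \<comment> \<open>decreases to the indicator of \<open>F\<close>\<close>
  define g where "g n z = max 0 (1 - real n * infdist z F)" for n z
  have contg: "continuous_on S (g n)" for n
    unfolding g_def by (intro continuous_intros)
  have "\<exists>p. real_polynomial_function p \<and> (\<forall>z\<in>S. \<bar>g n z - p z\<bar> < inverse (real (Suc n)))" for n
    by (rule Stone_Weierstrass_real_polynomial_function[OF cS contg, of "inverse (real (Suc n))" n]) auto
  then obtain p where p: "\<And>n. real_polynomial_function (p n)"
    "\<And>n z. z \<in> S \<Longrightarrow> \<bar>g n z - p n z\<bar> < inverse (real (Suc n))"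
    by metis
  define P where "P n \<xi> = complex_of_real (p n (torus_map \<xi>))" for n \<xi>
  have Pt: "P n \<in> trig_polys" for n
    unfolding P_def by (intro real_polynomial_torus_map p)
  have [measurable]: "P n \<in> borel_measurable borel" for n
    by (rule trig_polys_measurable) (rule Pt)
  have inS: "torus_map \<xi> \<in> S" if "\<xi> \<in> unit_cube" for \<xi>
    using that by (auto simp: S_def unit_cube_def mem_box_cart less_imp_le)
  show ?thesis
  proof (rule trig_approxI_sequence[OF _ _ trig_approx_poly[OF Pt]])
    have "unit_cube \<inter> {..a} \<in> sets M"
      unfolding sets_M by (subst sets_restrict_space_iff) auto
    then show [measurable]: "(indicator (unit_cube \<inter> {..a}) :: real^'n \<Rightarrow> complex) \<in> borel_measurable M"
      by simp
    have "(\<lambda>n. l2sq M (\<lambda>\<xi>. P n \<xi> - indicator (unit_cube \<inter> {..a}) \<xi>)) \<longlonglongrightarrow> 0"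
    proof (rule l2_dominated_convergence[where w = "\<lambda>_. 2"])
      show "AE \<xi> in M. cmod (P n \<xi>) \<le> 2" for n
      proof (rule AE_I2)
        fix \<xi> assume "\<xi> \<in> space M"
        then have "\<bar>g n (torus_map \<xi>) - p n (torus_map \<xi>)\<bar> < inverse (real (Suc n))"
          by (intro p inS) (simp add: space_M)
        moreover have "inverse (real (Suc n)) \<le> 1" by (simp add: field_simps)
        moreover have "0 \<le> g n (torus_map \<xi>)" "g n (torus_map \<xi>) \<le> 1"
          by (auto simp: g_def infdist_nonneg)
        ultimately show "cmod (P n \<xi>) \<le> 2" by (simp add: P_def)
      qed
      show "(\<integral>\<^sup>+ z. ennreal (2\<^sup>2) \<partial>M) < top"
        using emeasure_space_less_top by (simp add: ennreal_mult_less_top)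
      show "AE \<xi> in M. (\<lambda>n. P n \<xi>) \<longlonglongrightarrow> indicator (unit_cube \<inter> {..a}) \<xi>"
      proof (rule AE_I2)
        fix \<xi> assume "\<xi> \<in> space M"
        then have \<xi>: "\<xi> \<in> unit_cube" by (simp add: space_M)
        let ?z = "torus_map \<xi>"
        have 1: "(\<lambda>n. g n ?z - p n ?z) \<longlonglongrightarrow> 0"
          by (rule Lim_null_comparison[OF _ LIMSEQ_inverse_real_of_nat])
             (use p(2)[OF inS[OF \<xi>]] in \<open>auto intro!: always_eventually less_imp_le simp del: of_nat_Suc\<close>)
        have 2: "(\<lambda>n. g n ?z) \<longlonglongrightarrow> (if \<xi> \<le> a then 1 else 0)"
        proof (cases "\<xi> \<le> a")
          case True
          then have "infdist ?z F = 0" using mem[OF \<xi>] by simp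
          then show ?thesis using True by (simp add: g_def)
        next
          case False
          then have "?z \<notin> F" using mem[OF \<xi>] by simp
          then have d: "infdist ?z F > 0"
            using cF neF by (metis compact_imp_closed in_closed_iff_infdist_zero infdist_nonneg order_less_le)
          obtain N :: nat where N: "1 / infdist ?z F < real N" using reals_Archimedean2 by blast
          have "g n ?z = 0" if "n \<ge> N" for n
          proof -
            have "1 / infdist ?z F < real n" using N that by linarith
            then show ?thesis using d by (simp add: g_def field_simps)
          qed
          then have "eventually (\<lambda>n. g n ?z = 0) sequentially" by (auto simp: eventually_sequentially)
          then show ?thesis using False by (simp add: tendsto_eventually)
        qed
        have "(\<lambda>n. g n ?z - (g n ?z - p n ?z)) \<longlonglongrightarrow> (if \<xi> \<le> a then 1 else 0) - 0"
          by (intro tendsto_diff 1 2)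
        then have "(\<lambda>n. complex_of_real (p n ?z)) \<longlonglongrightarrow> of_real (if \<xi> \<le> a then 1 else 0)"
          by (intro tendsto_of_real) simp
        then show "(\<lambda>n. P n \<xi>) \<longlonglongrightarrow> indicator (unit_cube \<inter> {..a}) \<xi>"
          using \<xi> by (simp add: P_def indicator_def split: if_splits)
      qed
    qed auto
    then show "(\<lambda>n. l2sq M (\<lambda>\<xi>. indicator (unit_cube \<inter> {..a}) \<xi> - P n \<xi>)) \<longlonglongrightarrow> 0"
      by (subst l2sq_minus_commute)
  qed auto
qed

lemma sets_M_generated: "sets M = sigma_sets unit_cube (range (\<lambda>a. unit_cube \<inter> {..a}))"
proof -
  have "sets M = (\<inter>) unit_cube ` sets (borel :: (real^'n) measure)"
    by (simp add: sets_M sets_restrict_space)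
  also have *: "sets (borel :: (real^'n) measure) = sigma_sets UNIV (range (\<lambda>a. {..a}))"
    by (subst borel_eq_atMost) simp
  also have "(\<inter>) unit_cube ` sigma_sets UNIV (range (\<lambda>a. {..a}))
      = sigma_sets unit_cube ((\<inter>) unit_cube ` range (\<lambda>a::real^'n. {..a}))"
    by (rule sigma_sets_Int) (simp_all flip: *)
  finally show ?thesis by (simp add: image_image)
qed

lemma trig_approx_indicator:
  assumes "E \<in> sets M"
  shows "trig_approx M (indicator E)"
proof -
  have gen: "range (\<lambda>a. unit_cube \<inter> {..a::real^'n}) \<subseteq> Pow unit_cube" by auto
  have int: "Int_stable (range (\<lambda>a. unit_cube \<inter> {..a::real^'n}))"
  proof (rule Int_stableI_image)
    fix a b :: "real^'n"
    have "unit_cube \<inter> {..a} \<inter> (unit_cube \<inter> {..b}) = unit_cube \<inter> {..inf a b}" by auto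
    then show "\<exists>c\<in>UNIV. unit_cube \<inter> {..a} \<inter> (unit_cube \<inter> {..b}) = unit_cube \<inter> {..c}" by auto
  qed
  have "E \<in> sigma_sets unit_cube (range (\<lambda>a. unit_cube \<inter> {..a}))"
    using assms by (simp add: sets_M_generated)
  from int gen this show ?thesis
  proof (induction rule: sigma_sets_induct_disjoint)
    case (basic A)
    then show ?case using trig_approx_indicator_atMost by auto
  next
    case empty
    then show ?case using trig_approx_poly[OF trig_polys_const[of 0]] by (simp add: indicator_def[abs_def])
  next
    case (compl A)
    then have A: "A \<in> sets M" by (simp add: sets_M_generated)
    then have [measurable]: "(indicator A :: real^'n \<Rightarrow> complex) \<in> borel_measurable M" by simp
    have "trig_approx M (\<lambda>\<xi>. \<Sum>i\<in>{True, False}. (if i then 1 else - 1) * (if i then (\<lambda>_. 1) else indicator A) \<xi>)"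
      using compl trig_approx_poly[OF trig_polys_const[of 1]] by (intro trig_approx_sum) auto
    then have "trig_approx M (\<lambda>\<xi>. 1 - indicator A \<xi>)" by simp
    moreover have "l2sq M (\<lambda>\<xi>. (1 - indicator A \<xi>) - P \<xi>) = l2sq M (\<lambda>\<xi>. indicator (unit_cube - A) \<xi> - P \<xi>)" for P
      by (rule l2sq_cong_AE) (auto intro!: AE_I2 simp: space_M indicator_def)
    ultimately show ?case by (simp add: trig_approx_def)
  next
    case (union A)
    then have A [measurable]: "A i \<in> sets M" for i by (auto simp: sets_M_generated)
    show ?case
    proof (rule trig_approxI_sequence)
      show "trig_approx M (\<lambda>\<xi>. \<Sum>i<n. 1 * indicator (A i) \<xi>)" for n
        using union by (intro trig_approx_sum) auto
      have "(\<lambda>n. l2sq M (\<lambda>\<xi>. (\<Sum>i<n. 1 * indicator (A i) \<xi>) - indicator (\<Union>i. A i) \<xi>)) \<longlonglongrightarrow> 0"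
      proof (rule l2_dominated_convergence[where w = "\<lambda>_. 1"])
        have fin_sum: "(\<Sum>i<n. 1 * indicator (A i) \<xi>) = (indicator (\<Union>i<n. A i) \<xi> :: complex)" for n \<xi>
          using union(1) by (subst indicator_UN_disjoint) (auto simp: disjoint_family_on_def)
        show "AE \<xi> in M. cmod (\<Sum>i<n. 1 * indicator (A i) \<xi>) \<le> 1" for n
          unfolding fin_sum by (auto simp: indicator_def)
        show "AE \<xi> in M. (\<lambda>n. \<Sum>i<n. 1 * indicator (A i) \<xi>) \<longlonglongrightarrow> (indicator (\<Union>i. A i) \<xi> :: complex)"
          unfolding fin_sum by (intro AE_I2 LIMSEQ_indicator_UN)
        show "(\<integral>\<^sup>+ z. ennreal (1\<^sup>2) \<partial>M) < top"
          using emeasure_space_less_top by simp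
      qed auto
      then show "(\<lambda>n. l2sq M (\<lambda>\<xi>. indicator (\<Union>i. A i) \<xi> - (\<Sum>i<n. 1 * indicator (A i) \<xi>))) \<longlonglongrightarrow> 0"
        by (subst l2sq_minus_commute)
    qed auto
  qed
qed

text \<open>The sets with approximable indicators form a Dynkin system, and simple functions do the rest.
  This argument does not see which finite measure is used; it therefore covers weights that are
  only integrable, for which the convergence of Fourier series is of no help.\<close>

theorem trig_polys_dense:
  assumes [measurable]: "C \<in> borel_measurable M" and fin: "l2sq M C < top"
  shows "trig_approx M C"
proof -
  obtain s :: "nat \<Rightarrow> real^'n \<Rightarrow> complex" where s: "\<And>i. simple_function M (s i)" "\<And>x. x \<in> space M \<Longrightarrow> (\<lambda>i. s i x) \<longlonglongrightarrow> C x"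
    "\<And>i x. x \<in> space M \<Longrightarrow> dist (s i x) 0 \<le> 2 * dist (C x) 0"
    using borel_measurable_implies_sequence_metric[OF assms(1), of 0] by blast
  have [measurable]: "s i \<in> borel_measurable M" for i
    by (intro borel_measurable_simple_function s)
  show ?thesis
  proof (rule trig_approxI_sequence)
    fix i
    have "trig_approx M (\<lambda>\<xi>. \<Sum>y\<in>s i ` space M. y * indicator (s i -` {y} \<inter> space M) \<xi>)"
      using s(1)[of i] by (intro trig_approx_sum trig_approx_indicator)
        (auto simp: simple_function_def)
    moreover have "l2sq M (\<lambda>\<xi>. (\<Sum>y\<in>s i ` space M. y * indicator (s i -` {y} \<inter> space M) \<xi>) - P \<xi>)
        = l2sq M (\<lambda>\<xi>. s i \<xi> - P \<xi>)" for P
    proof (rule l2sq_cong_AE, rule AE_I2)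
      fix \<xi> assume \<xi>: "\<xi> \<in> space M"
      have "(\<Sum>y\<in>s i ` space M. y * indicator (s i -` {y} \<inter> space M) \<xi>)
          = (\<Sum>y\<in>s i ` space M. if y = s i \<xi> then s i \<xi> else 0)"
        using \<xi> by (intro sum.cong) (auto simp: indicator_def)
      also have "\<dots> = s i \<xi>"
        using s(1)[of i] \<xi> by (subst sum.delta) (auto simp: simple_function_def)
      finally show "(\<Sum>y\<in>s i ` space M. y * indicator (s i -` {y} \<inter> space M) \<xi>) - P \<xi> = s i \<xi> - P \<xi>"
        by simp
    qed
    ultimately show "trig_approx M (s i)" by (simp add: trig_approx_def)
  next
    have "(\<integral>\<^sup>+ z. ennreal ((2 * cmod (C z))\<^sup>2) \<partial>M) < top"
      using fin by (simp add: l2sq_def power_mult_distrib ennreal_mult nn_integral_cmult ennreal_mult_less_top)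
    then have "(\<lambda>n. l2sq M (\<lambda>\<xi>. s n \<xi> - C \<xi>)) \<longlonglongrightarrow> 0"
      using s by (intro l2_dominated_convergence[where w = "\<lambda>z. 2 * cmod (C z)"]) (auto intro!: AE_I2)
    then show "(\<lambda>n. l2sq M (\<lambda>\<xi>. C \<xi> - s n \<xi>)) \<longlonglongrightarrow> 0"
      by (subst l2sq_minus_commute)
  qed auto
qed

end

text \<open>Lebesgue measure on the torus.\<close>

interpretation torus: torus_finite_measure "torus_measure :: (real^'n) measure"
  by (intro torus_finite_measure.intro finite_measure_torus torus_finite_measure_axioms.intro refl)

definition kcube :: "nat \<Rightarrow> (int^'n) set" where
  "kcube N = {k. \<forall>i. \<bar>k $ i\<bar> \<le> int N}"

lemma finite_kcube [simp]: "finite (kcube N :: (int^'n) set)"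
proof -
  have "kcube N \<subseteq> (\<lambda>f. \<chi> i. f i) ` (PiE UNIV (\<lambda>_::'n. {- int N..int N}))"
  proof
    fix k :: "int^'n" assume k: "k \<in> kcube N"
    have "- int N \<le> k $ i \<and> k $ i \<le> int N" for i
      using k unfolding kcube_def by (auto simp: abs_le_iff minus_le_iff)
    then show "k \<in> (\<lambda>f. \<chi> i. f i) ` (PiE UNIV (\<lambda>_::'n. {- int N..int N}))"
      by (intro image_eqI[of _ _ "\<lambda>i. k $ i"]) (auto simp: vec_eq_iff)
  qed
  then show ?thesis by (rule finite_subset) (intro finite_imageI finite_PiE; simp)
qed

lemma kcube_mono: "M \<le> N \<Longrightarrow> kcube M \<subseteq> kcube N"
  by (auto simp: kcube_def intro: order_trans)

lemma finite_subset_kcube: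
  assumes "finite (A :: (int^'n) set)"
  obtains N where "A \<subseteq> kcube N"
proof -
  have *: "k \<in> kcube (\<Sum>i\<in>UNIV. nat \<bar>k $ i\<bar>)" for k :: "int^'n"
    unfolding kcube_def
  proof (intro CollectI allI)
    fix i
    have "nat \<bar>k $ i\<bar> \<le> (\<Sum>i\<in>UNIV. nat \<bar>k $ i\<bar>)" by (rule member_le_sum) auto
    then show "\<bar>k $ i\<bar> \<le> int (\<Sum>i\<in>UNIV. nat \<bar>k $ i\<bar>)" by linarith
  qed
  have "k \<in> kcube (\<Sum>k\<in>A. \<Sum>i\<in>UNIV. nat \<bar>k $ i\<bar>)" if "k \<in> A" for k
    by (rule subsetD[OF kcube_mono *]) (use that assms in \<open>auto intro!: member_le_sum\<close>)
  then show ?thesis using that by blast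
qed

text \<open>Orthogonal projection onto a finite set of characters: the partial Fourier sum is the best
  approximation, and the identity also gives Bessel's inequality.\<close>

lemma fourier_projection:
  assumes [measurable]: "C \<in> borel_measurable torus_measure" and fin: "l2sq torus_measure C < top"
    and A: "finite A"
  shows "l2sq torus_measure C = l2sq torus_measure (\<lambda>\<xi>. C \<xi> - trig_poly A (fourier_coeff C) \<xi>)
      + ennreal (\<Sum>k\<in>A. (cmod (fourier_coeff C k))\<^sup>2)" (is ?eq)
    and "l2sq torus_measure (\<lambda>\<xi>. C \<xi> - trig_poly A a \<xi>)
      = l2sq torus_measure (\<lambda>\<xi>. C \<xi> - trig_poly A (fourier_coeff C) \<xi>)
      + ennreal (\<Sum>k\<in>A. (cmod (fourier_coeff C k - a k))\<^sup>2)" (is ?best)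
proof -
  have best: "l2sq torus_measure (\<lambda>\<xi>. C \<xi> - trig_poly A a \<xi>)
      = l2sq torus_measure (\<lambda>\<xi>. C \<xi> - trig_poly A (fourier_coeff C) \<xi>)
      + ennreal (\<Sum>k\<in>A. (cmod (fourier_coeff C k - a k))\<^sup>2)" for a
  proof -
    let ?D = "\<lambda>\<xi>. C \<xi> - trig_poly A (fourier_coeff C) \<xi>"
    let ?T = "trig_poly A (\<lambda>k. fourier_coeff C k - a k)"
    have finT: "l2sq torus_measure (trig_poly A b) < top" for b
      using A by (simp add: trig_poly_l2sq)
    have finD: "l2sq torus_measure ?D < top"
      by (intro l2sq_diff_finite fin finT) auto
    have split: "C \<xi> - trig_poly A a \<xi> = ?D \<xi> + ?T \<xi>" for \<xi>
      by (simp add: trig_poly_def left_diff_distrib sum_subtractf)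
    have finS: "l2sq torus_measure (\<lambda>\<xi>. ?D \<xi> + ?T \<xi>) < top"
      by (intro l2sq_add_finite finD finT) auto
    have meas: "?D \<in> borel_measurable torus_measure" "?T \<in> borel_measurable torus_measure"
      by measurable
    note int = l2_Cauchy_Schwarz(1)[OF meas(1,1) finD finD] l2_Cauchy_Schwarz(1)[OF meas(2,2) finT finT]
      l2_Cauchy_Schwarz(1)[OF meas(1,2) finD finT] l2_Cauchy_Schwarz(1)[OF meas(2,1) finT finD]
    have coeffD: "fourier_coeff ?D k = 0" if "k \<in> A" for k
    proof -
      have "fourier_coeff ?D k = fourier_coeff C k - fourier_coeff (trig_poly A (fourier_coeff C)) k"
        unfolding fourier_coeff_def left_diff_distrib
        by (intro Bochner_Integration.integral_diff l2_Cauchy_Schwarz fin finT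
            l2sq_bounded_finite[OF finite_measure_torus, of _ 1]) auto
      then show ?thesis using that A by (simp add: fourier_coeff_trig_poly)
    qed
    have ortho: "(LINT \<xi>|torus_measure. ?D \<xi> * cnj (?T \<xi>)) = 0"
      using finD coeffD by (subst integral_mult_cnj_trig_poly) auto
    have "(LINT \<xi>|torus_measure. ?T \<xi> * cnj (?D \<xi>)) = (LINT \<xi>|torus_measure. cnj (?D \<xi> * cnj (?T \<xi>)))"
      by (simp add: mult.commute)
    also have "\<dots> = cnj (LINT \<xi>|torus_measure. ?D \<xi> * cnj (?T \<xi>))"
      by (rule Bochner_Integration.integral_cnj)
    also have "\<dots> = 0" unfolding ortho by simp
    finally have ortho': "(LINT \<xi>|torus_measure. ?T \<xi> * cnj (?D \<xi>)) = 0" .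
    have "complex_of_real (enn2real (l2sq torus_measure (\<lambda>\<xi>. ?D \<xi> + ?T \<xi>)))
        = (LINT \<xi>|torus_measure. (?D \<xi> + ?T \<xi>) * cnj (?D \<xi> + ?T \<xi>))"
      by (rule l2sq_eq_integral[OF _ finS]) measurable
    also have "\<dots> = (LINT \<xi>|torus_measure. (?D \<xi> * cnj (?D \<xi>) + ?T \<xi> * cnj (?T \<xi>))
            + (?D \<xi> * cnj (?T \<xi>) + ?T \<xi> * cnj (?D \<xi>)))"
      by (intro Bochner_Integration.integral_cong refl) (simp add: algebra_simps)
    also have "\<dots> = (LINT \<xi>|torus_measure. ?D \<xi> * cnj (?D \<xi>)) + (LINT \<xi>|torus_measure. ?T \<xi> * cnj (?T \<xi>))"
      by (simp only: Bochner_Integration.integral_add Bochner_Integration.integrable_add int ortho ortho' add_0_right)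
    also have "\<dots> = complex_of_real (enn2real (l2sq torus_measure ?D)) + complex_of_real (enn2real (l2sq torus_measure ?T))"
      by (simp only: l2sq_eq_integral[OF meas(1) finD] l2sq_eq_integral[OF meas(2) finT])
    also have "\<dots> = complex_of_real (enn2real (l2sq torus_measure ?D) + enn2real (l2sq torus_measure ?T))"
      by simp
    finally have "enn2real (l2sq torus_measure (\<lambda>\<xi>. ?D \<xi> + ?T \<xi>))
        = enn2real (l2sq torus_measure ?D) + enn2real (l2sq torus_measure ?T)"
      by (simp only: of_real_eq_iff)
    then have "l2sq torus_measure (\<lambda>\<xi>. ?D \<xi> + ?T \<xi>) = l2sq torus_measure ?D + l2sq torus_measure ?T"
      by (rule enn2real_eq_addD[OF finS finD finT])
    then show ?thesis
      using A by (simp only: split trig_poly_l2sq)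
  qed
  show ?best by (rule best)
  show ?eq using best[of "\<lambda>_. 0"] by (simp add: trig_poly_def)
qed

theorem fourier_series_tendsto:
  assumes [measurable]: "C \<in> borel_measurable torus_measure" and fin: "l2sq torus_measure C < top"
  shows "(\<lambda>N. l2sq torus_measure (\<lambda>\<xi>. trig_poly (kcube N) (fourier_coeff C) \<xi> - C \<xi>)) \<longlonglongrightarrow> 0"
proof (rule order_tendstoI)
  fix e :: ennreal assume e: "e > 0"
  obtain y where y: "0 < y" "y < e" using dense[OF e] by auto
  then obtain d where d: "y = ennreal d" "d \<ge> 0" by (cases y) auto
  with y have d0: "d > 0" "ennreal d < e" by auto
  obtain P where P: "P \<in> trig_polys" "l2sq torus_measure (\<lambda>\<xi>. C \<xi> - P \<xi>) < ennreal d"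
    using torus.trig_polys_dense[OF assms] d0 unfolding trig_approx_def by blast
  then obtain A a where A: "finite A" "P = trig_poly A a" by (auto simp: trig_polys_def)
  obtain N0 where N0: "A \<subseteq> kcube N0" using finite_subset_kcube[OF A(1)] .
  have "l2sq torus_measure (\<lambda>\<xi>. trig_poly (kcube N) (fourier_coeff C) \<xi> - C \<xi>) < e" if "N \<ge> N0" for N
  proof -
    have P': "P = trig_poly (kcube N) (\<lambda>k. if k \<in> A then a k else 0)"
      unfolding A by (rule trig_poly_superset) (use N0 kcube_mono[OF that] in auto)
    have "l2sq torus_measure (\<lambda>\<xi>. C \<xi> - trig_poly (kcube N) (fourier_coeff C) \<xi>)
        \<le> l2sq torus_measure (\<lambda>\<xi>. C \<xi> - P \<xi>)"
      unfolding P' fourier_projection(2)[OF assms finite_kcube, where a = "\<lambda>k. if k \<in> A then a k else 0"]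
      by simp
    then show ?thesis
      unfolding l2sq_minus_commute[of _ _ C]
      by (rule order_le_less_trans[OF _ order_less_trans[OF P(2) d0(2)]])
  qed
  then show "eventually (\<lambda>N. l2sq torus_measure (\<lambda>\<xi>. trig_poly (kcube N) (fourier_coeff C) \<xi> - C \<xi>) < e) sequentially"
    by (auto simp: eventually_sequentially)
qed auto

lemma kcube_exhausts: "incseq kcube" "(\<Union>N. kcube N) = (UNIV :: (int^'n) set)"
proof -
  show "incseq kcube" using kcube_mono by (auto simp: incseq_def)
  show "(\<Union>N. kcube N) = (UNIV :: (int^'n) set)"
  proof (intro equalityI subsetI UNIV_I)
    fix k :: "int^'n"
    show "k \<in> (\<Union>N. kcube N)" using finite_subset_kcube[of "{k}"] by auto
  qed
qed

theorem parseval: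
  assumes [measurable]: "C \<in> borel_measurable torus_measure" and fin: "l2sq torus_measure C < top"
  shows "(\<integral>\<^sup>+ k. ennreal ((cmod (fourier_coeff C k))\<^sup>2) \<partial>count_space UNIV) = l2sq torus_measure C"
proof (rule LIMSEQ_unique)
  show "(\<lambda>N. \<Sum>k\<in>kcube N. ennreal ((cmod (fourier_coeff C k))\<^sup>2))
      \<longlonglongrightarrow> (\<integral>\<^sup>+ k. ennreal ((cmod (fourier_coeff C k))\<^sup>2) \<partial>count_space UNIV)"
    by (rule nn_integral_count_space_limit) (use kcube_exhausts in auto)
  have "(\<lambda>N. l2sq torus_measure (trig_poly (kcube N) (fourier_coeff C))) \<longlonglongrightarrow> l2sq torus_measure C"
    by (rule l2sq_tendsto[OF _ _ fourier_series_tendsto]) (use fin in auto)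
  then show "(\<lambda>N. \<Sum>k\<in>kcube N. ennreal ((cmod (fourier_coeff C k))\<^sup>2)) \<longlonglongrightarrow> l2sq torus_measure C"
    by (simp add: trig_poly_l2sq)
qed

section \<open>The Fourier transform of compactly supported functions\<close>

lemma lborel_integral_translate:
  fixes f :: "'a::euclidean_space \<Rightarrow> 'b::{banach, second_countable_topology}"
  assumes [measurable]: "f \<in> borel_measurable borel"
  shows "(LINT x|lborel. f (x + a)) = (LINT x|lborel. f x)"
proof -
  have "(LINT x|lborel. f x) = (LINT x|distr lborel borel ((+) a). f x)"
    by (simp add: lborel_distr_plus)
  also have "\<dots> = (LINT x|lborel. f (a + x))"
    by (subst integral_distr) auto
  finally show ?thesis by (simp add: add.commute)
qed

lemma lborel_integrable_translate:
  fixes f :: "'a::euclidean_space \<Rightarrow> 'b::{banach, second_countable_topology}"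
  assumes "integrable lborel f"
  shows "integrable lborel (\<lambda>x. f (x + a))"
proof -
  have "integrable (distr lborel borel ((+) a)) f"
    using assms by (simp add: lborel_distr_plus)
  then have "integrable lborel (\<lambda>x. f (a + x))"
    by (rule integrable_distr[rotated]) simp
  then show ?thesis by (simp add: add.commute)
qed

lemma l2sq_lborel_translate:
  fixes f :: "'a::euclidean_space \<Rightarrow> complex"
  assumes [measurable]: "f \<in> borel_measurable borel"
  shows "l2sq lborel (\<lambda>x. f (x + a)) = l2sq lborel f"
  unfolding l2sq_def using nn_integral_lborel_translate[of "\<lambda>x. ennreal ((cmod (f x))\<^sup>2)" a] by simp

lemma integral_torus:
  fixes f :: "real^'n \<Rightarrow> complex"
  shows "(LINT \<xi>|torus_measure. f \<xi>) = (LINT \<xi>|lborel. f \<xi> * indicator unit_cube \<xi>)"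
  by (subst integral_restrict_space) (auto simp: indicator_def intro!: Bochner_Integration.integral_cong)

lemma integrable_mult_indicator_complex:
  fixes f :: "'a \<Rightarrow> complex"
  assumes "integrable M f" "A \<in> sets M"
  shows "integrable M (\<lambda>x. f x * indicator A x)"
  using integrable_mult_indicator[OF assms(2,1)]
  by (rule Bochner_Integration.integrable_cong[THEN iffD1, rotated 2]) (auto simp: indicator_def)

definition fourier_integral :: "(real^'n \<Rightarrow> complex) \<Rightarrow> real^'n \<Rightarrow> complex" where
  "fourier_integral g t = (LINT x|lborel. g x * cis (2 * pi * (x \<bullet> t)))"

lemma integrable_of_l2_bounded_support:
  fixes g :: "'a::euclidean_space \<Rightarrow> complex"
  assumes [measurable]: "g \<in> borel_measurable borel" and fin: "l2sq lborel g < top"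
    and supp: "\<And>x. norm x > R \<Longrightarrow> g x = 0"
  shows "integrable lborel g"
proof -
  have "integrable lborel (\<lambda>x. (cmod (g x))\<^sup>2)"
    using fin by (simp add: integrable_iff_bounded l2sq_def)
  moreover have "integrable lborel (indicator (cball 0 R) :: 'a \<Rightarrow> real)"
    using emeasure_lborel_cball_finite[of 0 R] by (intro integrable_real_indicator) auto
  ultimately have int: "integrable lborel (\<lambda>x. indicator (cball 0 R) x + (cmod (g x))\<^sup>2)"
    by (intro Bochner_Integration.integrable_add)
  show ?thesis
  proof (rule Bochner_Integration.integrable_bound[OF int])
    show "AE x in lborel. norm (g x) \<le> norm (indicator (cball 0 R) x + (cmod (g x))\<^sup>2)"
    proof (rule AE_I2)
      fix x
      have "cmod (g x) \<le> 1 + (cmod (g x))\<^sup>2"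
        using sum_squares_bound[of 1 "cmod (g x)"] norm_ge_zero[of "g x"] unfolding one_power2 by linarith
      then show "norm (g x) \<le> norm (indicator (cball 0 R) x + (cmod (g x))\<^sup>2)"
        using supp[of x] by (cases "x \<in> cball 0 R") (auto simp: not_le)
    qed
  qed simp
qed

lemma floor_vec_in_kcube:
  assumes "norm x \<le> R"
  shows "floor_vec x \<in> kcube (nat \<lceil>R\<rceil> + 1)"
  unfolding kcube_def
proof (intro CollectI allI)
  fix i
  have "\<bar>x $ i\<bar> \<le> R" using component_le_norm_cart[of x i] assms by linarith
  then show "\<bar>floor_vec x $ i\<bar> \<le> int (nat \<lceil>R\<rceil> + 1)"
    unfolding floor_vec_def vec_lambda_beta by linarith
qed

text \<open>The periodization of \<open>x \<mapsto> g x exp (2 \<pi> \<i> x t)\<close> (the Zak transform of \<open>g\<close>). Its Fourier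
  coefficients in \<open>x\<close> are the values of the Fourier transform on \<open>t + \<int>\<^sup>n\<close>, whereas in \<open>t\<close> it is,
  up to a phase, a trigonometric polynomial with coefficients \<open>g (x + p)\<close>. Evaluating the norm
  of the Zak transform in the two orders of integration is Plancherel's identity.\<close>

definition zak :: "(int^'n) set \<Rightarrow> (real^'n \<Rightarrow> complex) \<Rightarrow> real^'n \<Rightarrow> real^'n \<Rightarrow> complex" where
  "zak S g t x = (\<Sum>p\<in>S. g (x + rvec p) * cis (2 * pi * ((x + rvec p) \<bullet> t)))"

context
  fixes g :: "real^'n \<Rightarrow> complex" and R :: real and S :: "(int^'n) set"
  assumes g_meas [measurable]: "g \<in> borel_measurable borel"
    and g_fin: "l2sq lborel g < top"
    and g_supp: "\<And>x. norm x > R \<Longrightarrow> g x = 0"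
    and S_def: "S = kcube (nat \<lceil>R\<rceil> + 1)"
begin

private lemma finS: "finite S"
  unfolding S_def by simp

private lemma g_zero: "x \<in> unit_cube \<Longrightarrow> p \<notin> S \<Longrightarrow> g (x + rvec p) = 0"
proof -
  assume "x \<in> unit_cube" "p \<notin> S"
  then have "p = floor_vec (x + rvec p)" using diff_rvec_in_unit_cube_iff[of "x + rvec p" p] by simp
  then have "\<not> norm (x + rvec p) \<le> R"
    using \<open>p \<notin> S\<close> floor_vec_in_kcube[of "x + rvec p" R] unfolding S_def by auto
  then show ?thesis by (intro g_supp) simp
qed

private lemma zak_measurable [measurable]: "zak S g t \<in> borel_measurable borel"
  unfolding zak_def by measurable

private lemma zak_finite: "l2sq torus_measure (zak S g t) < top"
proof -
  have "l2sq torus_measure (\<lambda>x. \<Sum>p\<in>S. 1 * (g (x + rvec p) * cis (2 * pi * ((x + rvec p) \<bullet> t)))) < top"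
  proof (rule l2sq_sum_finite[OF finS])
    fix p assume "p \<in> S"
    have "l2sq torus_measure (\<lambda>x. g (x + rvec p) * cis (2 * pi * ((x + rvec p) \<bullet> t)))
        \<le> l2sq lborel (\<lambda>x. g (x + rvec p))"
      unfolding l2sq_def nn_integral_torus
      by (intro nn_integral_mono) (auto simp: norm_mult indicator_def)
    also have "\<dots> < top" using g_fin by (simp add: l2sq_lborel_translate)
    finally show "l2sq torus_measure (\<lambda>x. g (x + rvec p) * cis (2 * pi * ((x + rvec p) \<bullet> t))) < top" .
  qed measurable
  then show ?thesis by (simp add: zak_def[abs_def])
qed

private lemma fourier_integral_zak:
  "fourier_integral g (t + rvec m) = fourier_coeff (zak S g t) (- m)"
proof -
  define h where "h x = g x * cis (2 * pi * (x \<bullet> t)) * character m x" for x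
  have [measurable]: "h \<in> borel_measurable borel" unfolding h_def by measurable
  have gi: "integrable lborel g"
    by (rule integrable_of_l2_bounded_support[OF g_meas g_fin g_supp])
  have hi: "integrable lborel h"
    by (rule Bochner_Integration.integrable_bound[OF gi]) (auto simp: h_def norm_mult)
  have hind: "integrable lborel (\<lambda>x. h x * indicator unit_cube (x - rvec p))" for p
  proof -
    have "integrable lborel (\<lambda>x. h x * indicator {x. x - rvec p \<in> unit_cube} x)"
      by (rule integrable_mult_indicator_complex[OF hi]) measurable
    then show ?thesis by (simp add: indicator_def)
  qed
  have hind': "integrable lborel (\<lambda>x. h (x + rvec p) * indicator unit_cube x)" for p
    using lborel_integrable_translate[OF hind[of p], of "rvec p"] by simp
  have "fourier_integral g (t + rvec m) = (LINT x|lborel. h x)"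
    unfolding fourier_integral_def h_def character_def
    by (simp add: inner_add_right distrib_left mult.assoc flip: cis_mult)
  also have "\<dots> = (LINT x|lborel. (\<Sum>p\<in>S. h x * indicator unit_cube (x - rvec p)))"
  proof (rule Bochner_Integration.integral_cong)
    fix x
    have "(\<Sum>p\<in>S. h x * indicator unit_cube (x - rvec p)) = (\<Sum>p\<in>S. if p = floor_vec x then h x else 0)"
      by (intro sum.cong) (auto simp: indicator_def diff_rvec_in_unit_cube_iff)
    also have "\<dots> = h x"
      using finS g_supp[of x] floor_vec_in_kcube[of x R] by (auto simp: S_def h_def not_le[symmetric])
    finally show "h x = (\<Sum>p\<in>S. h x * indicator unit_cube (x - rvec p))" by simp
  qed simp
  also have "\<dots> = (\<Sum>p\<in>S. LINT x|lborel. h x * indicator unit_cube (x - rvec p))"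
    by (rule Bochner_Integration.integral_sum) (rule hind)
  also have "\<dots> = (\<Sum>p\<in>S. LINT x|lborel. h (x + rvec p) * indicator unit_cube x)"
  proof (rule sum.cong[OF refl])
    fix p
    show "(LINT x|lborel. h x * indicator unit_cube (x - rvec p))
      = (LINT x|lborel. h (x + rvec p) * indicator unit_cube x)"
      using lborel_integral_translate[of "\<lambda>x. h x * indicator unit_cube (x - rvec p)" "rvec p"]
      by simp
  qed
  also have "\<dots> = (LINT x|lborel. (\<Sum>p\<in>S. h (x + rvec p) * indicator unit_cube x))"
    by (rule Bochner_Integration.integral_sum[symmetric]) (rule hind')
  also have "\<dots> = (LINT x|torus_measure. (\<Sum>p\<in>S. h (x + rvec p)))"
    by (simp add: integral_torus sum_distrib_right)
  also have "\<dots> = fourier_coeff (zak S g t) (- m)"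
    unfolding fourier_coeff_def zak_def h_def character_periodic
    by (simp add: cnj_character sum_distrib_right)
  finally show ?thesis .
qed

private lemma sum_fourier_integral:
  "(\<integral>\<^sup>+ m. ennreal ((cmod (fourier_integral g (t + rvec m)))\<^sup>2) \<partial>count_space UNIV)
    = l2sq torus_measure (zak S g t)"
proof -
  have bij: "bij_betw (uminus :: int^'n \<Rightarrow> int^'n) UNIV UNIV"
    by (rule bij_betwI[of _ _ _ uminus]) auto
  have "(\<integral>\<^sup>+ m. ennreal ((cmod (fourier_coeff (zak S g t) (- m)))\<^sup>2) \<partial>count_space UNIV)
      = (\<integral>\<^sup>+ m. ennreal ((cmod (fourier_coeff (zak S g t) m))\<^sup>2) \<partial>count_space UNIV)"
    by (rule nn_integral_bij_count_space[OF bij])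
  then show ?thesis
    using parseval[OF _ zak_finite, of t] by (simp add: fourier_integral_zak)
qed

private lemma zak_norm_in_t:
  "(\<integral>\<^sup>+ t. ennreal ((cmod (zak S g t x))\<^sup>2) \<partial>torus_measure) = (\<Sum>p\<in>S. ennreal ((cmod (g (x + rvec p)))\<^sup>2))"
proof -
  have "zak S g t x = cis (2 * pi * (x \<bullet> t)) * trig_poly S (\<lambda>p. g (x + rvec p)) t" for t
  proof -
    have "cis (2 * pi * ((x + rvec p) \<bullet> t)) = cis (2 * pi * (x \<bullet> t)) * character p t" for p
      by (simp add: character_def cis_mult inner_add_left distrib_left inner_commute[of t])
    then show ?thesis
      by (simp add: zak_def trig_poly_def sum_distrib_left mult_ac)
  qed
  then have "cmod (zak S g t x) = cmod (trig_poly S (\<lambda>p. g (x + rvec p)) t)" for t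
    by (simp add: norm_mult)
  then show ?thesis
    using trig_poly_l2sq[OF finS, of "\<lambda>p. g (x + rvec p)"] by (simp add: l2sq_def)
qed

lemma plancherel_aux: "l2sq lborel (fourier_integral g) = l2sq lborel g"
proof -
  have fm [measurable]: "fourier_integral g \<in> borel_measurable borel"
    unfolding fourier_integral_def[abs_def] by measurable
  have Zm: "(\<lambda>(t, x). ennreal ((cmod (zak S g t x))\<^sup>2) * indicator unit_cube t * indicator unit_cube x)
      \<in> borel_measurable (lborel \<Otimes>\<^sub>M lborel)"
    unfolding zak_def by measurable
  have "l2sq lborel (fourier_integral g)
      = (\<integral>\<^sup>+ t. (\<integral>\<^sup>+ m. ennreal ((cmod (fourier_integral g (t + rvec m)))\<^sup>2) \<partial>count_space UNIV) \<partial>torus_measure)"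
    unfolding l2sq_def by (rule nn_integral_lborel_tiling) simp
  also have "\<dots> = (\<integral>\<^sup>+ t. (\<integral>\<^sup>+ x. ennreal ((cmod (zak S g t x))\<^sup>2) \<partial>torus_measure) \<partial>torus_measure)"
    unfolding sum_fourier_integral l2sq_def ..
  also have "\<dots> = (\<integral>\<^sup>+ t. (\<integral>\<^sup>+ x. ennreal ((cmod (zak S g t x))\<^sup>2) * indicator unit_cube t * indicator unit_cube x \<partial>lborel) \<partial>lborel)"
    unfolding nn_integral_torus
    by (intro nn_integral_cong) (auto simp: indicator_def)
  also have "\<dots> = (\<integral>\<^sup>+ x. (\<integral>\<^sup>+ t. ennreal ((cmod (zak S g t x))\<^sup>2) * indicator unit_cube t * indicator unit_cube x \<partial>lborel) \<partial>lborel)"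
    by (rule lborel_pair.Fubini'[symmetric]) (rule Zm)
  also have "\<dots> = (\<integral>\<^sup>+ x. (\<integral>\<^sup>+ t. ennreal ((cmod (zak S g t x))\<^sup>2) \<partial>torus_measure) \<partial>torus_measure)"
    unfolding nn_integral_torus
    by (intro nn_integral_cong) (auto simp: indicator_def)
  also have "\<dots> = (\<integral>\<^sup>+ x. (\<integral>\<^sup>+ p. ennreal ((cmod (g (x + rvec p)))\<^sup>2) \<partial>count_space UNIV) \<partial>torus_measure)"
    unfolding zak_norm_in_t
  proof (rule nn_integral_cong)
    fix x :: "real^'n" assume "x \<in> space torus_measure"
    then show "(\<Sum>p\<in>S. ennreal ((cmod (g (x + rvec p)))\<^sup>2))
        = (\<integral>\<^sup>+ p. ennreal ((cmod (g (x + rvec p)))\<^sup>2) \<partial>count_space UNIV)"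
      using g_zero[of x] by (intro nn_integral_count_space'[symmetric] finS) auto
  qed
  also have "\<dots> = l2sq lborel g"
    unfolding l2sq_def by (rule nn_integral_lborel_tiling[symmetric]) simp
  finally show ?thesis .
qed

end

theorem plancherel_bounded_support:
  assumes "g \<in> borel_measurable borel" "l2sq lborel g < top" "\<And>x. norm x > R \<Longrightarrow> g x = 0"
  shows "l2sq lborel (fourier_integral g) = l2sq lborel g"
  by (rule plancherel_aux[OF assms refl])

section \<open>The kernel of the Weyl transform\<close>

definition weyl_integral ::
  "((real^'n) \<times> (real^'n) \<Rightarrow> complex) \<Rightarrow> (real^'n) \<times> (real^'n) \<Rightarrow> complex" where
  "weyl_integral f = (\<lambda>(\<xi>, \<eta>). LINT x|lborel. f (x, \<eta> - \<xi>) * cis (pi * (x \<bullet> (\<xi> + \<eta>))))"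

definition L2_bounded_x :: "((real^'n) \<times> (real^'n) \<Rightarrow> complex) set" where
  "L2_bounded_x = {f \<in> L2. \<exists>R. \<forall>x y. norm x > R \<longrightarrow> f (x, y) = 0}"

lemma nn_integral_lborel_pair:
  fixes f :: "'a::euclidean_space \<times> 'b::euclidean_space \<Rightarrow> ennreal"
  assumes [measurable]: "f \<in> borel_measurable borel"
  shows "(\<integral>\<^sup>+ z. f z \<partial>lborel) = (\<integral>\<^sup>+ x. (\<integral>\<^sup>+ y. f (x, y) \<partial>lborel) \<partial>lborel)"
    and "(\<integral>\<^sup>+ z. f z \<partial>lborel) = (\<integral>\<^sup>+ y. (\<integral>\<^sup>+ x. f (x, y) \<partial>lborel) \<partial>lborel)"
proof -
  have m: "f \<in> borel_measurable (lborel \<Otimes>\<^sub>M lborel)"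
    by (simp add: lborel_prod)
  show 1: "(\<integral>\<^sup>+ z. f z \<partial>lborel) = (\<integral>\<^sup>+ x. (\<integral>\<^sup>+ y. f (x, y) \<partial>lborel) \<partial>lborel)"
    by (subst lborel_prod[symmetric]) (rule lborel.nn_integral_fst[OF m, symmetric])
  show "(\<integral>\<^sup>+ z. f z \<partial>lborel) = (\<integral>\<^sup>+ y. (\<integral>\<^sup>+ x. f (x, y) \<partial>lborel) \<partial>lborel)"
    unfolding 1 by (rule lborel_pair.Fubini'[symmetric]) (simp add: lborel_prod)
qed

lemma weyl_integral_measurable [measurable]:
  assumes [measurable]: "f \<in> borel_measurable borel"
  shows "weyl_integral f \<in> borel_measurable borel"
proof -
  have "(\<lambda>z. LINT x|lborel. f (x, snd z - fst z) * cis (pi * (x \<bullet> (fst z + snd z)))) \<in> borel_measurable borel"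
    by measurable
  then show ?thesis by (simp add: weyl_integral_def case_prod_beta')
qed

text \<open>The map \<open>(\<xi>, \<eta>) \<mapsto> \<eta> - \<xi>\<close> pulls null sets back to null sets. It transports properties of
  almost every section \<open>f (\<cdot>, y)\<close> to almost every argument of the kernel.\<close>

lemma AE_lborel_diff:
  fixes Q :: "'a::euclidean_space \<Rightarrow> bool"
  assumes "AE y in lborel. Q y"
  shows "AE z in lborel. Q (snd z - fst z)"
proof -
  obtain N where N: "N \<in> null_sets lborel" "{y. \<not> Q y} \<subseteq> N"
    using assms by (auto simp: eventually_ae_filter)
  have [measurable]: "N \<in> sets borel" using N(1) by auto
  have "(\<integral>\<^sup>+ z. indicator N (snd z - fst z) \<partial>(lborel :: ('a \<times> 'a) measure))
      = (\<integral>\<^sup>+ x. (\<integral>\<^sup>+ y. indicator N (y + - x) \<partial>lborel) \<partial>lborel)"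
    by (subst nn_integral_lborel_pair(1)) auto
  also have "\<dots> = (\<integral>\<^sup>+ x. (\<integral>\<^sup>+ y. indicator N y \<partial>lborel) \<partial>(lborel :: 'a measure))"
    by (subst nn_integral_lborel_translate) auto
  also have "\<dots> = 0" using N(1) by auto
  finally have "AE z in (lborel :: ('a \<times> 'a) measure). (indicator N (snd z - fst z) :: ennreal) = 0"
    by (subst (asm) nn_integral_0_iff_AE) auto
  then show ?thesis
    by eventually_elim (use N(2) in \<open>auto simp: indicator_def split: if_splits\<close>)
qed

lemma L2_bounded_x_sections:
  assumes "f \<in> L2_bounded_x"
  shows "AE y in lborel. l2sq lborel (\<lambda>x. f (x, y)) < top"
    and "AE y in lborel. integrable lborel (\<lambda>x. f (x, y))"
proof -
  have [measurable]: "f \<in> borel_measurable borel" and fin: "l2sq lborel f < top"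
    using assms by (auto simp: L2_bounded_x_def L2_iff)
  obtain R where R: "\<And>x y. norm x > R \<Longrightarrow> f (x, y) = 0"
    using assms by (auto simp: L2_bounded_x_def)
  have "(\<integral>\<^sup>+ y. l2sq lborel (\<lambda>x. f (x, y)) \<partial>lborel) = l2sq lborel f"
    unfolding l2sq_def by (rule nn_integral_lborel_pair(2)[symmetric]) simp
  moreover have "(\<lambda>y. l2sq lborel (\<lambda>x. f (x, y))) \<in> borel_measurable borel"
    unfolding l2sq_def by measurable
  ultimately have "AE y in lborel. l2sq lborel (\<lambda>x. f (x, y)) \<noteq> \<infinity>"
    using fin by (intro nn_integral_PInf_AE) auto
  then show 1: "AE y in lborel. l2sq lborel (\<lambda>x. f (x, y)) < top"
    by eventually_elim (simp add: less_top)
  show "AE y in lborel. integrable lborel (\<lambda>x. f (x, y))"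
    using 1 by eventually_elim (rule integrable_of_l2_bounded_support[where R = R], use R in auto)
qed

text \<open>Substituting \<open>\<eta> = \<xi> + y\<close>, the kernel becomes for fixed \<open>y\<close> the Fourier transform of
  \<open>f (\<cdot>, y)\<close> at \<open>\<xi> + y/2\<close>.\<close>

theorem weyl_integral_isometry:
  assumes "f \<in> L2_bounded_x"
  shows "l2sq lborel (weyl_integral f) = l2sq lborel f"
proof -
  have [measurable]: "f \<in> borel_measurable borel"
    using assms by (auto simp: L2_bounded_x_def L2_iff)
  obtain R where R: "\<And>x y. norm x > R \<Longrightarrow> f (x, y) = 0"
    using assms by (auto simp: L2_bounded_x_def)
  let ?W = "\<lambda>\<xi> \<eta>. ennreal ((cmod (weyl_integral f (\<xi>, \<eta>)))\<^sup>2)"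
  have eq: "weyl_integral f (\<xi>, y + \<xi>) = fourier_integral (\<lambda>x. f (x, y)) (\<xi> + (1/2) *\<^sub>R y)" for \<xi> y
  proof -
    have "pi * (x \<bullet> (\<xi> + (y + \<xi>))) = 2 * pi * (x \<bullet> (\<xi> + (1/2) *\<^sub>R y))" for x
      by (simp only: inner_add_right inner_scaleR_right) (simp add: field_simps)
    then show ?thesis
      by (simp only: weyl_integral_def fourier_integral_def prod.case add_diff_cancel_right')
  qed
  have "l2sq lborel (weyl_integral f) = (\<integral>\<^sup>+ \<xi>. (\<integral>\<^sup>+ \<eta>. ?W \<xi> \<eta> \<partial>lborel) \<partial>lborel)"
    unfolding l2sq_def by (rule nn_integral_lborel_pair(1)) simp
  also have "\<dots> = (\<integral>\<^sup>+ \<xi>. (\<integral>\<^sup>+ y. ?W \<xi> (y + \<xi>) \<partial>lborel) \<partial>lborel)"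
    by (subst nn_integral_lborel_translate) auto
  also have "\<dots> = (\<integral>\<^sup>+ y. (\<integral>\<^sup>+ \<xi>. ?W \<xi> (y + \<xi>) \<partial>lborel) \<partial>lborel)"
    by (rule lborel_pair.Fubini'[symmetric]) simp
  also have "\<dots> = (\<integral>\<^sup>+ y. l2sq lborel (fourier_integral (\<lambda>x. f (x, y))) \<partial>lborel)"
  proof (rule nn_integral_cong)
    fix y
    have [measurable]: "fourier_integral (\<lambda>x. f (x, y)) \<in> borel_measurable borel"
      unfolding fourier_integral_def[abs_def] by measurable
    show "(\<integral>\<^sup>+ \<xi>. ?W \<xi> (y + \<xi>) \<partial>lborel) = l2sq lborel (fourier_integral (\<lambda>x. f (x, y)))"
      unfolding eq l2sq_def
      by (rule nn_integral_lborel_translate[of "\<lambda>\<xi>. ennreal ((cmod (fourier_integral (\<lambda>x. f (x, y)) \<xi>))\<^sup>2)"])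
         measurable
  qed
  also have "\<dots> = (\<integral>\<^sup>+ y. l2sq lborel (\<lambda>x. f (x, y)) \<partial>lborel)"
    using L2_bounded_x_sections(1)[OF assms]
    by (intro nn_integral_cong_AE, eventually_elim)
       (rule plancherel_bounded_support[where R = R], use R in auto)
  also have "\<dots> = l2sq lborel f"
    unfolding l2sq_def by (rule nn_integral_lborel_pair(2)[symmetric]) simp
  finally show ?thesis .
qed

lemma L2_bounded_x_sum:
  assumes "finite J" "\<And>j. j \<in> J \<Longrightarrow> f j \<in> L2_bounded_x"
  shows "(\<lambda>z. \<Sum>j\<in>J. c j * f j z) \<in> L2_bounded_x"
proof -
  have "\<forall>j\<in>J. \<exists>R. \<forall>x y. norm x > R \<longrightarrow> f j (x, y) = 0"
    using assms by (auto simp: L2_bounded_x_def)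
  then obtain R where R: "\<And>j x y. j \<in> J \<Longrightarrow> norm x > R j \<Longrightarrow> f j (x, y) = 0"
    by metis
  have "(\<Sum>j\<in>J. c j * f j (x, y)) = 0" if "norm x > Max (insert 0 (R ` J))" for x y
    using that assms(1) by (intro sum.neutral) (auto simp: R)
  then show ?thesis
    using assms L2_sum[of J f c] unfolding L2_bounded_x_def by blast
qed

lemma weyl_integral_sum:
  assumes "finite J" "\<And>j. j \<in> J \<Longrightarrow> f j \<in> L2_bounded_x"
  shows "AE z in lborel. weyl_integral (\<lambda>z. \<Sum>j\<in>J. c j * f j z) z = (\<Sum>j\<in>J. c j * weyl_integral (f j) z)"
proof -
  have "AE z in lborel. \<forall>j\<in>J. integrable lborel (\<lambda>x. f j (x, snd z - fst z))"
    using assms by (intro AE_finite_allI AE_lborel_diff L2_bounded_x_sections(2)) auto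
  then show ?thesis
  proof eventually_elim
    case (elim z)
    obtain \<xi> \<eta> where z: "z = (\<xi>, \<eta>)" by (cases z)
    have int: "integrable lborel (\<lambda>x. f j (x, \<eta> - \<xi>) * cis (pi * (x \<bullet> (\<xi> + \<eta>))))" if "j \<in> J" for j
    proof (rule Bochner_Integration.integrable_bound)
      show "integrable lborel (\<lambda>x. f j (x, \<eta> - \<xi>))" using elim that z by simp
      then show "(\<lambda>x. f j (x, \<eta> - \<xi>) * cis (pi * (x \<bullet> (\<xi> + \<eta>)))) \<in> borel_measurable lborel"
        by measurable
    qed (simp add: norm_mult)
    have "weyl_integral (\<lambda>z. \<Sum>j\<in>J. c j * f j z) z
        = (LINT x|lborel. (\<Sum>j\<in>J. c j * (f j (x, \<eta> - \<xi>) * cis (pi * (x \<bullet> (\<xi> + \<eta>))))))"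
      by (simp add: weyl_integral_def z sum_distrib_right mult.assoc)
    also have "\<dots> = (\<Sum>j\<in>J. c j * weyl_integral (f j) z)"
      using int by (subst Bochner_Integration.integral_sum) (auto simp: weyl_integral_def z)
    finally show ?case .
  qed
qed

text \<open>The graph of the Weyl transform: approximating \<open>f\<close> by any functions of bounded support in
  \<open>x\<close>, not only by truncations to balls, makes the graph visibly invariant under translations.\<close>

definition weyl_pair ::
  "((real^'n) \<times> (real^'n) \<Rightarrow> complex) \<Rightarrow> ((real^'n) \<times> (real^'n) \<Rightarrow> complex) \<Rightarrow> bool" where
  "weyl_pair f K \<longleftrightarrow> f \<in> L2 \<and> K \<in> borel_measurable borel \<and>
    (\<exists>g. (\<forall>N. g N \<in> L2_bounded_x) \<and> (\<lambda>N. l2sq lborel (\<lambda>z. g N z - f z)) \<longlonglongrightarrow> 0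
      \<and> (\<lambda>N. l2sq lborel (\<lambda>z. weyl_integral (g N) z - K z)) \<longlonglongrightarrow> 0)"

lemma L2_bounded_x_measurable: "f \<in> L2_bounded_x \<Longrightarrow> f \<in> borel_measurable borel"
  by (simp add: L2_bounded_x_def L2_def)

lemma weyl_pair_isometry:
  assumes "weyl_pair f K"
  shows "l2sq lborel K = l2sq lborel f"
proof -
  obtain g where g: "\<And>N. g N \<in> L2_bounded_x" and f: "f \<in> L2" and [measurable]: "K \<in> borel_measurable borel"
    and lim: "(\<lambda>N. l2sq lborel (\<lambda>z. g N z - f z)) \<longlonglongrightarrow> 0"
      "(\<lambda>N. l2sq lborel (\<lambda>z. weyl_integral (g N) z - K z)) \<longlonglongrightarrow> 0"
    using assms by (auto simp: weyl_pair_def)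
  have [measurable]: "f \<in> borel_measurable borel" using f by (rule L2_measurable)
  have [measurable]: "g N \<in> borel_measurable borel" for N using g by (rule L2_bounded_x_measurable)
  have l1: "(\<lambda>N. l2sq lborel (g N)) \<longlonglongrightarrow> l2sq lborel f"
    using f by (intro l2sq_tendsto lim) (auto simp: L2_iff)
  obtain N where N: "l2sq lborel (\<lambda>z. weyl_integral (g N) z - K z) < 1"
    using order_tendstoD(2)[OF lim(2), of 1] by (auto simp: eventually_sequentially)
  have "l2sq lborel (weyl_integral (g N)) < top"
    using g[of N] by (simp add: weyl_integral_isometry) (simp add: L2_bounded_x_def L2_iff)
  moreover have "l2sq lborel (\<lambda>z. weyl_integral (g N) z - K z) < top"
    using N by (rule order_less_trans) simp
  moreover have "weyl_integral (g N) \<in> borel_measurable lborel"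
    "(\<lambda>z. weyl_integral (g N) z - K z) \<in> borel_measurable lborel"
    by simp_all
  ultimately have "l2sq lborel (\<lambda>z. weyl_integral (g N) z - (weyl_integral (g N) z - K z)) < top"
    using l2sq_diff_finite by blast
  then have "l2sq lborel K < top" by simp
  then have "(\<lambda>N. l2sq lborel (weyl_integral (g N))) \<longlonglongrightarrow> l2sq lborel K"
    by (intro l2sq_tendsto lim) auto
  then have "(\<lambda>N. l2sq lborel (g N)) \<longlonglongrightarrow> l2sq lborel K"
    using g by (simp add: weyl_integral_isometry)
  then show ?thesis using l1 by (rule LIMSEQ_unique)
qed

lemma weyl_pair_sum:
  assumes J: "finite J" and "\<And>j. j \<in> J \<Longrightarrow> weyl_pair (f j) (K j)"
  shows "weyl_pair (\<lambda>z. \<Sum>j\<in>J. c j * f j z) (\<lambda>z. \<Sum>j\<in>J. c j * K j z)"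
proof -
  have "\<forall>j\<in>J. \<exists>g. (\<forall>N. g N \<in> L2_bounded_x) \<and> (\<lambda>N. l2sq lborel (\<lambda>z. g N z - f j z)) \<longlonglongrightarrow> 0
      \<and> (\<lambda>N. l2sq lborel (\<lambda>z. weyl_integral (g N) z - K j z)) \<longlonglongrightarrow> 0"
    using assms(2) by (simp add: weyl_pair_def)
  from bchoice[OF this] obtain g where g: "\<And>j N. j \<in> J \<Longrightarrow> g j N \<in> L2_bounded_x"
    "\<And>j. j \<in> J \<Longrightarrow> (\<lambda>N. l2sq lborel (\<lambda>z. g j N z - f j z)) \<longlonglongrightarrow> 0"
    "\<And>j. j \<in> J \<Longrightarrow> (\<lambda>N. l2sq lborel (\<lambda>z. weyl_integral (g j N) z - K j z)) \<longlonglongrightarrow> 0"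
    by blast
  have fL: "f j \<in> L2" "f j \<in> borel_measurable borel" "K j \<in> borel_measurable borel" if "j \<in> J" for j
    using assms(2)[OF that] by (auto simp: weyl_pair_def L2_measurable)
  have gm: "g j N \<in> borel_measurable borel" if "j \<in> J" for j N
    using g(1)[OF that] by (rule L2_bounded_x_measurable)
  let ?g = "\<lambda>N z. \<Sum>j\<in>J. c j * g j N z"
  have "(\<lambda>N. l2sq lborel (\<lambda>z. \<Sum>j\<in>J. c j * (g j N z - f j z))) \<longlonglongrightarrow> 0"
    using fL gm by (intro l2_tendsto_sum J g) auto
  then have 1: "(\<lambda>N. l2sq lborel (\<lambda>z. ?g N z - (\<Sum>j\<in>J. c j * f j z))) \<longlonglongrightarrow> 0"
    by (simp add: right_diff_distrib sum_subtractf)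
  have "(\<lambda>N. l2sq lborel (\<lambda>z. \<Sum>j\<in>J. c j * (weyl_integral (g j N) z - K j z))) \<longlonglongrightarrow> 0"
    using fL gm by (intro l2_tendsto_sum J g) auto
  moreover have "l2sq lborel (\<lambda>z. \<Sum>j\<in>J. c j * (weyl_integral (g j N) z - K j z))
      = l2sq lborel (\<lambda>z. weyl_integral (?g N) z - (\<Sum>j\<in>J. c j * K j z))" for N
  proof (rule l2sq_cong_AE)
    show "AE z in lborel. (\<Sum>j\<in>J. c j * (weyl_integral (g j N) z - K j z))
        = weyl_integral (?g N) z - (\<Sum>j\<in>J. c j * K j z)"
    proof -
      have "AE z in lborel. weyl_integral (?g N) z = (\<Sum>j\<in>J. c j * weyl_integral (g j N) z)"
        by (rule weyl_integral_sum[OF J]) (rule g(1))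
      then show ?thesis
        by eventually_elim (simp add: right_diff_distrib sum_subtractf)
    qed
  qed
  ultimately have 2: "(\<lambda>N. l2sq lborel (\<lambda>z. weyl_integral (?g N) z - (\<Sum>j\<in>J. c j * K j z))) \<longlonglongrightarrow> 0"
    by simp
  have 3: "?g N \<in> L2_bounded_x" for N
    using J g(1) by (intro L2_bounded_x_sum)
  have 4: "(\<lambda>z. \<Sum>j\<in>J. c j * f j z) \<in> L2"
    using J fL by (intro L2_sum) auto
  have 5: "(\<lambda>z. \<Sum>j\<in>J. c j * K j z) \<in> borel_measurable borel"
    using fL by (intro borel_measurable_sum borel_measurable_times) auto
  show ?thesis unfolding weyl_pair_def
    by (intro conjI 4 5 exI[of _ ?g] allI 3 1 2)
qed

text \<open>The truncations of \<open>f\<close> to balls converge to \<open>f\<close>, hence their kernels are a Cauchy sequence by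
  the isometry; so the limit that \<open>weyl_kernel\<close> chooses exists.\<close>

lemma weyl_kernel_pair:
  fixes f :: "(real^'n) \<times> (real^'n) \<Rightarrow> complex"
  assumes f: "f \<in> L2"
  shows "weyl_pair f (weyl_kernel f)" and "weyl_kernel f \<in> L2"
proof -
  have fm [measurable]: "f \<in> borel_measurable borel" and fin: "l2sq lborel f < top"
    using f by (auto simp: L2_iff)
  define g where "g N z = indicator (cball 0 (real N)) (fst z) * f z" for N :: nat and z
  have gm [measurable]: "g N \<in> borel_measurable borel" for N
  proof -
    have [measurable]: "(cball 0 (real N) :: (real^'n) set) \<in> sets borel"
      by (intro borel_closed closed_cball)
    show ?thesis unfolding g_def by measurable
  qed
  have gle: "cmod (g N z) \<le> cmod (f z)" for N z
    by (simp add: g_def indicator_def)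
  have g: "g N \<in> L2_bounded_x" for N
    unfolding L2_bounded_x_def L2_iff
  proof (intro CollectI conjI exI[of _ "real N"] allI impI)
    show "l2sq lborel (g N) < top"
      using l2sq_mono_AE[of "g N" f lborel] gle fin by (auto intro: order_le_less_trans)
  qed (auto simp: g_def)
  have tr: "truncated_weyl_kernel f N = weyl_integral (g N)" for N
    unfolding truncated_weyl_kernel_def weyl_integral_def set_lebesgue_integral_def g_def
    by (auto simp: fun_eq_iff indicator_def cis_conv_exp mult.assoc intro!: Bochner_Integration.integral_cong)
  have lim: "(\<lambda>N. l2sq lborel (\<lambda>z. g N z - f z)) \<longlonglongrightarrow> 0"
  proof (rule l2_dominated_convergence[where w = "\<lambda>z. cmod (f z)"])
    show "AE z in lborel. (\<lambda>N. g N z) \<longlonglongrightarrow> f z"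
    proof (rule AE_I2)
      fix z :: "(real^'n) \<times> (real^'n)"
      obtain N0 :: nat where "norm (fst z) \<le> real N0" using real_arch_simple by blast
      then have "g N z = f z" if "N \<ge> N0" for N
        using that by (auto simp: g_def indicator_def)
      then show "(\<lambda>N. g N z) \<longlonglongrightarrow> f z"
        by (intro tendsto_eventually) (auto simp: eventually_sequentially)
    qed
  qed (use gle fin in \<open>auto simp: l2sq_def\<close>)
  have cauchy: "\<exists>N. \<forall>m\<ge>N. \<forall>n\<ge>N. l2sq lborel (\<lambda>z. weyl_integral (g m) z - weyl_integral (g n) z) \<le> ennreal e"
    if "e > 0" for e
  proof -
    have "l2sq lborel (\<lambda>z. weyl_integral (g m) z - weyl_integral (g n) z) = l2sq lborel (\<lambda>z. g m z - g n z)" for m n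
    proof -
      let ?c = "\<lambda>b. if b then 1 else - 1 :: complex" and ?h = "\<lambda>b. if b then g m else g n"
      have "l2sq lborel (\<lambda>z. weyl_integral (g m) z - weyl_integral (g n) z)
          = l2sq lborel (weyl_integral (\<lambda>z. \<Sum>b\<in>{True, False}. ?c b * ?h b z))"
      proof (rule l2sq_cong_AE)
        have "AE z in lborel. weyl_integral (\<lambda>z. \<Sum>b\<in>{True, False}. ?c b * ?h b z) z
            = (\<Sum>b\<in>{True, False}. ?c b * weyl_integral (?h b) z)"
          by (rule weyl_integral_sum) (use g in auto)
        then show "AE z in lborel. weyl_integral (g m) z - weyl_integral (g n) z
            = weyl_integral (\<lambda>z. \<Sum>b\<in>{True, False}. ?c b * ?h b z) z"
          by eventually_elim simp
      qed
      also have "\<dots> = l2sq lborel (\<lambda>z. \<Sum>b\<in>{True, False}. ?c b * ?h b z)"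
        using g by (intro weyl_integral_isometry L2_bounded_x_sum) auto
      finally show ?thesis by simp
    qed
    then show ?thesis
      using l2_tendsto_imp_Cauchy[OF _ _ lim that] by simp
  qed
  obtain K where K: "K \<in> borel_measurable lborel"
    "(\<lambda>N. l2sq lborel (\<lambda>z. weyl_integral (g N) z - K z)) \<longlonglongrightarrow> 0"
    by (rule l2_complete[of "\<lambda>N. weyl_integral (g N)" lborel, OF _ cauchy]) auto
  have pair: "weyl_pair f K'" if "K' \<in> borel_measurable borel"
      "(\<lambda>N. l2sq lborel (\<lambda>z. weyl_integral (g N) z - K' z)) \<longlonglongrightarrow> 0" for K'
    unfolding weyl_pair_def using f g lim that by blast
  have "K \<in> L2"
    using K weyl_pair_isometry[OF pair, of K] fin by (simp add: L2_iff)
  then have ex: "\<exists>K. K \<in> L2 \<and> L2_tendsto (truncated_weyl_kernel f) K"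
    using K(2) unfolding L2_tendsto_iff tr by blast
  have *: "weyl_kernel f \<in> L2 \<and> L2_tendsto (truncated_weyl_kernel f) (weyl_kernel f)"
    unfolding weyl_kernel_def by (rule someI_ex[OF ex])
  then show "weyl_kernel f \<in> L2" by simp
  show "weyl_pair f (weyl_kernel f)"
    using * unfolding L2_tendsto_iff tr by (intro pair) (auto simp: L2_iff)
qed

lemma twisted_translate_eq:
  "twisted_translate (k, l) f z = cis (pi * (fst z \<bullet> rvec l - snd z \<bullet> rvec k)) * f (z + (- rvec k, - rvec l))"
  by (cases z) (simp add: twisted_translate_def cis_conv_exp mult_ac)

lemma twisted_translate_measurable [measurable]:
  assumes [measurable]: "f \<in> borel_measurable borel"
  shows "twisted_translate j f \<in> borel_measurable borel"
proof -
  obtain k l where j: "j = (k, l)" by (cases j)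
  have "(\<lambda>z. cis (pi * (fst z \<bullet> rvec l - snd z \<bullet> rvec k)) * f (z + (- rvec k, - rvec l)))
      \<in> borel_measurable borel"
    by measurable
  then show ?thesis by (simp add: j twisted_translate_eq[abs_def])
qed

lemma l2sq_twisted_translate:
  assumes "f \<in> borel_measurable borel"
  shows "l2sq lborel (twisted_translate j f) = l2sq lborel f"
proof -
  obtain k l where j: "j = (k, l)" by (cases j)
  have "l2sq lborel (twisted_translate j f) = l2sq lborel (\<lambda>z. f (z + (- rvec k, - rvec l)))"
    unfolding j twisted_translate_eq[abs_def] by (rule l2sq_unimodular) simp
  then show ?thesis using assms by (simp add: l2sq_lborel_translate)
qed

lemma twisted_translate_L2: "f \<in> L2 \<Longrightarrow> twisted_translate j f \<in> L2"
  by (auto simp: L2_iff l2sq_twisted_translate)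

lemma twisted_translate_diff:
  "twisted_translate j f z - twisted_translate j g z = twisted_translate j (\<lambda>z. f z - g z) z"
  by (cases j) (simp add: twisted_translate_eq right_diff_distrib)

lemma weyl_integral_twisted_translate:
  assumes [measurable]: "f \<in> borel_measurable borel"
  shows "weyl_integral (twisted_translate (k, l) f) (\<xi>, \<eta>)
    = cis (pi * (rvec k \<bullet> rvec l)) * character k \<xi> * weyl_integral f (\<xi> + rvec l, \<eta>)"
proof -
  let ?h = "\<lambda>x. twisted_translate (k, l) f (x, \<eta> - \<xi>) * cis (pi * (x \<bullet> (\<xi> + \<eta>)))"
  have h: "?h (x + rvec k) = (cis (pi * (rvec k \<bullet> rvec l)) * character k \<xi>)
      * (f (x, \<eta> - (\<xi> + rvec l)) * cis (pi * (x \<bullet> ((\<xi> + rvec l) + \<eta>))))" for x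
  proof -
    have "pi * ((x + rvec k) \<bullet> rvec l - (\<eta> - \<xi>) \<bullet> rvec k) + pi * ((x + rvec k) \<bullet> (\<xi> + \<eta>))
        = pi * (rvec k \<bullet> rvec l) + 2 * pi * (\<xi> \<bullet> rvec k) + pi * (x \<bullet> ((\<xi> + rvec l) + \<eta>))"
      by (simp add: inner_add_left inner_add_right inner_diff_left inner_commute algebra_simps)
    then have "cis (pi * ((x + rvec k) \<bullet> rvec l - (\<eta> - \<xi>) \<bullet> rvec k)) * cis (pi * ((x + rvec k) \<bullet> (\<xi> + \<eta>)))
        = cis (pi * (rvec k \<bullet> rvec l)) * character k \<xi> * cis (pi * (x \<bullet> ((\<xi> + rvec l) + \<eta>)))"
      unfolding character_def cis_mult by simp
    moreover have "(x + rvec k, \<eta> - \<xi>) + (- rvec k, - rvec l) = (x, \<eta> - (\<xi> + rvec l))" by simp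
    ultimately show ?thesis
      unfolding twisted_translate_eq by (simp add: mult_ac diff_diff_eq)
  qed
  have "weyl_integral (twisted_translate (k, l) f) (\<xi>, \<eta>) = (LINT x|lborel. ?h (x + rvec k))"
    unfolding weyl_integral_def prod.case
    by (rule lborel_integral_translate[symmetric]) measurable
  also have "\<dots> = (LINT x|lborel. (cis (pi * (rvec k \<bullet> rvec l)) * character k \<xi>)
      * (f (x, \<eta> - (\<xi> + rvec l)) * cis (pi * (x \<bullet> ((\<xi> + rvec l) + \<eta>)))))"
    unfolding h ..
  also have "\<dots> = cis (pi * (rvec k \<bullet> rvec l)) * character k \<xi> * weyl_integral f (\<xi> + rvec l, \<eta>)"
    unfolding integral_mult_right_zero by (simp add: weyl_integral_def)
  finally show ?thesis .
qed

text \<open>The operation on kernels that corresponds to a twisted translation: \<open>l\<close> shifts \<open>\<xi>\<close>, and \<open>k\<close>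
  becomes a character in \<open>\<xi>\<close>, so that \<open>\<eta>\<close> is left alone.\<close>

definition kernel_translate ::
  "(int^'n) \<times> (int^'n) \<Rightarrow> ((real^'n) \<times> (real^'n) \<Rightarrow> complex) \<Rightarrow> (real^'n) \<times> (real^'n) \<Rightarrow> complex" where
  "kernel_translate = (\<lambda>(k, l) K (\<xi>, \<eta>).
     cis (pi * (rvec k \<bullet> rvec l)) * character k \<xi> * K (\<xi> + rvec l, \<eta>))"

lemma kernel_translate_eq:
  "kernel_translate (k, l) K z = (cis (pi * (rvec k \<bullet> rvec l)) * character k (fst z)) * K (z + (rvec l, 0))"
  by (cases z) (simp add: kernel_translate_def)

lemma kernel_translate_measurable [measurable]:
  assumes [measurable]: "K \<in> borel_measurable borel"
  shows "kernel_translate j K \<in> borel_measurable borel"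
proof -
  obtain k l where j: "j = (k, l)" by (cases j)
  have "(\<lambda>z. (cis (pi * (rvec k \<bullet> rvec l)) * character k (fst z)) * K (z + (rvec l, 0)))
      \<in> borel_measurable borel"
    by measurable
  then show ?thesis by (simp add: j kernel_translate_eq[abs_def])
qed

lemma weyl_pair_twisted_translate:
  assumes "weyl_pair f K"
  shows "weyl_pair (twisted_translate j f) (kernel_translate j K)"
proof -
  obtain k l where j: "j = (k, l)" by (cases j)
  obtain g where g: "\<And>N. g N \<in> L2_bounded_x" and f: "f \<in> L2" and [measurable]: "K \<in> borel_measurable borel"
    and lim: "(\<lambda>N. l2sq lborel (\<lambda>z. g N z - f z)) \<longlonglongrightarrow> 0"
      "(\<lambda>N. l2sq lborel (\<lambda>z. weyl_integral (g N) z - K z)) \<longlonglongrightarrow> 0"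
    using assms by (auto simp: weyl_pair_def)
  have [measurable]: "f \<in> borel_measurable borel" using f by (rule L2_measurable)
  have [measurable]: "g N \<in> borel_measurable borel" for N using g by (rule L2_bounded_x_measurable)
  have g': "twisted_translate j (g N) \<in> L2_bounded_x" for N
  proof -
    obtain R where R: "\<And>x y. norm x > R \<Longrightarrow> g N (x, y) = 0"
      using g[of N] by (auto simp: L2_bounded_x_def)
    have "twisted_translate j (g N) (x, y) = 0" if "norm x > R + norm (rvec k)" for x y
    proof -
      have "norm (x - rvec k) > R" using that norm_triangle_sub[of x "rvec k"] by linarith
      then show ?thesis by (simp add: j twisted_translate_eq R)
    qed
    moreover have "twisted_translate j (g N) \<in> L2"
      using g[of N] by (intro twisted_translate_L2) (simp add: L2_bounded_x_def)
    ultimately show ?thesis unfolding L2_bounded_x_def by blast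
  qed
  have 1: "l2sq lborel (\<lambda>z. twisted_translate j (g N) z - twisted_translate j f z)
      = l2sq lborel (\<lambda>z. g N z - f z)" for N
    unfolding twisted_translate_diff by (rule l2sq_twisted_translate) measurable
  have 2: "l2sq lborel (\<lambda>z. weyl_integral (twisted_translate j (g N)) z - kernel_translate j K z)
      = l2sq lborel (\<lambda>z. weyl_integral (g N) z - K z)" for N
  proof -
    have "weyl_integral (twisted_translate j (g N)) z - kernel_translate j K z
        = (cis (pi * (rvec k \<bullet> rvec l)) * character k (fst z))
          * (\<lambda>z. weyl_integral (g N) z - K z) (z + (rvec l, 0))" for z
      by (cases z) (simp add: j weyl_integral_twisted_translate kernel_translate_eq right_diff_distrib)
    then have "l2sq lborel (\<lambda>z. weyl_integral (twisted_translate j (g N)) z - kernel_translate j K z)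
        = l2sq lborel (\<lambda>z. (\<lambda>z. weyl_integral (g N) z - K z) (z + (rvec l, 0)))"
      by (simp only:) (rule l2sq_unimodular, simp add: norm_mult)
    also have "\<dots> = l2sq lborel (\<lambda>z. weyl_integral (g N) z - K z)"
      by (rule l2sq_lborel_translate) measurable
    finally show ?thesis .
  qed
  show ?thesis
    unfolding weyl_pair_def
    by (intro conjI exI[of _ "\<lambda>N. twisted_translate j (g N)"] allI g' twisted_translate_L2 f)
       (simp_all add: 1 2 lim)
qed

section \<open>The Gram structure of the twisted system\<close>

text \<open>The heart of the matter, fibre by fibre: when the shifted sequences \<open>(k (m + l))\<^sub>m\<close> of vectors
  are mutually orthogonal as elements of an \<open>\<ell>\<^sup>2\<close> sum of \<open>L\<^sup>2\<close> spaces, they satisfy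
  Pythagoras' theorem.\<close>

lemma shifted_fibres_pythagoras:
  fixes k :: "int^'n \<Rightarrow> 'a \<Rightarrow> complex"
  assumes [measurable]: "\<And>m. k m \<in> borel_measurable M"
    and fin: "(\<integral>\<^sup>+ m. l2sq M (k m) \<partial>count_space UNIV) < top"
    and orth: "\<And>l. l \<noteq> 0 \<Longrightarrow> ((\<lambda>m. LINT \<eta>|M. k m \<eta> * cnj (k (m + l) \<eta>)) has_sum 0) UNIV"
    and B: "finite B"
  shows "(\<integral>\<^sup>+ m. l2sq M (\<lambda>\<eta>. \<Sum>l\<in>B. C l * k (m + l) \<eta>) \<partial>count_space UNIV)
    = (\<Sum>l\<in>B. ennreal ((cmod (C l))\<^sup>2)) * (\<integral>\<^sup>+ m. l2sq M (k m) \<partial>count_space UNIV)"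
proof -
  define W where "W = enn2real (\<integral>\<^sup>+ m. l2sq M (k m) \<partial>count_space UNIV)"
  define a where "a m l l' = (LINT \<eta>|M. k (m + l) \<eta> * cnj (k (m + l') \<eta>))" for m l l'
  have kf: "l2sq M (k m) < top" for m
    using nn_integral_ge_point[of m UNIV "\<lambda>m. l2sq M (k m)"] fin by (auto intro: order_le_less_trans)
  have bij: "bij_betw (\<lambda>m. m + l) UNIV UNIV" for l :: "int^'n"
    by (rule bij_betwI[of _ _ _ "\<lambda>m. m - l"]) auto
  have int: "integrable M (\<lambda>\<eta>. k m \<eta> * cnj (k m' \<eta>))" for m m'
    using kf by (intro l2_Cauchy_Schwarz(1)) auto
  \<comment> \<open>reindexing by \<open>m + l\<close> reduces the pair \<open>(l, l')\<close> to the difference \<open>l' - l\<close>\<close>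
  have a_sum: "((\<lambda>m. a m l l') has_sum (if l = l' then of_real W else 0)) UNIV" for l l'
  proof -
    have "((\<lambda>m. LINT \<eta>|M. k m \<eta> * cnj (k (m + (l' - l)) \<eta>)) has_sum (if l = l' then of_real W else 0)) UNIV"
    proof (cases "l = l'")
      case True
      have "((\<lambda>m. complex_of_real (enn2real (l2sq M (k m)))) has_sum of_real W) UNIV"
        using has_sum_enn2real[OF fin] unfolding W_def by (rule has_sum_of_real)
      then show ?thesis using True kf by (simp add: l2sq_eq_integral)
    next
      case False
      then show ?thesis using orth[of "l' - l"] by simp
    qed
    then show ?thesis
      using has_sum_reindex_bij_betw[OF bij[of l], of "\<lambda>m. LINT \<eta>|M. k m \<eta> * cnj (k (m + (l' - l)) \<eta>)"]
      by (simp add: a_def algebra_simps)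
  qed
  define q where "q m = enn2real (l2sq M (\<lambda>\<eta>. \<Sum>l\<in>B. C l * k (m + l) \<eta>))" for m
  have qf: "l2sq M (\<lambda>\<eta>. \<Sum>l\<in>B. C l * k (m + l) \<eta>) < top" for m
    using kf by (intro l2sq_sum_finite B) auto
  have q_eq: "complex_of_real (q m) = (\<Sum>l\<in>B. \<Sum>l'\<in>B. C l * cnj (C l') * a m l l')" for m
  proof -
    have "complex_of_real (q m) = (LINT \<eta>|M. (\<Sum>l\<in>B. C l * k (m + l) \<eta>) * cnj (\<Sum>l\<in>B. C l * k (m + l) \<eta>))"
      unfolding q_def by (rule l2sq_eq_integral[OF _ qf]) measurable
    also have "\<dots> = (LINT \<eta>|M. (\<Sum>l\<in>B. \<Sum>l'\<in>B. C l * cnj (C l') * (k (m + l) \<eta> * cnj (k (m + l') \<eta>))))"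
      by (simp add: sum_product mult_ac)
    also have "\<dots> = (\<Sum>l\<in>B. \<Sum>l'\<in>B. C l * cnj (C l') * a m l l')"
      using int by (simp add: a_def Bochner_Integration.integral_sum)
    finally show ?thesis .
  qed
  have "((\<lambda>m. complex_of_real (q m)) has_sum
      (\<Sum>l\<in>B. \<Sum>l'\<in>B. C l * cnj (C l') * (if l = l' then of_real W else 0))) UNIV"
    unfolding q_eq by (intro has_sum_sum_finite has_sum_cmult_right a_sum)
  also have "(\<Sum>l\<in>B. \<Sum>l'\<in>B. C l * cnj (C l') * (if l = l' then of_real W else 0))
      = (\<Sum>l\<in>B. \<Sum>l'\<in>B. if l' = l then C l * cnj (C l) * of_real W else 0)"
    by (intro sum.cong refl) auto
  also have "\<dots> = complex_of_real ((\<Sum>l\<in>B. (cmod (C l))\<^sup>2) * W)"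
    using B by (simp only: sum.delta of_real_mult of_real_sum complex_norm_square sum_distrib_right) (auto intro!: sum.cong)
  finally have "(q has_sum (\<Sum>l\<in>B. (cmod (C l))\<^sup>2) * W) UNIV"
    using has_sum_Re by fastforce
  then have "(\<integral>\<^sup>+ m. ennreal (q m) \<partial>count_space UNIV) = ennreal ((\<Sum>l\<in>B. (cmod (C l))\<^sup>2) * W)"
    by (rule nn_integral_count_space_ennreal_has_sum) (simp add: q_def)
  moreover have "ennreal (q m) = l2sq M (\<lambda>\<eta>. \<Sum>l\<in>B. C l * k (m + l) \<eta>)" for m
    using qf[of m] by (simp add: q_def)
  moreover have "ennreal W = (\<integral>\<^sup>+ m. l2sq M (k m) \<partial>count_space UNIV)"
    using fin by (simp add: W_def)
  ultimately show ?thesis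
    by (simp add: ennreal_mult sum_nonneg W_def)
qed

locale orthogonal_twisted_system =
  fixes \<phi> :: "(real^'n) \<times> (real^'n) \<Rightarrow> complex"
  assumes phi: "\<phi> \<in> L2" and cond_C: "condition_C \<phi>"
begin

abbreviation "K \<equiv> weyl_kernel \<phi>"

lemma phi_measurable [measurable]: "\<phi> \<in> borel_measurable borel"
  using phi by (rule L2_measurable)

lemma K_measurable [measurable]: "K \<in> borel_measurable borel"
  using weyl_kernel_pair(2)[OF phi] by (rule L2_measurable)

lemma K_finite: "l2sq lborel K < top"
  using weyl_kernel_pair(2)[OF phi] by (simp add: L2_iff)

lemma weight_eq: "weight \<phi> \<xi> = (\<integral>\<^sup>+ m. l2sq lborel (\<lambda>\<eta>. K (\<xi> + rvec m, \<eta>)) \<partial>count_space UNIV)"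
  unfolding weight_def l2sq_def by (rule infsum_ennreal_eq_nn_integral)

lemma fibre_measurable [measurable]: "(\<lambda>\<xi>. l2sq lborel (\<lambda>\<eta>. K (\<xi>, \<eta>))) \<in> borel_measurable borel"
  unfolding l2sq_def by measurable

lemma weight_measurable [measurable]: "weight \<phi> \<in> borel_measurable borel"
proof (rule borel_measurable_LIMSEQ_order[where u = "\<lambda>N \<xi>. \<Sum>m\<in>kcube N. l2sq lborel (\<lambda>\<eta>. K (\<xi> + rvec m, \<eta>))"])
  show "(\<lambda>N. \<Sum>m\<in>kcube N. l2sq lborel (\<lambda>\<eta>. K (\<xi> + rvec m, \<eta>))) \<longlonglongrightarrow> weight \<phi> \<xi>" for \<xi>
    unfolding weight_eq by (rule nn_integral_count_space_limit) (use kcube_exhausts in auto)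
qed measurable

lemma integral_weight: "(\<integral>\<^sup>+ \<xi>. weight \<phi> \<xi> \<partial>torus_measure) = l2sq lborel K"
proof -
  have "l2sq lborel K = (\<integral>\<^sup>+ \<xi>. l2sq lborel (\<lambda>\<eta>. K (\<xi>, \<eta>)) \<partial>lborel)"
    unfolding l2sq_def by (rule nn_integral_lborel_pair(1)) simp
  also have "\<dots> = (\<integral>\<^sup>+ \<xi>. weight \<phi> \<xi> \<partial>torus_measure)"
    unfolding weight_eq by (rule nn_integral_lborel_tiling) simp
  finally show ?thesis ..
qed

lemma weight_finite_AE: "AE \<xi> in torus_measure. weight \<phi> \<xi> < top"
proof -
  have "AE \<xi> in torus_measure. weight \<phi> \<xi> \<noteq> \<infinity>"
    using K_finite by (intro nn_integral_PInf_AE) (auto simp: integral_weight)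
  then show ?thesis by eventually_elim (simp add: less_top)
qed

text \<open>\<open>L\<^sup>2\<close> of this measure contains the symbols: a combination of the \<open>T\<^sub>(\<^sub>k\<^sub>,\<^sub>0\<^sub>) \<phi>\<close> has the norm
  of the trigonometric polynomial with the same coefficients.\<close>

definition weighted_torus :: "(real^'n) measure" where
  "weighted_torus = density torus_measure (weight \<phi>)"

sublocale weighted: torus_finite_measure weighted_torus
proof (intro torus_finite_measure.intro torus_finite_measure_axioms.intro finite_measureI)
  have "emeasure weighted_torus (space weighted_torus) = (\<integral>\<^sup>+ \<xi>. weight \<phi> \<xi> \<partial>torus_measure)"
    unfolding weighted_torus_def
    using sets.top[of torus_measure]
    by (subst emeasure_density) (auto intro!: nn_integral_cong simp: indicator_def)
  then show "emeasure weighted_torus (space weighted_torus) \<noteq> \<infinity>"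
    using K_finite by (simp add: integral_weight)
qed (simp add: weighted_torus_def)

lemma measurable_weighted_iff:
  "f \<in> borel_measurable weighted_torus \<longleftrightarrow> f \<in> borel_measurable torus_measure"
  by (simp add: weighted_torus_def)

lemma l2sq_weighted:
  "f \<in> borel_measurable torus_measure \<Longrightarrow>
    l2sq weighted_torus f = (\<integral>\<^sup>+ \<xi>. weight \<phi> \<xi> * ennreal ((cmod (f \<xi>))\<^sup>2) \<partial>torus_measure)"
  unfolding l2sq_def weighted_torus_def by (rule nn_integral_density) auto

text \<open>The Fourier coefficients of the multiplier in front of \<open>K (\<xi> + l, \<eta>)\<close> in the kernel of a
  linear combination; the phase is the one that a twisted translation leaves on the kernel.\<close>

definition row :: "((int^'n) \<times> (int^'n) \<Rightarrow> complex) \<Rightarrow> int^'n \<Rightarrow> int^'n \<Rightarrow> complex" where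
  "row c l k = c (k, l) * cis (pi * (rvec k \<bullet> rvec l))"

lemma row_0 [simp]: "row c 0 k = c (k, 0)"
  by (simp add: row_def)

lemma norm_row [simp]: "cmod (row c l k) = cmod (c (k, l))"
  by (simp add: row_def norm_mult)

definition lin_comb :: "(int^'n) set \<Rightarrow> (int^'n) set \<Rightarrow> ((int^'n) \<times> (int^'n) \<Rightarrow> complex)
    \<Rightarrow> (real^'n) \<times> (real^'n) \<Rightarrow> complex" where
  "lin_comb A B c z = (\<Sum>j\<in>A \<times> B. c j * twisted_translate j \<phi> z)"

lemma lin_comb_L2: "finite A \<Longrightarrow> finite B \<Longrightarrow> lin_comb A B c \<in> L2"
  unfolding lin_comb_def[abs_def] by (intro L2_sum finite_cartesian_product twisted_translate_L2 phi)

lemma lin_comb_measurable [measurable]: "lin_comb A B c \<in> borel_measurable borel"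
  unfolding lin_comb_def[abs_def] by (intro borel_measurable_sum borel_measurable_times) auto

text \<open>The kernel of the combination is \<open>\<Sum>l. P\<^sub>l \<xi> * K (\<xi> + l, \<eta>)\<close> with periodic multipliers \<open>P\<^sub>l\<close>.
  After tiling the \<open>\<xi>\<close>-space by lattice translates of the cube, the fibres over almost every point
  of the torus are subject to Pythagoras' theorem by condition C, and each row contributes
  \<open>|P\<^sub>l|\<^sup>2\<close> times the weight.\<close>

theorem norm_lin_comb:
  assumes A: "finite A" and B: "finite B"
  shows "l2sq lborel (lin_comb A B c) = (\<Sum>l\<in>B. l2sq weighted_torus (trig_poly A (row c l)))"
proof -
  define P where "P l = trig_poly A (row c l)" for l
  have [measurable]: "P l \<in> borel_measurable borel" for l unfolding P_def by measurable
  have P_per: "P l (\<xi> + rvec m) = P l \<xi>" for l m \<xi>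
    by (simp add: P_def trig_poly_def character_periodic)
  let ?F = "\<lambda>z. \<Sum>l\<in>B. P l (fst z) * K (fst z + rvec l, snd z)"
  have "weyl_pair (lin_comb A B c) (\<lambda>z. \<Sum>j\<in>A \<times> B. c j * kernel_translate j K z)"
    unfolding lin_comb_def[abs_def] using A B
    by (intro weyl_pair_sum weyl_pair_twisted_translate weyl_kernel_pair phi) auto
  then have "l2sq lborel (lin_comb A B c) = l2sq lborel (\<lambda>z. \<Sum>j\<in>A \<times> B. c j * kernel_translate j K z)"
    by (rule weyl_pair_isometry[symmetric])
  also have "(\<lambda>z. \<Sum>j\<in>A \<times> B. c j * kernel_translate j K z) = ?F"
  proof
    fix z :: "(real^'n) \<times> (real^'n)"
    obtain \<xi> \<eta> where z: "z = (\<xi>, \<eta>)" by (cases z)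
    have "(\<Sum>j\<in>A \<times> B. c j * kernel_translate j K z) = (\<Sum>l\<in>B. \<Sum>k\<in>A. c (k, l) * kernel_translate (k, l) K z)"
      by (subst sum.swap) (simp add: sum.cartesian_product)
    also have "\<dots> = ?F z"
      unfolding P_def trig_poly_def row_def kernel_translate_def z prod.case fst_conv snd_conv sum_distrib_right
      by (intro sum.cong refl) (simp add: mult_ac)
    finally show "(\<Sum>j\<in>A \<times> B. c j * kernel_translate j K z) = ?F z" .
  qed
  also have "l2sq lborel ?F = (\<integral>\<^sup>+ \<xi>. l2sq lborel (\<lambda>\<eta>. ?F (\<xi>, \<eta>)) \<partial>lborel)"
    unfolding l2sq_def by (rule nn_integral_lborel_pair(1)) measurable
  also have "\<dots> = (\<integral>\<^sup>+ \<xi>. (\<integral>\<^sup>+ m. l2sq lborel (\<lambda>\<eta>. ?F (\<xi> + rvec m, \<eta>)) \<partial>count_space UNIV) \<partial>torus_measure)"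
  proof (rule nn_integral_lborel_tiling)
    show "(\<lambda>\<xi>. l2sq lborel (\<lambda>\<eta>. ?F (\<xi>, \<eta>))) \<in> borel_measurable borel"
      unfolding l2sq_def by measurable
  qed
  also have "\<dots> = (\<integral>\<^sup>+ \<xi>. (\<Sum>l\<in>B. ennreal ((cmod (P l \<xi>))\<^sup>2)) * weight \<phi> \<xi> \<partial>torus_measure)"
  proof (rule nn_integral_cong_AE)
    have "AE \<xi> in torus_measure. \<forall>l\<in>UNIV - {0}. ((\<lambda>m. LINT \<eta>|lborel. K (\<xi> + rvec m, \<eta>)
              * cnj (K (\<xi> + rvec m + rvec l, \<eta>))) has_sum 0) UNIV"
      using cond_C unfolding condition_C_def by (subst AE_ball_countable) auto
    with weight_finite_AE
    show "AE \<xi> in torus_measure. (\<integral>\<^sup>+ m. l2sq lborel (\<lambda>\<eta>. ?F (\<xi> + rvec m, \<eta>)) \<partial>count_space UNIV)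
        = (\<Sum>l\<in>B. ennreal ((cmod (P l \<xi>))\<^sup>2)) * weight \<phi> \<xi>"
    proof eventually_elim
      case (elim \<xi>)
      have "(\<integral>\<^sup>+ m. l2sq lborel (\<lambda>\<eta>. \<Sum>l\<in>B. P l \<xi> * K (\<xi> + rvec (m + l), \<eta>)) \<partial>count_space UNIV)
          = (\<Sum>l\<in>B. ennreal ((cmod (P l \<xi>))\<^sup>2)) * (\<integral>\<^sup>+ m. l2sq lborel (\<lambda>\<eta>. K (\<xi> + rvec m, \<eta>)) \<partial>count_space UNIV)"
        by (rule shifted_fibres_pythagoras[OF _ _ _ B]) (use elim in \<open>auto simp: weight_eq rvec_add add.assoc\<close>)
      then show ?case by (simp add: weight_eq P_per rvec_add add.assoc)
    qed
  qed
  also have "\<dots> = (\<integral>\<^sup>+ \<xi>. (\<Sum>l\<in>B. weight \<phi> \<xi> * ennreal ((cmod (P l \<xi>))\<^sup>2)) \<partial>torus_measure)"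
    by (intro nn_integral_cong, subst mult.commute) (rule sum_distrib_left)
  also have "\<dots> = (\<Sum>l\<in>B. l2sq weighted_torus (P l))"
    by (subst nn_integral_sum) (auto simp: l2sq_weighted)
  finally show ?thesis by (simp add: P_def)
qed

lemma trig_poly_weighted_finite: "l2sq weighted_torus (trig_poly A a) < top"
  by (rule l2sq_bounded_finite[OF weighted.finite_measure_axioms cmod_trig_poly_le])

text \<open>Both sides are sesquilinear, and the norm identity says that their diagonals agree.\<close>

theorem inner_lin_comb:
  assumes A: "finite A" and B: "finite B"
  shows "L2_inner (lin_comb A B a) (lin_comb A B b)
    = (\<Sum>l\<in>B. LINT \<xi>|weighted_torus. trig_poly A (row a l) \<xi> * cnj (trig_poly A (row b l) \<xi>))"
proof -
  let ?P = "\<lambda>l. trig_poly A (row a l)" and ?Q = "\<lambda>l. trig_poly A (row b l)"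
  have fin: "l2sq lborel (lin_comb A B c) < top" for c
    using lin_comb_L2[OF A B, of c] by (simp add: L2_iff)
  have "4 * L2_inner (lin_comb A B a) (lin_comb A B b)
      = (\<Sum>s\<in>{1, - 1, \<i>, - \<i>}. s * of_real (enn2real (l2sq lborel (\<lambda>z. lin_comb A B a z + s * lin_comb A B b z))))"
    unfolding L2_inner_def by (rule polarization) (auto simp: fin)
  also have "\<dots> = (\<Sum>s\<in>{1, - 1, \<i>, - \<i>}. s * of_real (\<Sum>l\<in>B. enn2real (l2sq weighted_torus (\<lambda>\<xi>. ?P l \<xi> + s * ?Q l \<xi>))))"
  proof (intro sum.cong refl)
    fix s :: complex
    define c where "c j = a j + s * b j" for j
    have "(\<lambda>z. lin_comb A B a z + s * lin_comb A B b z) = lin_comb A B c"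
      by (simp add: lin_comb_def c_def fun_eq_iff distrib_right sum.distrib sum_distrib_left mult.assoc)
    moreover have "(\<lambda>\<xi>. ?P l \<xi> + s * ?Q l \<xi>) = trig_poly A (row c l)" for l
      by (simp add: trig_poly_def row_def c_def fun_eq_iff distrib_right sum.distrib sum_distrib_left mult.assoc)
    ultimately show "s * of_real (enn2real (l2sq lborel (\<lambda>z. lin_comb A B a z + s * lin_comb A B b z)))
        = s * of_real (\<Sum>l\<in>B. enn2real (l2sq weighted_torus (\<lambda>\<xi>. ?P l \<xi> + s * ?Q l \<xi>)))"
      using trig_poly_weighted_finite by (simp add: norm_lin_comb[OF A B] enn2real_sum)
  qed
  also have "\<dots> = (\<Sum>l\<in>B. \<Sum>s\<in>{1, - 1, \<i>, - \<i>}. s * of_real (enn2real (l2sq weighted_torus (\<lambda>\<xi>. ?P l \<xi> + s * ?Q l \<xi>))))"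
    by (subst sum.swap) (simp only: of_real_sum sum_distrib_left)
  also have "\<dots> = (\<Sum>l\<in>B. 4 * (LINT \<xi>|weighted_torus. ?P l \<xi> * cnj (?Q l \<xi>)))"
    using trig_poly_weighted_finite by (intro sum.cong refl polarization[symmetric]) auto
  finally show ?thesis by (simp flip: sum_distrib_left)
qed

definition row_comb :: "(int^'n) set \<Rightarrow> (int^'n \<Rightarrow> complex) \<Rightarrow> (real^'n) \<times> (real^'n) \<Rightarrow> complex" where
  "row_comb A p z = (\<Sum>k\<in>A. p k * twisted_translate (k, 0) \<phi> z)"

lemma row_comb_measurable [measurable]: "row_comb A p \<in> borel_measurable borel"
  unfolding row_comb_def[abs_def] by (intro borel_measurable_sum borel_measurable_times) auto

lemma row_comb_eq_lin_comb:
  assumes "finite A'" "finite B" "A \<subseteq> A'" "0 \<in> B"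
  shows "row_comb A p = lin_comb A' B (\<lambda>(k, l). if k \<in> A \<and> l = 0 then p k else 0)"
proof
  fix z
  have "lin_comb A' B (\<lambda>(k, l). if k \<in> A \<and> l = 0 then p k else 0) z
      = (\<Sum>k\<in>A'. \<Sum>l\<in>B. if l = 0 then (if k \<in> A then p k * twisted_translate (k, 0) \<phi> z else 0) else 0)"
    unfolding lin_comb_def sum.cartesian_product' by (intro sum.cong refl) auto
  also have "\<dots> = (\<Sum>k\<in>A'. if k \<in> A then p k * twisted_translate (k, 0) \<phi> z else 0)"
    using assms by simp
  also have "\<dots> = row_comb A p z"
    unfolding row_comb_def using assms by (intro sum.mono_neutral_cong_right) auto
  finally show "row_comb A p z = lin_comb A' B (\<lambda>(k, l). if k \<in> A \<and> l = 0 then p k else 0) z" ..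
qed

lemma lin_comb_superset:
  assumes "finite A'" "finite B'" "A \<subseteq> A'" "B \<subseteq> B'"
  shows "lin_comb A B c = lin_comb A' B' (\<lambda>j. if j \<in> A \<times> B then c j else 0)"
  unfolding lin_comb_def fun_eq_iff
  using assms by (intro allI sum.mono_neutral_cong_left) auto

text \<open>Partial sums of an arbitrary series are compared with approximations whose symbol occupies the
  row \<open>l = 0\<close> only.\<close>

lemma norm_lin_comb_diff_row_comb:
  assumes A: "finite A" "finite A'" and B: "finite B" "0 \<in> B"
  shows "l2sq lborel (\<lambda>z. lin_comb A B c z - row_comb A' p z)
    = (\<Sum>l\<in>B. l2sq weighted_torus (\<lambda>\<xi>. trig_poly A (row c l) \<xi> - (if l = 0 then trig_poly A' p \<xi> else 0)))"
proof -
  let ?U = "A \<union> A'"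
  define c' where "c' j = (if j \<in> A \<times> B then c j else 0) - (case j of (k, l) \<Rightarrow> if k \<in> A' \<and> l = 0 then p k else 0)" for j
  have "(\<lambda>z. lin_comb A B c z - row_comb A' p z) = lin_comb ?U B c'"
    using A B row_comb_eq_lin_comb[of ?U B A' p] lin_comb_superset[of ?U B A B c]
    by (simp add: lin_comb_def c'_def fun_eq_iff left_diff_distrib sum_subtractf)
  then have "l2sq lborel (\<lambda>z. lin_comb A B c z - row_comb A' p z) = (\<Sum>l\<in>B. l2sq weighted_torus (trig_poly ?U (row c' l)))"
    using A B by (simp add: norm_lin_comb)
  also have "\<dots> = (\<Sum>l\<in>B. l2sq weighted_torus (\<lambda>\<xi>. trig_poly A (row c l) \<xi> - (if l = 0 then trig_poly A' p \<xi> else 0)))"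
  proof (intro sum.cong refl arg_cong[where f = "l2sq weighted_torus"] ext)
    fix l \<xi> assume l: "l \<in> B"
    have 1: "trig_poly A (row c l) = trig_poly ?U (\<lambda>k. if k \<in> A then row c l k else 0)"
      using A by (intro trig_poly_superset) auto
    have 2: "trig_poly A' p = trig_poly ?U (\<lambda>k. if k \<in> A' then p k else 0)"
      using A by (intro trig_poly_superset) auto
    show "trig_poly ?U (row c' l) \<xi> = trig_poly A (row c l) \<xi> - (if l = 0 then trig_poly A' p \<xi> else 0)"
    proof (cases "l = 0")
      case True
      then show ?thesis unfolding 1 2 using l
        by (auto simp: trig_poly_def c'_def left_diff_distrib simp flip: sum_subtractf intro!: sum.cong)
    next
      case False
      then show ?thesis unfolding 1 using l
        by (auto simp: trig_poly_def c'_def row_def intro!: sum.cong)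
    qed
  qed
  finally show ?thesis .
qed

lemma norm_row_comb_diff:
  assumes A: "finite A" "finite A'"
  shows "l2sq lborel (\<lambda>z. row_comb A q z - row_comb A' p z)
    = l2sq weighted_torus (\<lambda>\<xi>. trig_poly A q \<xi> - trig_poly A' p \<xi>)"
proof -
  have "row_comb A q = lin_comb A {0} (\<lambda>(k, l). if k \<in> A \<and> l = 0 then q k else 0)"
    using A by (intro row_comb_eq_lin_comb) auto
  moreover have "trig_poly A (row (\<lambda>(k, l). if k \<in> A \<and> l = 0 then q k else 0) 0) = trig_poly A q"
    unfolding trig_poly_def fun_eq_iff by auto
  ultimately show ?thesis
    using norm_lin_comb_diff_row_comb[OF A, of "{0}"] by simp
qed

lemma inner_row_comb_translate:
  assumes A: "finite A"
  shows "L2_inner (row_comb A p) (twisted_translate (k, l) \<phi>)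
    = (if l = 0 then LINT \<xi>|weighted_torus. trig_poly A p \<xi> * cnj (character k \<xi>) else 0)"
proof -
  let ?U = "insert k A" and ?B = "{0, l}"
  define a :: "(int^'n) \<times> (int^'n) \<Rightarrow> complex" where "a = (\<lambda>(k, l). if k \<in> A \<and> l = 0 then p k else 0)"
  define b :: "(int^'n) \<times> (int^'n) \<Rightarrow> complex" where "b j = (if j = (k, l) then 1 else 0)" for j
  have 1: "row_comb A p = lin_comb ?U ?B a"
    unfolding a_def using A by (intro row_comb_eq_lin_comb) auto
  have 2: "twisted_translate (k, l) \<phi> = lin_comb ?U ?B b"
  proof
    fix z
    have "lin_comb ?U ?B b z = (\<Sum>j\<in>?U \<times> ?B. if j = (k, l) then twisted_translate (k, l) \<phi> z else 0)"
      unfolding lin_comb_def b_def by (intro sum.cong refl) auto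
    also have "\<dots> = twisted_translate (k, l) \<phi> z"
      using A by (subst sum.delta) auto
    finally show "twisted_translate (k, l) \<phi> z = lin_comb ?U ?B b z" ..
  qed
  have Pa: "trig_poly ?U (row a l') = (if l' = 0 then trig_poly A p else (\<lambda>_. 0))" for l'
  proof (cases "l' = 0")
    case True
    have "trig_poly A p = trig_poly ?U (\<lambda>k. if k \<in> A then p k else 0)"
      using A by (intro trig_poly_superset) auto
    then show ?thesis using True by (auto simp: trig_poly_def a_def fun_eq_iff intro!: sum.cong)
  next
    case False
    then show ?thesis by (auto simp: trig_poly_def row_def a_def fun_eq_iff)
  qed
  have Pb: "trig_poly ?U (row b 0) \<xi> = (if l = 0 then character k \<xi> else 0)" for \<xi>
  proof -
    have "trig_poly ?U (row b 0) \<xi> = (\<Sum>k'\<in>?U. if k' = k then (if l = 0 then character k \<xi> else 0) else 0)"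
      unfolding trig_poly_def row_0 b_def by (intro sum.cong refl) auto
    then show ?thesis using A by (simp only: sum.delta) auto
  qed
  have "L2_inner (row_comb A p) (twisted_translate (k, l) \<phi>)
      = (\<Sum>l'\<in>?B. LINT \<xi>|weighted_torus. trig_poly ?U (row a l') \<xi> * cnj (trig_poly ?U (row b l') \<xi>))"
    unfolding 1 2 using A by (intro inner_lin_comb) auto
  also have "\<dots> = (\<Sum>l'\<in>?B. if l' = 0 then LINT \<xi>|weighted_torus. trig_poly A p \<xi> * cnj (trig_poly ?U (row b 0) \<xi>) else 0)"
    by (intro sum.cong refl) (auto simp: Pa)
  also have "\<dots> = (LINT \<xi>|weighted_torus. trig_poly A p \<xi> * cnj (trig_poly ?U (row b 0) \<xi>))"
    by simp
  finally show ?thesis by (simp add: Pb)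
qed

text \<open>Trigonometric polynomials are dense in the weighted space and are the symbols of linear
  combinations of the same norm. A sequence of them that tends to \<open>C\<close> thus gives a Cauchy
  sequence of linear combinations; its limit is the element with symbol \<open>C\<close>.\<close>

lemma symbol_realized:
  assumes [measurable]: "C \<in> borel_measurable weighted_torus" and fin: "l2sq weighted_torus C < top"
  obtains \<psi> A p where "\<psi> \<in> twisted_closed_span \<phi>" "\<And>n::nat. finite (A n)"
    "(\<lambda>n. l2sq lborel (\<lambda>z. row_comb (A n) (p n) z - \<psi> z)) \<longlonglongrightarrow> 0"
    "(\<lambda>n. l2sq weighted_torus (\<lambda>\<xi>. trig_poly (A n) (p n) \<xi> - C \<xi>)) \<longlonglongrightarrow> 0"
proof -
  obtain P :: "nat \<Rightarrow> real^'n \<Rightarrow> complex" where P: "\<And>n. P n \<in> trig_polys" "(\<lambda>n. l2sq weighted_torus (\<lambda>\<xi>. C \<xi> - P n \<xi>)) \<longlonglongrightarrow> 0"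
    by (rule weighted.trig_approx_sequence[OF weighted.trig_polys_dense[OF assms]]) (rule that)
  have "\<forall>n. \<exists>A a. finite A \<and> P n = trig_poly A a"
    using P(1) by (simp add: trig_polys_def)
  then obtain A p where Ap: "\<And>n. finite (A n)" "\<And>n. P n = trig_poly (A n) (p n)"
    by metis
  have lim: "(\<lambda>n. l2sq weighted_torus (\<lambda>\<xi>. trig_poly (A n) (p n) \<xi> - C \<xi>)) \<longlonglongrightarrow> 0"
    using P(2) by (simp add: Ap l2sq_minus_commute[of _ C])
  have "\<exists>N. \<forall>m\<ge>N. \<forall>n\<ge>N. l2sq lborel (\<lambda>z. row_comb (A m) (p m) z - row_comb (A n) (p n) z) \<le> ennreal e"
    if "e > 0" for e
    using l2_tendsto_imp_Cauchy[OF _ _ lim that] Ap(1) by (simp add: norm_row_comb_diff)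
  then obtain \<psi> where \<psi>: "\<psi> \<in> borel_measurable lborel"
    "(\<lambda>n. l2sq lborel (\<lambda>z. row_comb (A n) (p n) z - \<psi> z)) \<longlonglongrightarrow> 0"
    by (rule l2_complete[of "\<lambda>n. row_comb (A n) (p n)" lborel, rotated]) auto
  have span: "row_comb (A n) (p n) \<in> twisted_span \<phi>" for n
  proof -
    have "row_comb (A n) (p n) z = (\<Sum>j\<in>(\<lambda>k. (k, 0)) ` A n. p n (fst j) * twisted_translate j \<phi> z)" for z
      by (subst sum.reindex) (auto simp: inj_on_def row_comb_def)
    then show ?thesis
      unfolding twisted_span_def using Ap(1)[of n]
      by (intro CollectI exI[of _ "(\<lambda>k. (k, 0)) ` A n"] exI[of _ "\<lambda>j. p n (fst j)"]) auto
  qed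
  have rL: "row_comb (A n) (p n) \<in> L2" for n
    unfolding row_comb_def[abs_def] by (intro L2_sum Ap twisted_translate_L2 phi)
  have "\<psi> \<in> L2"
    using \<psi> rL by (rule L2_limit)
  then have "\<psi> \<in> twisted_closed_span \<phi>"
    unfolding twisted_closed_span_def L2_tendsto_iff using span \<psi>(2)
    by (intro CollectI conjI exI[of _ "\<lambda>n. row_comb (A n) (p n)"] allI)
  then show ?thesis using Ap(1) \<psi>(2) lim by (rule that)
qed

end

section \<open>Bounded weights, Bessel and Hilbertian systems\<close>

lemma index_cube_eq: "index_cube N = kcube N \<times> kcube N"
  by (auto simp: index_cube_def kcube_def)

lemma finite_index_cube [simp]: "finite (index_cube N)"
  by (simp add: index_cube_eq)

lemma index_cube_exhausts: "incseq index_cube" "(\<Union>N. index_cube N) = UNIV"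
proof -
  have mono: "index_cube M \<subseteq> index_cube N" if "M \<le> N" for M N :: nat
    using kcube_mono[OF that] by (auto simp: index_cube_eq)
  then show "incseq index_cube" by (auto simp: incseq_def)
  have "(k, l) \<in> (\<Union>N. index_cube N)" for k l :: "int^'n"
  proof -
    obtain N where "{k, l} \<subseteq> kcube N" using finite_subset_kcube[of "{k, l}"] by auto
    then show ?thesis by (auto simp: index_cube_eq)
  qed
  then show "(\<Union>N. index_cube N) = (UNIV :: ((int^'n) \<times> (int^'n)) set)" by auto
qed

text \<open>The substitution \<open>z \<mapsto> z + (k, l)\<close> adds \<open>k \<bullet> l\<close> to both scalar products in the phase; the two
  contributions cancel, which leaves the conjugate of the phase of the opposite translation.\<close>

lemma inner_twisted_translate:
  assumes [measurable]: "f \<in> borel_measurable borel" "g \<in> borel_measurable borel"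
  shows "L2_inner (twisted_translate (k, l) f) g = L2_inner f (twisted_translate (- k, - l) g)"
proof -
  let ?a = "(rvec k, rvec l)"
  let ?h = "\<lambda>z. twisted_translate (k, l) f z * cnj (g z)"
  have "L2_inner (twisted_translate (k, l) f) g = (LINT z|lborel. ?h (z + ?a))"
    unfolding L2_inner_def by (rule lborel_integral_translate[symmetric]) measurable
  also have "\<dots> = L2_inner f (twisted_translate (- k, - l) g)"
    unfolding L2_inner_def
  proof (intro Bochner_Integration.integral_cong refl)
    fix z :: "(real^'a) \<times> (real^'a)"
    have 1: "z + ?a + (- rvec k, - rvec l) = z" by (cases z) simp
    have "(fst (z + ?a)) \<bullet> rvec l - (snd (z + ?a)) \<bullet> rvec k
        = - (fst z \<bullet> rvec (- l) - snd z \<bullet> rvec (- k))"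
      by (simp add: inner_add_left rvec_uminus inner_commute[of "rvec k"])
    then have "cis (pi * ((fst (z + ?a)) \<bullet> rvec l - (snd (z + ?a)) \<bullet> rvec k))
        = cnj (cis (pi * (fst z \<bullet> rvec (- l) - snd z \<bullet> rvec (- k))))"
      by (simp only: cis_cnj mult_minus_right)
    then show "?h (z + ?a) = f z * cnj (twisted_translate (- k, - l) g z)"
      unfolding twisted_translate_eq 1 by (simp add: rvec_uminus mult_ac)
  qed
  finally show ?thesis .
qed

lemma twisted_translate_compose:
  "twisted_translate (k, l) (twisted_translate (k', l') f) z
    = cis (pi * (rvec l \<bullet> rvec k' - rvec k \<bullet> rvec l'))
      * twisted_translate (k + k', l + l') f z"
proof -
  have "pi * (fst z \<bullet> rvec l - snd z \<bullet> rvec k)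
      + pi * (fst (z + (- rvec k, - rvec l)) \<bullet> rvec l' - snd (z + (- rvec k, - rvec l)) \<bullet> rvec k')
    = pi * (rvec l \<bullet> rvec k' - rvec k \<bullet> rvec l') + pi * (fst z \<bullet> rvec (l + l') - snd z \<bullet> rvec (k + k'))"
    by (simp add: rvec_add inner_add_left inner_add_right inner_diff_left algebra_simps)
  then have 2: "cis (pi * (fst z \<bullet> rvec l - snd z \<bullet> rvec k))
      * cis (pi * (fst (z + (- rvec k, - rvec l)) \<bullet> rvec l' - snd (z + (- rvec k, - rvec l)) \<bullet> rvec k'))
    = cis (pi * (rvec l \<bullet> rvec k' - rvec k \<bullet> rvec l')) * cis (pi * (fst z \<bullet> rvec (l + l') - snd z \<bullet> rvec (k + k')))"
    by (simp only: cis_mult)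
  have 1: "z + (- rvec k, - rvec l) + (- rvec k', - rvec l') = z + (- rvec (k + k'), - rvec (l + l'))"
    by (cases z) (simp add: rvec_add)
  show ?thesis
    by (simp only: twisted_translate_eq mult.assoc[symmetric] 2 1)
qed

text \<open>Moving the second translation to the left as an adjoint leaves one translation by \<open>j - j'\<close>,
  up to a phase that is \<open>1\<close> when \<open>j = j'\<close>.\<close>

lemma canonical_dual_biorthogonal:
  assumes dual: "canonical_dual \<phi> \<psi>" and phi: "\<phi> \<in> L2"
  shows "L2_inner (twisted_translate j \<psi>) (twisted_translate j' \<phi>) = (if j = j' then 1 else 0)"
proof -
  obtain k l k' l' where j: "j = (k, l)" "j' = (k', l')" by (cases j, cases j')
  have [measurable]: "\<psi> \<in> borel_measurable borel" "\<phi> \<in> borel_measurable borel"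
    using dual phi by (auto simp: canonical_dual_def L2_measurable)
  define u where "u = cis (pi * (rvec (- l') \<bullet> rvec k - rvec (- k') \<bullet> rvec l))"
  have "L2_inner (twisted_translate j \<psi>) (twisted_translate j' \<phi>)
      = L2_inner (twisted_translate (- k', - l') (twisted_translate (k, l) \<psi>)) \<phi>"
    using inner_twisted_translate[of "twisted_translate (k, l) \<psi>" \<phi> "- k'" "- l'"] by (simp add: j)
  also have "\<dots> = u * L2_inner (twisted_translate (- k' + k, - l' + l) \<psi>) \<phi>"
    unfolding L2_inner_def twisted_translate_compose u_def by (simp add: mult.assoc)
  also have "\<dots> = u * (if j = j' then 1 else 0)"
    using dual unfolding canonical_dual_def by (simp add: j)
  also have "\<dots> = (if j = j' then 1 else 0)"
    by (auto simp: u_def j rvec_uminus inner_commute)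
  finally show ?thesis .
qed

context orthogonal_twisted_system
begin

lemma translate_phi_L2: "twisted_translate j \<phi> \<in> L2"
  by (intro twisted_translate_L2 phi)

lemma esssup_weight_iff:
  "esssup torus_measure (weight \<phi>) < \<infinity> \<longleftrightarrow> (\<exists>b::real. 0 < b \<and> (AE \<xi> in torus_measure. weight \<phi> \<xi> \<le> ennreal b))"
proof
  assume fin: "esssup torus_measure (weight \<phi>) < \<infinity>"
  then obtain b where b: "esssup torus_measure (weight \<phi>) = ennreal b" "b \<ge> 0"
    by (cases "esssup torus_measure (weight \<phi>)") auto
  have "AE \<xi> in torus_measure. weight \<phi> \<xi> \<le> ennreal (b + 1)"
    using esssup_AE[of "weight \<phi>" torus_measure]
  proof eventually_elim
    case (elim \<xi>)
    then have "weight \<phi> \<xi> \<le> ennreal b" using b by simp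
    also have "\<dots> \<le> ennreal (b + 1)" by (intro ennreal_leI) simp
    finally show ?case .
  qed
  then show "\<exists>b::real. 0 < b \<and> (AE \<xi> in torus_measure. weight \<phi> \<xi> \<le> ennreal b)"
    using b by (intro exI[of _ "b + 1"]) auto
next
  assume "\<exists>b::real. 0 < b \<and> (AE \<xi> in torus_measure. weight \<phi> \<xi> \<le> ennreal b)"
  then obtain b where b: "AE \<xi> in torus_measure. weight \<phi> \<xi> \<le> ennreal b" by auto
  have "esssup torus_measure (weight \<phi>) \<le> ennreal b"
    by (rule esssup_I) (use b in auto)
  then show "esssup torus_measure (weight \<phi>) < \<infinity>"
    by (auto intro: order_le_less_trans)
qed

lemma norm_lin_comb_le:
  assumes b: "AE \<xi> in torus_measure. weight \<phi> \<xi> \<le> ennreal b" "b > 0" and A: "finite A" "finite B"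
  shows "l2sq lborel (lin_comb A B c) \<le> ennreal (b * (\<Sum>j\<in>A \<times> B. (cmod (c j))\<^sup>2))"
proof -
  have "l2sq lborel (lin_comb A B c) = (\<Sum>l\<in>B. l2sq weighted_torus (trig_poly A (row c l)))"
    by (rule norm_lin_comb[OF A])
  also have "\<dots> \<le> (\<Sum>l\<in>B. ennreal b * ennreal (\<Sum>k\<in>A. (cmod (c (k, l)))\<^sup>2))"
  proof (rule sum_mono)
    fix l
    let ?P = "trig_poly A (row c l)"
    have "l2sq weighted_torus ?P = (\<integral>\<^sup>+ \<xi>. weight \<phi> \<xi> * ennreal ((cmod (?P \<xi>))\<^sup>2) \<partial>torus_measure)"
      by (rule l2sq_weighted) measurable
    also have "\<dots> \<le> (\<integral>\<^sup>+ \<xi>. ennreal b * ennreal ((cmod (?P \<xi>))\<^sup>2) \<partial>torus_measure)"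
      using b(1) by (intro nn_integral_mono_AE) (auto elim!: eventually_mono intro: mult_right_mono)
    also have "\<dots> = ennreal b * l2sq torus_measure ?P"
      unfolding l2sq_def by (rule nn_integral_cmult) measurable
    finally show "l2sq weighted_torus ?P \<le> ennreal b * ennreal (\<Sum>k\<in>A. (cmod (c (k, l)))\<^sup>2)"
      using A by (simp add: trig_poly_l2sq)
  qed
  also have "\<dots> = ennreal (b * (\<Sum>l\<in>B. \<Sum>k\<in>A. (cmod (c (k, l)))\<^sup>2))"
    using b(2) by (simp add: sum_nonneg sum_distrib_left flip: ennreal_mult)
  also have "(\<Sum>l\<in>B. \<Sum>k\<in>A. (cmod (c (k, l)))\<^sup>2) = (\<Sum>j\<in>A \<times> B. (cmod (c j))\<^sup>2)"
    by (subst sum.swap) (simp add: sum.cartesian_product')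
  finally show ?thesis .
qed

text \<open>Duality: testing \<open>f\<close> against the combination with coefficients \<open>\<langle>f, T\<^sub>j \<phi>\<rangle>\<close>.\<close>

lemma bessel_if_weight_bounded:
  assumes b: "AE \<xi> in torus_measure. weight \<phi> \<xi> \<le> ennreal b" "b > 0"
  shows "bessel_sequence (twisted_system \<phi>)"
  unfolding bessel_sequence_def
proof (intro exI[of _ b] conjI ballI b(2))
  fix f :: "(real^'n) \<times> (real^'n) \<Rightarrow> complex" assume f: "f \<in> L2"
  define x where "x j = L2_inner f (twisted_translate j \<phi>)" for j
  let ?F = "(L2_norm f)\<^sup>2"
  have fin: "(\<Sum>j\<in>index_cube N. ennreal ((cmod (x j))\<^sup>2)) \<le> ennreal (b * ?F)" for N
  proof -
    define S where "S = (\<Sum>j\<in>index_cube N. (cmod (x j))\<^sup>2)"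
    have S0: "S \<ge> 0" unfolding S_def by (intro sum_nonneg) auto
    let ?g = "lin_comb (kcube N) (kcube N) x"
    have gL: "?g \<in> L2" by (intro lin_comb_L2) auto
    have "L2_inner f ?g = (\<Sum>j\<in>index_cube N. cnj (x j) * x j)"
      unfolding lin_comb_def[abs_def] x_def index_cube_eq
      by (intro L2_inner_sum_right f translate_phi_L2) auto
    also have "\<dots> = complex_of_real S"
      unfolding S_def of_real_sum complex_norm_square by (simp add: mult.commute)
    finally have "(cmod (L2_inner f ?g))\<^sup>2 = S\<^sup>2" by simp
    then have "ennreal (S\<^sup>2) \<le> l2sq lborel f * l2sq lborel ?g"
      using l2_Cauchy_Schwarz(2)[of f lborel ?g] f gL by (simp add: L2_iff L2_inner_def)
    also have "\<dots> \<le> ennreal ?F * ennreal (b * S)"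
      using norm_lin_comb_le[OF b, of "kcube N" "kcube N" x] L2_norm_l2sq[OF f]
      by (intro mult_mono) (auto simp: S_def index_cube_eq)
    also have "\<dots> = ennreal (?F * (b * S))"
      using b(2) S0 by (simp flip: ennreal_mult)
    finally have "S\<^sup>2 \<le> ?F * (b * S)"
      using b(2) S0 by (subst (asm) ennreal_le_iff) auto
    then have "S \<le> b * ?F"
      using S0 b(2) by (cases "S = 0") (auto simp: power2_eq_square mult_ac)
    then show ?thesis
      by (simp add: S_def ennreal_leI)
  qed
  have "(\<lambda>N. \<Sum>j\<in>index_cube N. ennreal ((cmod (x j))\<^sup>2)) \<longlonglongrightarrow> (\<integral>\<^sup>+ j. ennreal ((cmod (x j))\<^sup>2) \<partial>count_space UNIV)"
    by (rule nn_integral_count_space_limit) (use index_cube_exhausts in auto)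
  then have "(\<integral>\<^sup>+ j. ennreal ((cmod (x j))\<^sup>2) \<partial>count_space UNIV) \<le> ennreal (b * ?F)"
    by (rule LIMSEQ_le_const2) (use fin in auto)
  then show "(\<Sum>\<^sub>\<infinity>j\<in>UNIV. ennreal ((cmod (L2_inner f (twisted_translate j \<phi>)))\<^sup>2)) \<le> ennreal (b * ?F)"
    by (simp add: infsum_ennreal_eq_nn_integral x_def)
qed

text \<open>The dual argument: \<open>\<parallel>f\<parallel>\<^sup>2 = \<Sum>j. cnj (c j) \<langle>f, T\<^sub>j \<phi>\<rangle>\<close> is at most \<open>\<parallel>c\<parallel> * sqrt B * \<parallel>f\<parallel>\<close>.\<close>

lemma norm_lin_comb_le_if_bessel:
  assumes B: "B > 0" "\<And>f. f \<in> L2 \<Longrightarrow>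
      (\<Sum>\<^sub>\<infinity>j\<in>UNIV. ennreal ((cmod (L2_inner f (twisted_translate j \<phi>)))\<^sup>2)) \<le> ennreal (B * (L2_norm f)\<^sup>2)"
  shows "l2sq lborel (lin_comb (kcube N) (kcube N) c) \<le> ennreal (B * (\<Sum>j\<in>index_cube N. (cmod (c j))\<^sup>2))"
proof -
  let ?f = "lin_comb (kcube N) (kcube N) c"
  define x where "x j = L2_inner ?f (twisted_translate j \<phi>)" for j
  define F where "F = (L2_norm ?f)\<^sup>2"
  define S where "S = (\<Sum>j\<in>index_cube N. (cmod (c j))\<^sup>2)"
  have S0: "S \<ge> 0" unfolding S_def by (intro sum_nonneg) auto
  have f: "?f \<in> L2" by (intro lin_comb_L2) auto
  have F: "l2sq lborel ?f = ennreal F" "F \<ge> 0"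
    using L2_norm_l2sq[OF f] by (simp_all add: F_def)
  have "complex_of_real F = L2_inner ?f ?f"
    using l2sq_eq_integral[of ?f lborel] f F by (simp add: L2_inner_def L2_iff)
  also have "\<dots> = (\<Sum>j\<in>index_cube N. cnj (c j) * x j)"
    using L2_inner_sum_right[of "kcube N \<times> kcube N" ?f "\<lambda>j. twisted_translate j \<phi>" c] f translate_phi_L2
    unfolding lin_comb_def[abs_def] x_def index_cube_eq by simp
  finally have "F = cmod (\<Sum>j\<in>index_cube N. cnj (c j) * x j)"
    using F(2) by (metis norm_of_real abs_of_nonneg)
  also have "\<dots> \<le> (\<Sum>j\<in>index_cube N. cmod (c j) * cmod (x j))"
    by (rule order_trans[OF norm_sum]) (simp add: norm_mult)
  finally have "F\<^sup>2 \<le> (\<Sum>j\<in>index_cube N. cmod (c j) * cmod (x j))\<^sup>2"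
    using F(2) by (rule power_mono)
  also have "\<dots> \<le> S * (\<Sum>j\<in>index_cube N. (cmod (x j))\<^sup>2)"
    unfolding S_def by (rule Cauchy_Schwarz_ineq_sum)
  also have "\<dots> \<le> S * (B * F)"
  proof (intro mult_left_mono S0)
    have "(\<Sum>j\<in>index_cube N. ennreal ((cmod (x j))\<^sup>2)) \<le> (\<integral>\<^sup>+ j. ennreal ((cmod (x j))\<^sup>2) \<partial>count_space UNIV)"
    proof (rule incseq_le[OF _ nn_integral_count_space_limit])
      show "incseq (\<lambda>N. \<Sum>j\<in>index_cube N. ennreal ((cmod (x j))\<^sup>2))"
        unfolding incseq_def
        by (intro allI impI sum_mono2) (use index_cube_exhausts(1) in \<open>auto simp: incseq_def\<close>)
    qed (use index_cube_exhausts in auto)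
    also have "\<dots> \<le> ennreal (B * F)"
      using B(2)[OF f] by (simp add: infsum_ennreal_eq_nn_integral x_def F_def)
    finally show "(\<Sum>j\<in>index_cube N. (cmod (x j))\<^sup>2) \<le> B * F"
      using B(1) F(2) by (simp add: sum_nonneg)
  qed
  finally have "F\<^sup>2 \<le> S * (B * F)" .
  then have "F \<le> B * S"
    using F(2) S0 B(1) by (cases "F = 0") (auto simp: power2_eq_square mult_ac)
  then show ?thesis unfolding F S_def[symmetric] by (rule ennreal_leI)
qed

lemma L2_series_iff:
  "L2_series c (twisted_system \<phi>) f \<longleftrightarrow> (\<lambda>N. l2sq lborel (\<lambda>z. lin_comb (kcube N) (kcube N) c z - f z)) \<longlonglongrightarrow> 0"
  unfolding L2_series_def L2_tendsto_iff lin_comb_def index_cube_eq ..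

text \<open>The bound on finite combinations, applied to differences of partial sums, is the Cauchy
  criterion.\<close>

lemma hilbertian_if_bessel:
  assumes "bessel_sequence (twisted_system \<phi>)"
  shows "hilbertian (twisted_system \<phi>)"
  unfolding hilbertian_def
proof (intro allI impI)
  fix c :: "(int^'n) \<times> (int^'n) \<Rightarrow> complex" assume c: "c \<in> ell2"
  obtain B where B: "B > 0" "\<And>f. f \<in> L2 \<Longrightarrow>
      (\<Sum>\<^sub>\<infinity>j\<in>UNIV. ennreal ((cmod (L2_inner f (twisted_translate j \<phi>)))\<^sup>2)) \<le> ennreal (B * (L2_norm f)\<^sup>2)"
    using assms unfolding bessel_sequence_def by blast
  let ?S = "\<lambda>N. lin_comb (kcube N) (kcube N) c"
  define s where "s N = (\<Sum>j\<in>index_cube N. (cmod (c j))\<^sup>2)" for N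
  have sm: "(\<lambda>j. (cmod (c j))\<^sup>2) summable_on UNIV" using c by (simp add: ell2_def)
  have inc: "incseq s"
    unfolding s_def using index_cube_exhausts(1) by (auto simp: incseq_def intro!: sum_mono2)
  have bdd: "s N \<le> (\<Sum>\<^sub>\<infinity>j\<in>UNIV. (cmod (c j))\<^sup>2)" for N
    unfolding s_def by (rule finite_sum_le_infsum[OF sm]) auto
  obtain L where "s \<longlonglongrightarrow> L"
    by (rule incseq_convergent[OF inc]) (use bdd in auto)
  then have cau: "Cauchy s" by (rule LIMSEQ_imp_Cauchy)
  have diff: "l2sq lborel (\<lambda>z. ?S m z - ?S n z) \<le> ennreal (B * \<bar>s m - s n\<bar>)" for m n
  proof -
    have le: "l2sq lborel (\<lambda>z. ?S m z - ?S n z) \<le> ennreal (B * (s m - s n))" if "n \<le> m" for m n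
    proof -
      have sub: "index_cube n \<subseteq> (index_cube m :: ((int^'n) \<times> (int^'n)) set)"
        using that index_cube_exhausts(1) by (auto simp: incseq_def)
      define c' where "c' j = (if j \<in> index_cube n then 0 else c j)" for j
      have "?S n = lin_comb (kcube m) (kcube m) (\<lambda>j. if j \<in> index_cube n then c j else 0)"
        unfolding index_cube_eq by (intro lin_comb_superset kcube_mono that finite_kcube)
      then have "(\<lambda>z. ?S m z - ?S n z) = lin_comb (kcube m) (kcube m) c'"
        by (simp add: lin_comb_def fun_eq_iff c'_def flip: sum_subtractf) (auto intro!: sum.cong)
      then have "l2sq lborel (\<lambda>z. ?S m z - ?S n z) \<le> ennreal (B * (\<Sum>j\<in>index_cube m. (cmod (c' j))\<^sup>2))"
        using norm_lin_comb_le_if_bessel[OF B, of m c'] by simp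
      also have "(\<Sum>j\<in>index_cube m. (cmod (c' j))\<^sup>2) = (\<Sum>j\<in>index_cube m - index_cube n. (cmod (c j))\<^sup>2)"
        by (intro sum.mono_neutral_cong_right) (auto simp: c'_def)
      also have "\<dots> = s m - s n"
        unfolding s_def using sub by (intro sum_diff) auto
      finally show ?thesis .
    qed
    show ?thesis
    proof (cases "n \<le> m")
      case True
      have "B * (s m - s n) \<le> B * \<bar>s m - s n\<bar>" using B(1) by (intro mult_left_mono) auto
      then show ?thesis using le[OF True] by (meson ennreal_leI order_trans)
    next
      case False
      have "B * (s n - s m) \<le> B * \<bar>s m - s n\<bar>" using B(1) by (intro mult_left_mono) auto
      then show ?thesis using le[of m n] False unfolding l2sq_minus_commute[of lborel "?S m"]
        by (meson ennreal_leI order_trans nat_le_linear)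
    qed
  qed
  have "\<exists>N. \<forall>m\<ge>N. \<forall>n\<ge>N. l2sq lborel (\<lambda>z. ?S m z - ?S n z) \<le> ennreal e" if e: "e > 0" for e :: real
  proof -
    obtain N where N: "\<And>m n. m \<ge> N \<Longrightarrow> n \<ge> N \<Longrightarrow> \<bar>s m - s n\<bar> < e / B"
      using CauchyD[OF cau, of "e / B"] e B(1) by auto
    have "l2sq lborel (\<lambda>z. ?S m z - ?S n z) \<le> ennreal e" if "m \<ge> N" "n \<ge> N" for m n
    proof -
      have "B * \<bar>s m - s n\<bar> \<le> e" using N[OF that] B(1) by (simp add: field_simps less_imp_le)
      then show ?thesis using diff[of m n] by (meson ennreal_leI order_trans)
    qed
    then show ?thesis by blast
  qed
  then obtain f where f: "f \<in> borel_measurable lborel" "(\<lambda>N. l2sq lborel (\<lambda>z. ?S N z - f z)) \<longlonglongrightarrow> 0"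
    by (rule l2_complete[of ?S lborel, rotated]) auto
  have "f \<in> L2" by (rule L2_limit[OF f]) (auto intro: lin_comb_L2)
  then show "L2_series_converges c (twisted_system \<phi>)"
    unfolding L2_series_converges_def L2_series_iff using f(2) by blast
qed

lemma row_norm_le:
  assumes "0 \<in> B" "finite A" "finite B"
  shows "l2sq weighted_torus (trig_poly A (\<lambda>k. c (k, 0))) \<le> l2sq lborel (lin_comb A B c)"
proof -
  have "l2sq weighted_torus (trig_poly A (row c 0)) \<le> (\<Sum>l\<in>B. l2sq weighted_torus (trig_poly A (row c l)))"
    using assms by (intro member_le_sum) auto
  moreover have "row c 0 = (\<lambda>k. c (k, 0))" by (simp add: fun_eq_iff)
  ultimately show ?thesis using assms by (simp add: norm_lin_comb)
qed

lemma AE_weighted: "AE \<xi> in torus_measure. P \<xi> \<Longrightarrow> AE \<xi> in weighted_torus. P \<xi>"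
  unfolding weighted_torus_def by (subst AE_density) (auto elim: eventually_mono)

lemma zero_in_kcube [simp]: "0 \<in> kcube N"
  by (simp add: kcube_def)

text \<open>A square integrable \<open>C\<close> on the torus is the limit of its partial Fourier sums. If the
  corresponding series of translates of \<open>\<phi>\<close> converges, these sums stay bounded in the weighted
  norm, so Fatou's lemma puts \<open>C\<close> into the weighted space; this happens for every \<open>C\<close> only if the
  weight is bounded.\<close>

lemma weight_bounded_if_hilbertian:
  assumes hil: "hilbertian (twisted_system \<phi>)"
  shows "\<exists>b::real. 0 < b \<and> (AE \<xi> in torus_measure. weight \<phi> \<xi> \<le> ennreal b)"
proof (rule essentially_bounded_if_L1_multiplier[OF finite_measure_torus])
  show "weight \<phi> \<in> borel_measurable torus_measure" by measurable
  fix D :: "real^'n \<Rightarrow> real"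
  assume Dm [measurable]: "D \<in> borel_measurable torus_measure" and D0: "\<And>x. 0 \<le> D x"
    and Dfin: "(\<integral>\<^sup>+ x. ennreal (D x) \<partial>torus_measure) < top"
  define C where "C \<xi> = complex_of_real (sqrt (D \<xi>))" for \<xi>
  have Cm [measurable]: "C \<in> borel_measurable torus_measure" unfolding C_def by measurable
  have C2: "(cmod (C \<xi>))\<^sup>2 = D \<xi>" for \<xi> using D0[of \<xi>] by (simp add: C_def)
  have Cfin: "l2sq torus_measure C < top" using Dfin by (simp add: l2sq_def C2)
  define a where "a = fourier_coeff C"
  define c :: "(int^'n) \<times> (int^'n) \<Rightarrow> complex" where "c j = (if snd j = 0 then a (fst j) else 0)" for j
  have c0: "c (k, 0) = a k" for k by (simp add: c_def)
  obtain q where q: "l2sq torus_measure C = ennreal q" "q \<ge> 0"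
    using Cfin by (cases "l2sq torus_measure C") auto
  have a_le: "(\<Sum>k\<in>F. (cmod (a k))\<^sup>2) \<le> q" if "finite F" for F
  proof -
    have "ennreal (\<Sum>k\<in>F. (cmod (a k))\<^sup>2) \<le> l2sq torus_measure C"
      unfolding fourier_projection(1)[OF Cm Cfin that] a_def by simp
    then show ?thesis using q by simp
  qed
  have "c \<in> ell2"
    unfolding ell2_def
  proof (intro CollectI nonneg_bdd_above_summable_on bdd_aboveI[of _ q])
    fix x assume "x \<in> sum (\<lambda>j. (cmod (c j))\<^sup>2) ` {F. F \<subseteq> UNIV \<and> finite F}"
    then obtain F where F: "finite F" "x = (\<Sum>j\<in>F. (cmod (c j))\<^sup>2)" by auto
    have "x \<le> (\<Sum>j\<in>fst ` F \<times> {0}. (cmod (c j))\<^sup>2)"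
    proof -
      have "x = (\<Sum>j\<in>{j\<in>F. snd j = 0}. (cmod (c j))\<^sup>2)"
        unfolding F(2) using F(1) by (intro sum.mono_neutral_cong_right) (auto simp: c_def)
      also have "\<dots> \<le> (\<Sum>j\<in>fst ` F \<times> {0}. (cmod (c j))\<^sup>2)"
        using F(1) by (intro sum_mono2) force+
      finally show ?thesis .
    qed
    also have "\<dots> = (\<Sum>k\<in>fst ` F. (cmod (a k))\<^sup>2)"
      by (simp add: sum.cartesian_product' c0)
    also have "\<dots> \<le> q" using F(1) by (intro a_le) auto
    finally show "x \<le> q" .
  qed auto
  then obtain f where f: "f \<in> L2" "(\<lambda>N. l2sq lborel (\<lambda>z. lin_comb (kcube N) (kcube N) c z - f z)) \<longlonglongrightarrow> 0"
    using hil unfolding hilbertian_def L2_series_converges_def L2_series_iff by blast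
  have [measurable]: "f \<in> borel_measurable borel" and ff: "l2sq lborel f < top"
    using f(1) by (auto simp: L2_iff)
  have lim: "(\<lambda>N. l2sq lborel (lin_comb (kcube N) (kcube N) c)) \<longlonglongrightarrow> l2sq lborel f"
    by (rule l2sq_tendsto[OF _ _ f(2) ff]) auto
  have less: "l2sq lborel f < l2sq lborel f + 1"
    using ff by (cases "l2sq lborel f") (auto simp flip: ennreal_plus ennreal_1 intro!: ennreal_lessI)
  obtain N0 where N0: "\<And>N. N \<ge> N0 \<Longrightarrow> l2sq lborel (lin_comb (kcube N) (kcube N) c) < l2sq lborel f + 1"
    using order_tendstoD(2)[OF lim less] by (auto simp: eventually_sequentially)
  obtain r :: "nat \<Rightarrow> nat" where r: "strict_mono r"
    "AE \<xi> in torus_measure. (\<lambda>n. trig_poly (kcube (r n)) a \<xi>) \<longlonglongrightarrow> C \<xi>"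
    by (rule l2_tendsto_subseq_AE[OF _ Cm fourier_series_tendsto[OF Cm Cfin]]) (auto simp: a_def)
  have "l2sq weighted_torus C \<le> l2sq lborel f + 1"
  proof (rule l2_Fatou[where F = "\<lambda>n. trig_poly (kcube (r (n + N0))) a"])
    show "C \<in> borel_measurable weighted_torus" by (simp add: measurable_weighted_iff)
    show "AE \<xi> in weighted_torus. (\<lambda>n. trig_poly (kcube (r (n + N0))) a \<xi>) \<longlonglongrightarrow> C \<xi>"
      by (rule AE_weighted) (use r(2) in \<open>auto elim!: eventually_mono intro: LIMSEQ_ignore_initial_segment\<close>)
    fix n
    have "r (n + N0) \<ge> N0" using seq_suble[OF r(1), of "n + N0"] by simp
    then have "l2sq lborel (lin_comb (kcube (r (n + N0))) (kcube (r (n + N0))) c) \<le> l2sq lborel f + 1"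
      using N0 less_imp_le by blast
    with row_norm_le[of "kcube (r (n + N0))" "kcube (r (n + N0))" c]
    show "l2sq weighted_torus (trig_poly (kcube (r (n + N0))) a) \<le> l2sq lborel f + 1"
      by (simp add: c0)
  qed measurable
  also have "\<dots> < top" using ff by simp
  finally show "(\<integral>\<^sup>+ x. ennreal (D x) * weight \<phi> x \<partial>torus_measure) < top"
    by (simp add: l2sq_weighted C2 mult.commute)
qed

theorem hilbertian_iff: "hilbertian (twisted_system \<phi>) \<longleftrightarrow> esssup torus_measure (weight \<phi>) < \<infinity>"
  and bessel_iff: "esssup torus_measure (weight \<phi>) < \<infinity> \<longleftrightarrow> bessel_sequence (twisted_system \<phi>)"
  unfolding esssup_weight_iff
  using weight_bounded_if_hilbertian bessel_if_weight_bounded hilbertian_if_bessel by blast+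

lemma nn_integral_weighted:
  assumes [measurable]: "g \<in> borel_measurable torus_measure"
  shows "(\<integral>\<^sup>+ \<xi>. g \<xi> \<partial>weighted_torus) = (\<integral>\<^sup>+ \<xi>. weight \<phi> \<xi> * g \<xi> \<partial>torus_measure)"
  unfolding weighted_torus_def by (rule nn_integral_density) auto

lemma integral_weighted:
  fixes g :: "real^'n \<Rightarrow> complex"
  assumes [measurable]: "g \<in> borel_measurable torus_measure"
  shows "(LINT \<xi>|weighted_torus. g \<xi>) = (LINT \<xi>|torus_measure. enn2real (weight \<phi> \<xi>) *\<^sub>R g \<xi>)"
proof -
  have "weighted_torus = density torus_measure (\<lambda>\<xi>. ennreal (enn2real (weight \<phi> \<xi>)))"
    unfolding weighted_torus_def
    by (rule density_cong) (use weight_finite_AE in \<open>auto elim: eventually_mono\<close>)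
  then show ?thesis by (simp add: integral_density)
qed

text \<open>Coefficients of a series in the translates of a dual function are recovered by pairing the
  sum with the translates of \<open>\<phi>\<close>.\<close>

lemma besselian_dual:
  assumes dual: "canonical_dual \<phi> \<psi>" and bessel: "bessel_sequence (twisted_system \<phi>)"
  shows "besselian (twisted_system \<psi>)"
  unfolding besselian_def
proof (intro allI impI)
  fix c assume "L2_series_converges c (twisted_system \<psi>)"
  then obtain f where f: "f \<in> L2"
    and lim: "(\<lambda>N. l2sq lborel (\<lambda>z. (\<Sum>j\<in>index_cube N. c j * twisted_translate j \<psi> z) - f z)) \<longlonglongrightarrow> 0"
    unfolding L2_series_converges_def L2_series_def L2_tendsto_iff by blast
  have psi: "twisted_translate j \<psi> \<in> L2" for j
    using dual by (intro twisted_translate_L2) (simp add: canonical_dual_def)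
  define S where "S N z = (\<Sum>j\<in>index_cube N. c j * twisted_translate j \<psi> z)" for N z
  have SL: "S N \<in> L2" for N
    unfolding S_def[abs_def] by (intro L2_sum psi) auto
  have coeff: "L2_inner f (twisted_translate i \<phi>) = c i" for i
  proof (rule LIMSEQ_unique)
    show "(\<lambda>N. L2_inner (S N) (twisted_translate i \<phi>)) \<longlonglongrightarrow> L2_inner f (twisted_translate i \<phi>)"
      unfolding L2_inner_def
      by (rule l2_inner_tendsto[OF _ _ _ _ _ _ lim[folded S_def]])
         (use f SL translate_phi_L2[of i] in \<open>auto simp: L2_iff\<close>)
    obtain N0 where N0: "i \<in> index_cube N0" using index_cube_exhausts(2) by blast
    have "L2_inner (S N) (twisted_translate i \<phi>) = c i" if "N \<ge> N0" for N
    proof -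
      have i: "i \<in> index_cube N" using N0 index_cube_exhausts(1) that by (auto simp: incseq_def)
      have "L2_inner (S N) (twisted_translate i \<phi>)
          = (\<Sum>j\<in>index_cube N. c j * L2_inner (twisted_translate j \<psi>) (twisted_translate i \<phi>))"
        unfolding S_def[abs_def] by (intro L2_inner_sum_left psi translate_phi_L2) auto
      also have "\<dots> = (\<Sum>j\<in>index_cube N. if j = i then c i else 0)"
        by (intro sum.cong refl) (simp add: canonical_dual_biorthogonal[OF dual phi])
      finally show ?thesis using i by simp
    qed
    then show "(\<lambda>N. L2_inner (S N) (twisted_translate i \<phi>)) \<longlonglongrightarrow> c i"
      by (intro tendsto_eventually) (auto simp: eventually_sequentially)
  qed
  obtain B where "(\<Sum>\<^sub>\<infinity>j\<in>UNIV. ennreal ((cmod (L2_inner f (twisted_translate j \<phi>)))\<^sup>2)) \<le> ennreal (B * (L2_norm f)\<^sup>2)"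
    using bessel f unfolding bessel_sequence_def by blast
  then have "(\<integral>\<^sup>+ j. ennreal ((cmod (c j))\<^sup>2) \<partial>count_space UNIV) < top"
    unfolding infsum_ennreal_eq_nn_integral coeff by (auto intro: order_le_less_trans)
  then have "((\<lambda>j. enn2real (ennreal ((cmod (c j))\<^sup>2))) has_sum
      enn2real (\<integral>\<^sup>+ j. ennreal ((cmod (c j))\<^sup>2) \<partial>count_space UNIV)) UNIV"
    by (rule has_sum_enn2real)
  then show "c \<in> ell2"
    unfolding ell2_def by (simp add: has_sum_imp_summable)
qed

end

section \<open>Integrability and boundedness of the inverse weight\<close>

locale orthogonal_twisted_system_inverse = orthogonal_twisted_system \<phi>
  for \<phi> :: "(real^'n) \<times> (real^'n) \<Rightarrow> complex" +
  assumes inverse_weight: "(\<integral>\<^sup>+ \<xi>. 1 / weight \<phi> \<xi> \<partial>torus_measure) < \<infinity>"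
begin

lemma weight_positive_AE: "AE \<xi> in torus_measure. 0 < weight \<phi> \<xi> \<and> weight \<phi> \<xi> < top"
proof -
  have "AE \<xi> in torus_measure. 1 / weight \<phi> \<xi> \<noteq> \<infinity>"
    using inverse_weight by (intro nn_integral_PInf_AE) auto
  with weight_finite_AE show ?thesis
    by eventually_elim (auto simp: zero_less_iff_neq_zero ennreal_divide_zero)
qed

lemma weight_times_inverse_AE: "AE \<xi> in torus_measure. weight \<phi> \<xi> * (1 / weight \<phi> \<xi>) = 1"
  using weight_positive_AE
proof eventually_elim
  case (elim \<xi>)
  then have "weight \<phi> \<xi> / weight \<phi> \<xi> = 1" by (intro ennreal_divide_self) auto
  then show ?case by (simp add: ennreal_times_divide)
qed

lemma AE_weighted_iff: "(AE \<xi> in weighted_torus. P \<xi>) \<longleftrightarrow> (AE \<xi> in torus_measure. P \<xi>)"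
proof
  assume "AE \<xi> in weighted_torus. P \<xi>"
  then have "AE \<xi> in torus_measure. 0 < weight \<phi> \<xi> \<longrightarrow> P \<xi>"
    unfolding weighted_torus_def by (subst (asm) AE_density) auto
  with weight_positive_AE show "AE \<xi> in torus_measure. P \<xi>"
    by eventually_elim auto
qed (rule AE_weighted)

text \<open>The dual function is the one with symbol \<open>1/w\<close>, which lies in the weighted space because
  \<open>|1/w|\<^sup>2 w = 1/w\<close> is integrable.\<close>

theorem canonical_dual_exists:
  obtains \<psi> where "\<psi> \<in> twisted_closed_span \<phi>" "canonical_dual \<phi> \<psi>"
proof -
  define C where "C \<xi> = complex_of_real (enn2real (1 / weight \<phi> \<xi>))" for \<xi>
  have Cm [measurable]: "C \<in> borel_measurable torus_measure" unfolding C_def by measurable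
  have "l2sq weighted_torus C = (\<integral>\<^sup>+ \<xi>. weight \<phi> \<xi> * ennreal ((cmod (C \<xi>))\<^sup>2) \<partial>torus_measure)"
    by (rule l2sq_weighted) measurable
  also have "\<dots> = (\<integral>\<^sup>+ \<xi>. 1 / weight \<phi> \<xi> \<partial>torus_measure)"
  proof (rule nn_integral_cong_AE)
    show "AE \<xi> in torus_measure. weight \<phi> \<xi> * ennreal ((cmod (C \<xi>))\<^sup>2) = 1 / weight \<phi> \<xi>"
      using weight_positive_AE weight_times_inverse_AE
    proof eventually_elim
      case (elim \<xi>)
      then have "1 / weight \<phi> \<xi> < top"
        by (auto simp: less_top[symmetric] ennreal_divide_eq_top_iff)
      then have "ennreal ((cmod (C \<xi>))\<^sup>2) = (1 / weight \<phi> \<xi>) * (1 / weight \<phi> \<xi>)"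
        by (simp add: C_def power2_eq_square ennreal_mult)
      then show ?case using elim(2) by (simp add: mult.assoc[symmetric])
    qed
  qed
  finally have Cfin: "l2sq weighted_torus C < top" using inverse_weight by simp
  have Cm': "C \<in> borel_measurable weighted_torus" by (simp add: measurable_weighted_iff)
  obtain \<psi> A p where psi: "\<psi> \<in> twisted_closed_span \<phi>" and A: "\<And>n::nat. finite (A n)"
    and lim: "(\<lambda>n. l2sq lborel (\<lambda>z. row_comb (A n) (p n) z - \<psi> z)) \<longlonglongrightarrow> 0"
      "(\<lambda>n. l2sq weighted_torus (\<lambda>\<xi>. trig_poly (A n) (p n) \<xi> - C \<xi>)) \<longlonglongrightarrow> 0"
    by (rule symbol_realized[OF Cm' Cfin]) (rule that)
  have psiL: "\<psi> \<in> L2" using psi by (simp add: twisted_closed_span_def)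
  have [measurable]: "\<psi> \<in> borel_measurable borel" using psiL by (rule L2_measurable)
  have rL: "row_comb (A n) (p n) \<in> L2" for n
    unfolding row_comb_def[abs_def] by (intro L2_sum A translate_phi_L2)
  have inner: "L2_inner \<psi> (twisted_translate (k, l) \<phi>) = (if (k, l) = (0, 0) then 1 else 0)" for k l
  proof (rule LIMSEQ_unique)
    show "(\<lambda>n. L2_inner (row_comb (A n) (p n)) (twisted_translate (k, l) \<phi>))
        \<longlonglongrightarrow> L2_inner \<psi> (twisted_translate (k, l) \<phi>)"
      unfolding L2_inner_def
      by (rule l2_inner_tendsto[OF _ _ _ _ _ _ lim(1)])
         (use psiL rL translate_phi_L2[of "(k, l)"] in \<open>auto simp: L2_iff\<close>)
    have "(LINT \<xi>|weighted_torus. C \<xi> * cnj (character k \<xi>))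
        = (LINT \<xi>|torus_measure. enn2real (weight \<phi> \<xi>) *\<^sub>R (C \<xi> * cnj (character k \<xi>)))"
      by (rule integral_weighted) measurable
    also have "\<dots> = (LINT \<xi>|torus_measure. character (- k) \<xi>)"
    proof (rule integral_cong_AE)
      show "AE \<xi> in torus_measure. enn2real (weight \<phi> \<xi>) *\<^sub>R (C \<xi> * cnj (character k \<xi>)) = character (- k) \<xi>"
        using weight_times_inverse_AE
      proof eventually_elim
        case (elim \<xi>)
        have "enn2real (weight \<phi> \<xi>) * enn2real (1 / weight \<phi> \<xi>) = 1"
          using elim by (metis enn2real_mult enn2real_1)
        then have "complex_of_real (enn2real (weight \<phi> \<xi>)) * complex_of_real (enn2real (1 / weight \<phi> \<xi>)) = 1"
          by (metis of_real_mult of_real_1)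
        then show ?case
          unfolding scaleR_conv_of_real C_def mult.assoc[symmetric] by (simp add: cnj_character)
      qed
    qed measurable
    also have "\<dots> = (if k = 0 then 1 else 0)"
      by (simp add: integral_character)
    finally have CK: "(LINT \<xi>|weighted_torus. C \<xi> * cnj (character k \<xi>)) = (if k = 0 then 1 else 0)" .
    have "(\<lambda>n. LINT \<xi>|weighted_torus. trig_poly (A n) (p n) \<xi> * cnj (character k \<xi>))
        \<longlonglongrightarrow> (LINT \<xi>|weighted_torus. C \<xi> * cnj (character k \<xi>))"
      by (rule l2_inner_tendsto[OF _ Cm' _ trig_poly_weighted_finite Cfin
            l2sq_bounded_finite[OF weighted.finite_measure_axioms, of _ 1] lim(2)])
         (auto intro: weighted.measurable_M)
    then show "(\<lambda>n. L2_inner (row_comb (A n) (p n)) (twisted_translate (k, l) \<phi>))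
        \<longlonglongrightarrow> (if (k, l) = (0, 0) then 1 else 0)"
      unfolding inner_row_comb_translate[OF A] CK by (cases "l = 0") auto
  qed
  have "canonical_dual \<phi> \<psi>"
    unfolding canonical_dual_def
  proof (intro conjI allI psiL)
    fix k l :: "int^'n"
    have "L2_inner (twisted_translate (k, l) \<psi>) \<phi> = L2_inner \<psi> (twisted_translate (- k, - l) \<phi>)"
      by (rule inner_twisted_translate) measurable
    then show "L2_inner (twisted_translate (k, l) \<psi>) \<phi> = (if (k, l) = (0, 0) then 1 else 0)"
      by (simp add: inner)
  qed
  with psi show ?thesis by (rule that)
qed

text \<open>Conversely, let \<open>C\<close> be in the weighted space. The element of the closed span with symbol \<open>C\<close>
  has an expansion with square summable coefficients; the partial sums of its row \<open>l = 0\<close>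
  converge to \<open>C\<close> in the weighted norm, hence almost everywhere along a subsequence, and
  are bounded in the unweighted norm. So \<open>C\<close> is square integrable without the weight.\<close>

theorem inverse_weight_bounded:
  assumes bes: "besselian (twisted_system \<phi>)"
    and rep: "\<forall>\<psi>\<in>twisted_closed_span \<phi>. \<exists>c. L2_series c (twisted_system \<phi>) \<psi>"
  shows "esssup torus_measure (\<lambda>\<xi>. 1 / weight \<phi> \<xi>) < \<infinity>"
proof -
  have "\<exists>b::real. 0 < b \<and> (AE \<xi> in weighted_torus. 1 / weight \<phi> \<xi> \<le> ennreal b)"
  proof (rule essentially_bounded_if_L1_multiplier[OF weighted.finite_measure_axioms])
    have "(\<lambda>\<xi>. 1 / weight \<phi> \<xi>) \<in> borel_measurable torus_measure" by measurable
    then show "(\<lambda>\<xi>. 1 / weight \<phi> \<xi>) \<in> borel_measurable weighted_torus"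
      by (simp add: measurable_weighted_iff)
    fix D :: "real^'n \<Rightarrow> real"
    assume "D \<in> borel_measurable weighted_torus" and D0: "\<And>x. 0 \<le> D x"
      and Dfin: "(\<integral>\<^sup>+ x. ennreal (D x) \<partial>weighted_torus) < top"
    then have Dm [measurable]: "D \<in> borel_measurable torus_measure" by (simp add: weighted_torus_def)
    define C where "C \<xi> = complex_of_real (sqrt (D \<xi>))" for \<xi>
    have Cm [measurable]: "C \<in> borel_measurable torus_measure" unfolding C_def by measurable
    have Cm': "C \<in> borel_measurable weighted_torus" by (simp add: measurable_weighted_iff)
    have C2: "(cmod (C \<xi>))\<^sup>2 = D \<xi>" for \<xi> using D0[of \<xi>] by (simp add: C_def)
    have Cfin: "l2sq weighted_torus C < top" using Dfin by (simp add: l2sq_def C2)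
    obtain \<psi> A p where psi: "\<psi> \<in> twisted_closed_span \<phi>" and A: "\<And>n::nat. finite (A n)"
      and lim: "(\<lambda>n. l2sq lborel (\<lambda>z. row_comb (A n) (p n) z - \<psi> z)) \<longlonglongrightarrow> 0"
        "(\<lambda>n. l2sq weighted_torus (\<lambda>\<xi>. trig_poly (A n) (p n) \<xi> - C \<xi>)) \<longlonglongrightarrow> 0"
      by (rule symbol_realized[OF Cm' Cfin]) (rule that)
    have psiL: "\<psi> \<in> L2" using psi by (simp add: twisted_closed_span_def)
    have [measurable]: "\<psi> \<in> borel_measurable borel" using psiL by (rule L2_measurable)
    obtain c where c: "L2_series c (twisted_system \<phi>) \<psi>" using rep psi by blast
    then have c2: "c \<in> ell2"
      using bes psiL unfolding besselian_def L2_series_converges_def by blast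
    let ?P = "\<lambda>N. trig_poly (kcube N) (\<lambda>k. c (k, 0))"
    let ?S = "\<lambda>N. lin_comb (kcube N) (kcube N) c"
    have Slim: "(\<lambda>N. l2sq lborel (\<lambda>z. ?S N z - \<psi> z)) \<longlonglongrightarrow> 0"
      using c by (simp add: L2_series_iff)
    have lim': "(\<lambda>n. l2sq lborel (\<lambda>z. \<psi> z - row_comb (A n) (p n) z)) \<longlonglongrightarrow> 0"
      using lim(1) by (simp add: l2sq_minus_commute[of lborel \<psi>])
    have diff: "(\<lambda>N. l2sq lborel (\<lambda>z. ?S N z - row_comb (A N) (p N) z)) \<longlonglongrightarrow> 0"
      by (rule tendsto_0_ennreal_le[OF tendsto_0_ennreal_2_plus_2[OF Slim lim']],
          intro always_eventually allI l2sq_triangle) auto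
    have le: "l2sq weighted_torus (\<lambda>\<xi>. ?P N \<xi> - trig_poly (A N) (p N) \<xi>)
        \<le> l2sq lborel (\<lambda>z. ?S N z - row_comb (A N) (p N) z)" for N
    proof -
      let ?t = "\<lambda>l. l2sq weighted_torus (\<lambda>\<xi>. trig_poly (kcube N) (row c l) \<xi> - (if l = 0 then trig_poly (A N) (p N) \<xi> else 0))"
      have "?t 0 \<le> (\<Sum>l\<in>kcube N. ?t l)" by (rule member_le_sum) auto
      moreover have "row c 0 = (\<lambda>k. c (k, 0))" by (simp add: fun_eq_iff)
      ultimately show ?thesis
        by (simp add: norm_lin_comb_diff_row_comb A)
    qed
    have "(\<lambda>N. l2sq weighted_torus (\<lambda>\<xi>. ?P N \<xi> - trig_poly (A N) (p N) \<xi>)) \<longlonglongrightarrow> 0"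
      by (rule tendsto_0_ennreal_le[OF diff always_eventually[OF allI[OF le]]])
    from l2_tendsto_triangle[OF _ _ Cm' this lim(2)]
    have Plim: "(\<lambda>N. l2sq weighted_torus (\<lambda>\<xi>. ?P N \<xi> - C \<xi>)) \<longlonglongrightarrow> 0"
      by (auto intro: weighted.measurable_M)
    obtain r :: "nat \<Rightarrow> nat" where r: "strict_mono r"
      "AE \<xi> in weighted_torus. (\<lambda>n. ?P (r n) \<xi>) \<longlonglongrightarrow> C \<xi>"
      by (rule l2_tendsto_subseq_AE[OF _ Cm' Plim]) (auto intro: weighted.measurable_M)
    define s where "s = (\<Sum>\<^sub>\<infinity>j\<in>UNIV. (cmod (c j))\<^sup>2)"
    have bd: "l2sq torus_measure (?P N) \<le> ennreal s" for N
    proof -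
      have "(\<Sum>k\<in>kcube N. (cmod (c (k, 0)))\<^sup>2) = (\<Sum>j\<in>kcube N \<times> {0}. (cmod (c j))\<^sup>2)"
        by (simp add: sum.cartesian_product')
      also have "\<dots> \<le> s"
        unfolding s_def using c2 by (intro finite_sum_le_infsum) (auto simp: ell2_def)
      finally show ?thesis by (simp add: trig_poly_l2sq ennreal_leI)
    qed
    have "l2sq torus_measure C \<le> ennreal s"
      by (rule l2_Fatou[OF _ _ r(2)[unfolded AE_weighted_iff] bd]) auto
    then have "(\<integral>\<^sup>+ x. ennreal (D x) \<partial>torus_measure) < top"
      by (auto simp: l2sq_def C2 intro: order_le_less_trans)
    moreover have "(\<integral>\<^sup>+ x. ennreal (D x) * (1 / weight \<phi> x) \<partial>weighted_torus)
        = (\<integral>\<^sup>+ x. ennreal (D x) \<partial>torus_measure)"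
    proof -
      have "(\<integral>\<^sup>+ x. ennreal (D x) * (1 / weight \<phi> x) \<partial>weighted_torus)
          = (\<integral>\<^sup>+ x. weight \<phi> x * (ennreal (D x) * (1 / weight \<phi> x)) \<partial>torus_measure)"
        by (rule nn_integral_weighted) measurable
      also have "\<dots> = (\<integral>\<^sup>+ x. ennreal (D x) \<partial>torus_measure)"
      proof (rule nn_integral_cong_AE, use weight_times_inverse_AE in eventually_elim)
        case (elim x)
        then show ?case by (metis mult.left_commute mult.right_neutral)
      qed
      finally show ?thesis .
    qed
    ultimately show "(\<integral>\<^sup>+ x. ennreal (D x) * (1 / weight \<phi> x) \<partial>weighted_torus) < top" by simp
  qed
  then obtain b where b: "AE \<xi> in torus_measure. 1 / weight \<phi> \<xi> \<le> ennreal b"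
    unfolding AE_weighted_iff by blast
  have "esssup torus_measure (\<lambda>\<xi>. 1 / weight \<phi> \<xi>) \<le> ennreal b"
    by (rule esssup_I) (use b in auto)
  then show ?thesis by (auto intro: order_le_less_trans)
qed

end

theorem theorem5p4:
  fixes \<phi> :: "(real^'n) \<times> (real^'n) \<Rightarrow> complex"
  assumes "\<phi> \<in> L2"
    and "condition_C \<phi>"
    and "(\<integral>\<^sup>+ \<xi>. 1 / weight \<phi> \<xi> \<partial>torus_measure) < \<infinity>"
  shows "(hilbertian (twisted_system \<phi>) \<longleftrightarrow> esssup torus_measure (weight \<phi>) < \<infinity>)
    \<and> (esssup torus_measure (weight \<phi>) < \<infinity> \<longleftrightarrow> bessel_sequence (twisted_system \<phi>))
    \<and> (hilbertian (twisted_system \<phi>) \<or> esssup torus_measure (weight \<phi>) < \<infinity>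
          \<or> bessel_sequence (twisted_system \<phi>)
        \<longrightarrow> (\<exists>\<psi>\<in>twisted_closed_span \<phi>.
               canonical_dual \<phi> \<psi> \<and> besselian (twisted_system \<psi>)))
    \<and> (besselian (twisted_system \<phi>)
          \<and> (\<forall>\<psi>\<in>twisted_closed_span \<phi>. \<exists>c. L2_series c (twisted_system \<phi>) \<psi>)
        \<longrightarrow> esssup torus_measure (\<lambda>\<xi>. 1 / weight \<phi> \<xi>) < \<infinity>)"
proof -
  interpret orthogonal_twisted_system_inverse \<phi>
    by unfold_locales (fact assms)+
  obtain \<psi> where "\<psi> \<in> twisted_closed_span \<phi>" "canonical_dual \<phi> \<psi>"
    by (rule canonical_dual_exists)
  then show ?thesis
    using hilbertian_iff bessel_iff besselian_dual inverse_weight_bounded by blast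
qed

end
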